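(* Let $G$ be a finite group with cyclic center, let $(i,\alpha)$ and $(j,\beta)$ be cocentral actions of $\mathbb{Z}_2$ on $G$, and put $H=G/i(\widehat{\mathbb{Z}_2})=G/j(\widehat{\mathbb{Z}_2})$ (the two subgroups coincide because $Z(G)$ is cyclic). Assume that $H^2(H,k^\times)$ is cyclic and that $\mathrm{Hom}(H,\mathbb{Z}_2)=\{1\}$. Then the following assertions are equivalent. (1) The Hopf algebras $\mathcal{O}(G)^{i,\alpha}$ and $\mathcal{O}(G)^{j,\beta}$ are isomorphic. (2) The cocentral actions $(i,\alpha)$ and $(j,\beta)$ are equivalent. (3) The cocentral actions $(i,\alpha)$ and $(j,\beta)$ are weakly equivalent.
   Context: The base field $k$ is algebraically closed of characteristic zero. For a finite group $G$, $\mathcal{O}(G)$ is the Hopf algebra of functions $G\to k$. For a group $\Gamma$, $\widehat{\Gamma}=\mathrm{Hom}(\Gamma,k^\times)$. $H^2(H,k^\times)$ is group cohomology with trivial action. A cocentral action of a finite abelian group $\Gamma$ on a finite group $G$ is a pair $(i,\alpha)$ where $i:\widehat{\Gamma}\to Z(G)$ is an injective group morphism and $\alpha:\Gamma\to\mathrm{Aut}(G)$, $g\mapsto\alpha_g$, is a group morphism such that each $\alpha_g$ fixes every element of $i(\widehat{\Gamma})$. It gives a grading $\mathcal{O}(G)=\bigoplus_{g\in\Gamma}\mathcal{O}(G)_g$ with $\mathcal{O}(G)_g=\{\phi : \phi(x\,i(\chi))=\chi(g)\phi(x)\ \forall x\in G,\chi\in\widehat\Gamma\}$, and an action of $\Gamma$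 on $\mathcal{O}(G)$ by Hopf algebra automorphisms $\alpha_g(\phi)=\phi\circ\alpha_g^{-1}$. The graded twisting $\mathcal{O}(G)^{i,\alpha}$ is the Hopf algebra having $\mathcal{O}(G)$ as underlying coalgebra, with product $\phi\cdot\psi=\phi\,\alpha_g(\psi)$ for $\phi\in\mathcal{O}(G)_g$, $\psi\in\mathcal{O}(G)$, and antipode $\phi\mapsto\alpha_{g^{-1}}(S(\phi))$ for $\phi\in\mathcal{O}(G)_g$. Two cocentral actions $(i,\alpha)$, $(j,\beta)$ of $\Gamma$ on $G$ are equivalent if there exist $u\in\mathrm{Aut}(\Gamma)$ and $f\in\mathrm{Aut}(G)$ such that $i\circ\widehat{u}=f\circ j$ (where $\widehat{u}(\chi)=\chi\circ u$) and $f^{-1}\circ\alpha_g\circ f=\beta_{u(g)}$ for all $g\in\Gamma$. They are weakly equivalent if there exist $u\in\mathrm{Aut}(\Gamma)$ and a group isomorphism $f:G/j(\widehat{\Gamma})\to G/i(\widehat{\Gamma})$ such that $f^{-1}\circ\overline{\alpha}_g\circ f=\overline{\beta}_{u(g)}$ for all $g\in\Gamma$, where $\overline{\alpha}_g$ and $\overline{\beta}_{u(g)}$ are the automorphisms induced by $\alpha_g$ on $G/i(\widehat\Gamma)$ and by $\beta_{u(g)}$ on $G/j(\widehat\Gamma)$. *)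

theory Defs
  imports
    "HOL-Algebra.Algebra"
    "HOL-Algebra.Algebraic_Closure_Type"
    "HOL-Library.Poly_Mapping"
begin

text \<open>The base field is a type \<open>'k\<close> of class \<open>field\<close>; in the theorem it is moreover of class
  \<open>alg_closed_field\<close> and \<open>field_char_0\<close>.  Groups are groups in the sense of \<open>HOL-Algebra\<close>, and
  functions on a carrier are taken to be extensional, so that equality of functions is
  equality on the carrier.\<close>

section \<open>Groups\<close>

abbreviation field_units :: "'k::field monoid" where
  "field_units \<equiv> mult_of (ring_of_type_algebra :: 'k ring)"

definition hom_group :: "('c, 'x) monoid_scheme \<Rightarrow> ('m, 'y) monoid_scheme \<Rightarrow> ('c \<Rightarrow> 'm) monoid" where
  "hom_group \<Gamma> M =
    \<lparr>carrier = hom \<Gamma> M \<inter> extensional (carrier \<Gamma>),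
     monoid.mult = \<lambda>\<chi> \<psi>. \<lambda>g\<in>carrier \<Gamma>. \<chi> g \<otimes>\<^bsub>M\<^esub> \<psi> g,
     one = \<lambda>g\<in>carrier \<Gamma>. \<one>\<^bsub>M\<^esub>\<rparr>"

abbreviation dual_group :: "('c, 'x) monoid_scheme \<Rightarrow> ('c \<Rightarrow> 'k::field) monoid" where
  "dual_group \<Gamma> \<equiv> hom_group \<Gamma> field_units"

definition dual_map :: "('c, 'x) monoid_scheme \<Rightarrow> ('c \<Rightarrow> 'c) \<Rightarrow> ('c \<Rightarrow> 'k) \<Rightarrow> ('c \<Rightarrow> 'k)" where
  "dual_map \<Gamma> u \<chi> = compose (carrier \<Gamma>) \<chi> u"

definition group_center :: "('a, 'x) monoid_scheme \<Rightarrow> 'a set" where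
  "group_center G = {z \<in> carrier G. \<forall>x\<in>carrier G. z \<otimes>\<^bsub>G\<^esub> x = x \<otimes>\<^bsub>G\<^esub> z}"

text \<open>Second cohomology with coefficients in an abelian group with trivial action, by
  inhomogeneous cochains.\<close>

definition cocycle_group2 :: "('a, 'x) monoid_scheme \<Rightarrow> ('m, 'y) monoid_scheme \<Rightarrow> ('a \<times> 'a \<Rightarrow> 'm) monoid" where
  "cocycle_group2 H M =
    \<lparr>carrier = {\<sigma> \<in> carrier H \<times> carrier H \<rightarrow>\<^sub>E carrier M.
       \<forall>x\<in>carrier H. \<forall>y\<in>carrier H. \<forall>z\<in>carrier H.
         \<sigma> (y, z) \<otimes>\<^bsub>M\<^esub> \<sigma> (x, y \<otimes>\<^bsub>H\<^esub> z) = \<sigma> (x \<otimes>\<^bsub>H\<^esub> y, z) \<otimes>\<^bsub>M\<^esub> \<sigma> (x, y)},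
     monoid.mult = \<lambda>\<sigma> \<tau>. \<lambda>p\<in>carrier H \<times> carrier H. \<sigma> p \<otimes>\<^bsub>M\<^esub> \<tau> p,
     one = \<lambda>p\<in>carrier H \<times> carrier H. \<one>\<^bsub>M\<^esub>\<rparr>"

definition coboundaries2 :: "('a, 'x) monoid_scheme \<Rightarrow> ('m, 'y) monoid_scheme \<Rightarrow> ('a \<times> 'a \<Rightarrow> 'm) set" where
  "coboundaries2 H M =
    (\<lambda>\<mu>. \<lambda>(x, y)\<in>carrier H \<times> carrier H. \<mu> y \<otimes>\<^bsub>M\<^esub> inv\<^bsub>M\<^esub> (\<mu> (x \<otimes>\<^bsub>H\<^esub> y)) \<otimes>\<^bsub>M\<^esub> \<mu> x)
      ` (carrier H \<rightarrow>\<^sub>E carrier M)"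

definition cohomology2 :: "('a, 'x) monoid_scheme \<Rightarrow> ('m, 'y) monoid_scheme \<Rightarrow> ('a \<times> 'a \<Rightarrow> 'm) set monoid" where
  "cohomology2 H M = cocycle_group2 H M Mod coboundaries2 H M"

section \<open>Tensor products and Hopf algebras\<close>

text \<open>\<open>V \<otimes> W\<close> is the free vector space on \<open>carrier V \<times> carrier W\<close> modulo the span
  \<open>tensor_null V W\<close> of the bilinearity relations; its elements are the cosets
  \<open>tensor_class V W p\<close>.  The coefficient \<open>c\<close> in the generating relations makes closure under
  addition sufficient.\<close>

inductive_set tensor_null ::
  "('k::field, 'v, 'x) module_scheme \<Rightarrow> ('k, 'w, 'y) module_scheme \<Rightarrow> (('v \<times> 'w) \<Rightarrow>\<^sub>0 'k) set"
  for V W where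
  zero: "0 \<in> tensor_null V W"
| add: "p \<in> tensor_null V W \<Longrightarrow> q \<in> tensor_null V W \<Longrightarrow> p + q \<in> tensor_null V W"
| add_left: "v \<in> carrier V \<Longrightarrow> v' \<in> carrier V \<Longrightarrow> w \<in> carrier W \<Longrightarrow>
    Poly_Mapping.single (v \<oplus>\<^bsub>V\<^esub> v', w) c - Poly_Mapping.single (v, w) c
      - Poly_Mapping.single (v', w) c \<in> tensor_null V W"
| add_right: "v \<in> carrier V \<Longrightarrow> w \<in> carrier W \<Longrightarrow> w' \<in> carrier W \<Longrightarrow>
    Poly_Mapping.single (v, w \<oplus>\<^bsub>W\<^esub> w') c - Poly_Mapping.single (v, w) c
      - Poly_Mapping.single (v, w') c \<in> tensor_null V W"
| smult_left: "v \<in> carrier V \<Longrightarrow> w \<in> carrier W \<Longrightarrow>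
    Poly_Mapping.single (a \<odot>\<^bsub>V\<^esub> v, w) c - Poly_Mapping.single (v, w) (c * a) \<in> tensor_null V W"
| smult_right: "v \<in> carrier V \<Longrightarrow> w \<in> carrier W \<Longrightarrow>
    Poly_Mapping.single (v, a \<odot>\<^bsub>W\<^esub> w) c - Poly_Mapping.single (v, w) (c * a) \<in> tensor_null V W"

definition tensor_class ::
  "('k::field, 'v, 'x) module_scheme \<Rightarrow> ('k, 'w, 'y) module_scheme
    \<Rightarrow> (('v \<times> 'w) \<Rightarrow>\<^sub>0 'k) \<Rightarrow> (('v \<times> 'w) \<Rightarrow>\<^sub>0 'k) set" where
  "tensor_class V W p = (\<lambda>n. p + n) ` tensor_null V W"

text \<open>The map \<open>f \<otimes> h\<close> into \<open>V' \<otimes> W'\<close>, for linear \<open>f\<close> and \<open>h\<close>: the classes united below then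
  all coincide.\<close>

definition tensor_map ::
  "('k::field, 'v2, 'x) module_scheme \<Rightarrow> ('k, 'w2, 'y) module_scheme \<Rightarrow> ('v \<Rightarrow> 'v2) \<Rightarrow> ('w \<Rightarrow> 'w2)
    \<Rightarrow> (('v \<times> 'w) \<Rightarrow>\<^sub>0 'k) set \<Rightarrow> (('v2 \<times> 'w2) \<Rightarrow>\<^sub>0 'k) set" where
  "tensor_map V' W' f h T =
    (\<Union>p\<in>T. tensor_class V' W'
      (\<Sum>(v, w)\<in>Poly_Mapping.keys p. Poly_Mapping.single (f v, h w) (Poly_Mapping.lookup p (v, w))))"

record (overloaded) ('k::zero, 'v) hopf = "('k, 'v) module" +
  comult :: "'v \<Rightarrow> (('v \<times> 'v) \<Rightarrow>\<^sub>0 'k) set"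
  counit :: "'v \<Rightarrow> 'k"
  antipode :: "'v \<Rightarrow> 'v"

definition hopf_iso :: "('k::field, 'v) hopf \<Rightarrow> ('k, 'w) hopf \<Rightarrow> ('v \<Rightarrow> 'w) set" where
  "hopf_iso A B = {f \<in> ring_iso A B.
     (\<forall>c. \<forall>x\<in>carrier A. f (c \<odot>\<^bsub>A\<^esub> x) = c \<odot>\<^bsub>B\<^esub> f x) \<and>
     (\<forall>x\<in>carrier A. comult B (f x) = tensor_map B B f f (comult A x)) \<and>
     (\<forall>x\<in>carrier A. counit B (f x) = counit A x) \<and>
     (\<forall>x\<in>carrier A. antipode B (f x) = f (antipode A x))}"

definition hopf_isomorphic :: "('k::field, 'v) hopf \<Rightarrow> ('k, 'w) hopf \<Rightarrow> bool" where
  "hopf_isomorphic A B \<longleftrightarrow> hopf_iso A B \<noteq> {}"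

section \<open>The Hopf algebra of functions on a finite group\<close>

definition function_algebra :: "('a, 'x) monoid_scheme \<Rightarrow> ('k::field, 'a \<Rightarrow> 'k) module" where
  "function_algebra G =
    \<lparr>carrier = carrier G \<rightarrow>\<^sub>E UNIV,
     monoid.mult = \<lambda>\<phi> \<psi>. \<lambda>x\<in>carrier G. \<phi> x * \<psi> x,
     one = \<lambda>x\<in>carrier G. 1,
     ring.zero = \<lambda>x\<in>carrier G. 0,
     add = \<lambda>\<phi> \<psi>. \<lambda>x\<in>carrier G. \<phi> x + \<psi> x,
     module.smult = \<lambda>c \<phi>. \<lambda>x\<in>carrier G. c * \<phi> x\<rparr>"

definition delta :: "('a, 'x) monoid_scheme \<Rightarrow> 'a \<Rightarrow> 'a \<Rightarrow> 'k::field" where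
  "delta G a = (\<lambda>x\<in>carrier G. if x = a then 1 else 0)"

text \<open>Under the identification of \<open>\<O>(G) \<otimes> \<O>(G)\<close> with functions on \<open>G \<times> G\<close>, the comultiplication
  sends \<open>\<phi>\<close> to \<open>(x, y) \<mapsto> \<phi> (x y)\<close>, that is, to \<open>\<Sum>x y. \<phi> (x y) \<delta>\<^sub>x \<otimes> \<delta>\<^sub>y\<close>.\<close>

definition function_hopf :: "('a, 'x) monoid_scheme \<Rightarrow> ('k::field, 'a \<Rightarrow> 'k) hopf" where
  "function_hopf G = module.extend (function_algebra G) (hopf.fields
     (\<lambda>\<phi>. tensor_class (function_algebra G) (function_algebra G)
        (\<Sum>(x, y)\<in>carrier G \<times> carrier G.
           Poly_Mapping.single (delta G x, delta G y) (\<phi> (x \<otimes>\<^bsub>G\<^esub> y))))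
     (\<lambda>\<phi>. \<phi> \<one>\<^bsub>G\<^esub>)
     (\<lambda>\<phi>. \<lambda>x\<in>carrier G. \<phi> (inv\<^bsub>G\<^esub> x)))"

section \<open>Cocentral actions and graded twisting\<close>

definition cocentral_action ::
  "('c, 'x) monoid_scheme \<Rightarrow> ('a, 'y) monoid_scheme \<Rightarrow> (('c \<Rightarrow> 'k::field) \<Rightarrow> 'a) \<Rightarrow> ('c \<Rightarrow> 'a \<Rightarrow> 'a) \<Rightarrow> bool" where
  "cocentral_action \<Gamma> G i \<alpha> \<longleftrightarrow>
    comm_group \<Gamma> \<and> finite (carrier \<Gamma>) \<and> group G \<and> finite (carrier G) \<and>
    i \<in> hom (dual_group \<Gamma>) G \<and> inj_on i (carrier (dual_group \<Gamma>)) \<and>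
    i ` carrier (dual_group \<Gamma>) \<subseteq> group_center G \<and>
    \<alpha> \<in> hom \<Gamma> (AutoGroup G) \<and>
    (\<forall>g\<in>carrier \<Gamma>. \<forall>\<chi>\<in>carrier (dual_group \<Gamma>). \<alpha> g (i \<chi>) = i \<chi>)"

definition homogeneous ::
  "('c, 'x) monoid_scheme \<Rightarrow> ('a, 'y) monoid_scheme \<Rightarrow> (('c \<Rightarrow> 'k::field) \<Rightarrow> 'a) \<Rightarrow> 'c \<Rightarrow> ('a \<Rightarrow> 'k) set" where
  "homogeneous \<Gamma> G i g =
    {\<phi> \<in> carrier (function_hopf G).
       \<forall>x\<in>carrier G. \<forall>\<chi>\<in>carrier (dual_group \<Gamma>). \<phi> (x \<otimes>\<^bsub>G\<^esub> i \<chi>) = \<chi> g * \<phi> x}"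

text \<open>The family of homogeneous components of \<open>\<phi>\<close> with respect to the direct sum decomposition
  \<open>\<O>(G) = \<Oplus>\<^sub>g \<O>(G)\<^sub>g\<close>.\<close>

definition components ::
  "('c, 'x) monoid_scheme \<Rightarrow> ('a, 'y) monoid_scheme \<Rightarrow> (('c \<Rightarrow> 'k::field) \<Rightarrow> 'a) \<Rightarrow> ('a \<Rightarrow> 'k) \<Rightarrow> 'c \<Rightarrow> 'a \<Rightarrow> 'k" where
  "components \<Gamma> G i \<phi> =
    (THE c. c \<in> (\<Pi>\<^sub>E g\<in>carrier \<Gamma>. homogeneous \<Gamma> G i g) \<and>
            \<phi> = (\<lambda>x\<in>carrier G. \<Sum>g\<in>carrier \<Gamma>. c g x))"

definition function_act ::
  "('a, 'y) monoid_scheme \<Rightarrow> ('c \<Rightarrow> 'a \<Rightarrow> 'a) \<Rightarrow> 'c \<Rightarrow> ('a \<Rightarrow> 'k) \<Rightarrow> 'a \<Rightarrow> 'k" where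
  "function_act G \<alpha> g \<phi> = compose (carrier G) \<phi> (inv_into (carrier G) (\<alpha> g))"

text \<open>The product and antipode of the twisting are specified on homogeneous elements; here they
  are extended additively to all of \<open>\<O>(G)\<close> by summing over the components.\<close>

definition graded_twist ::
  "('c, 'x) monoid_scheme \<Rightarrow> ('a, 'y) monoid_scheme \<Rightarrow> (('c \<Rightarrow> 'k::field) \<Rightarrow> 'a) \<Rightarrow> ('c \<Rightarrow> 'a \<Rightarrow> 'a)
    \<Rightarrow> ('k, 'a \<Rightarrow> 'k) hopf" where
  "graded_twist \<Gamma> G i \<alpha> = (function_hopf G)
    \<lparr>monoid.mult := \<lambda>\<phi> \<psi>. \<lambda>x\<in>carrier G.
        \<Sum>g\<in>carrier \<Gamma>. (components \<Gamma> G i \<phi> g \<otimes>\<^bsub>function_hopf G\<^esub> function_act G \<alpha> g \<psi>) x,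
     antipode := \<lambda>\<phi>. \<lambda>x\<in>carrier G.
        \<Sum>g\<in>carrier \<Gamma>. function_act G \<alpha> (inv\<^bsub>\<Gamma>\<^esub> g)
          (antipode (function_hopf G) (components \<Gamma> G i \<phi> g)) x\<rparr>"

section \<open>Equivalence and weak equivalence\<close>

definition equivalent_actions ::
  "('c, 'x) monoid_scheme \<Rightarrow> ('a, 'y) monoid_scheme
    \<Rightarrow> (('c \<Rightarrow> 'k::field) \<Rightarrow> 'a) \<Rightarrow> ('c \<Rightarrow> 'a \<Rightarrow> 'a) \<Rightarrow> (('c \<Rightarrow> 'k) \<Rightarrow> 'a) \<Rightarrow> ('c \<Rightarrow> 'a \<Rightarrow> 'a) \<Rightarrow> bool" where
  "equivalent_actions \<Gamma> G i \<alpha> j \<beta> \<longleftrightarrow>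
    (\<exists>u \<in> iso \<Gamma> \<Gamma>. \<exists>f \<in> iso G G.
       (\<forall>\<chi>\<in>carrier (dual_group \<Gamma>). i (dual_map \<Gamma> u \<chi>) = f (j \<chi>)) \<and>
       (\<forall>g\<in>carrier \<Gamma>. \<forall>x\<in>carrier G. inv_into (carrier G) f (\<alpha> g (f x)) = \<beta> (u g) x))"

text \<open>An automorphism \<open>a\<close> of \<open>G\<close> with \<open>a ` N = N\<close> induces \<open>C \<mapsto> a ` C\<close> on the cosets
  \<open>C\<close> of \<open>N\<close>.\<close>

definition weakly_equivalent_actions ::
  "('c, 'x) monoid_scheme \<Rightarrow> ('a, 'y) monoid_scheme
    \<Rightarrow> (('c \<Rightarrow> 'k::field) \<Rightarrow> 'a) \<Rightarrow> ('c \<Rightarrow> 'a \<Rightarrow> 'a) \<Rightarrow> (('c \<Rightarrow> 'k) \<Rightarrow> 'a) \<Rightarrow> ('c \<Rightarrow> 'a \<Rightarrow> 'a) \<Rightarrow> bool" where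
  "weakly_equivalent_actions \<Gamma> G i \<alpha> j \<beta> \<longleftrightarrow>
    (let Qi = G Mod (i ` carrier (dual_group \<Gamma>)); Qj = G Mod (j ` carrier (dual_group \<Gamma>)) in
     \<exists>u \<in> iso \<Gamma> \<Gamma>. \<exists>f \<in> iso Qj Qi.
       \<forall>g\<in>carrier \<Gamma>. \<forall>C\<in>carrier Qj. inv_into (carrier Qj) f (\<alpha> g ` f C) = \<beta> (u g) ` C)"

section \<open>Cocentral actions of the group of order two\<close>

text \<open>If the center of \<open>G\<close> is cyclic, all cocentral actions of \<open>\<int>/2\<close> on \<open>G\<close> have the same
  image in the center, so the quotient \<open>H\<close> in the theorem does not depend on the choice of \<open>i\<close>
  or \<open>j\<close>.\<close>

lemma dual_integer_mod_group_2:
  "carrier (dual_group (integer_mod_group 2) :: (int \<Rightarrow> 'k::field) monoid) =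
    {\<lambda>g\<in>{0,1}. 1, \<lambda>g\<in>{0,1}. if g = 0 then 1 else -1}" (is "_ = {?t, ?s}")
proof (intro Set.set_eqI iffI)
  have Z2: "carrier (integer_mod_group 2) = {0,1}"
    by (auto simp: carrier_integer_mod_group)
  have units: "carrier (field_units :: 'k monoid) = -{0}"
      "monoid.mult field_units = ((*) :: 'k \<Rightarrow> _)" "one (field_units :: 'k monoid) = 1"
    by (auto simp: ring_of_type_algebra_def)
  note simps = hom_group_def hom_def Z2 units
  fix \<chi> :: "int \<Rightarrow> 'k"
  show "\<chi> \<in> {?t, ?s}" if "\<chi> \<in> carrier (dual_group (integer_mod_group 2))"
  proof -
    have ext: "\<chi> \<in> extensional {0,1}"
      and m: "\<chi> ((x + y) mod 2) = \<chi> x * \<chi> y" if "x \<in> {0,1}" "y \<in> {0,1}" for x y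
      using \<open>\<chi> \<in> _\<close> that by (auto simp: simps simp del: carrier_mult_of mult_mult_of)
    have "\<chi> 0 \<noteq> 0"
      using that Z2 units(1) by (fastforce simp: hom_group_def hom_def simp del: carrier_mult_of)
    then have "\<chi> 0 = 1" using m[of 0 0] by simp
    moreover from this have "\<chi> 1 = 1 \<or> \<chi> 1 = -1"
      using m[of 1 1] by (simp add: square_eq_1_iff)
    ultimately show ?thesis using ext[of 0 0]
      by (auto simp: fun_eq_iff extensional_def restrict_def)
  qed
  show "\<chi> \<in> carrier (dual_group (integer_mod_group 2))" if "\<chi> \<in> {?t, ?s}"
    using that by (auto simp: simps simp del: carrier_mult_of mult_mult_of)
qed

lemma cocentral_image_2:
  fixes G (structure) and i :: "(int \<Rightarrow> 'k::field_char_0) \<Rightarrow> 'a"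
  assumes "cocentral_action (integer_mod_group 2) G i \<alpha>"
  obtains a where "i ` carrier (dual_group (integer_mod_group 2)) = {\<one>\<^bsub>G\<^esub>, a}"
    and "a \<in> group_center G" and "a \<noteq> \<one>\<^bsub>G\<^esub>" and "a \<otimes>\<^bsub>G\<^esub> a = \<one>\<^bsub>G\<^esub>"
proof -
  let ?t = "\<lambda>g\<in>{0,1::int}. 1 :: 'k" and ?s = "\<lambda>g\<in>{0,1::int}. if g = 0 then 1 else (-1 :: 'k)"
  let ?D = "dual_group (integer_mod_group 2) :: (int \<Rightarrow> 'k) monoid"
  interpret group G using assms by (simp add: cocentral_action_def)
  have D: "carrier ?D = {?t, ?s}" by (rule dual_integer_mod_group_2)
  have mult: "?t \<otimes>\<^bsub>?D\<^esub> ?t = ?t" "?s \<otimes>\<^bsub>?D\<^esub> ?s = ?t"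
    by (auto simp: hom_group_def carrier_integer_mod_group ring_of_type_algebra_def fun_eq_iff)
  have h: "i (x \<otimes>\<^bsub>?D\<^esub> y) = i x \<otimes> i y" "i x \<in> carrier G" if "x \<in> {?t, ?s}" "y \<in> {?t, ?s}" for x y
    using assms that D unfolding cocentral_action_def hom_def by blast+
  have t: "i ?t = \<one>"
    using h[of ?t ?t] mult by (metis insertI1 l_cancel_one)
  have "?t 1 \<noteq> ?s 1" by simp
  then have "?t \<noteq> ?s" by metis
  then have "i ?s \<noteq> i ?t"
    using assms D unfolding cocentral_action_def inj_on_def by (metis insertI1 insertI2)
  moreover have "i ?s \<in> group_center G"
    using assms D unfolding cocentral_action_def by blast
  moreover have "i ?s \<otimes> i ?s = \<one>"
    using h(1)[of ?s ?s] mult t by simp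
  moreover have "i ` carrier ?D = {\<one>, i ?s}" using D t by auto
  ultimately show ?thesis using that[of "i ?s"] t by simp
qed

lemma dvd_diff_of_double:
  fixes N m n :: int
  assumes "N dvd m + m" "N dvd n + n" "\<not> N dvd m" "\<not> N dvd n"
  shows "N dvd m - n"
proof -
  have odd: "odd s" if s: "l + l = N * s" and l: "\<not> N dvd l" for l s
  proof
    assume "even s"
    then obtain r where "s = 2 * r" by (elim evenE)
    with s have "l = N * r" by simp
    with l show False by simp
  qed
  obtain s t where s: "m + m = N * s" and t: "n + n = N * t" using assms(1,2) by (elim dvdE)
  have "even (s - t)" using odd s t assms(3,4) by simp
  then obtain r where "s - t = 2 * r" by (elim evenE)
  then have "N * s - N * t = N * (2 * r)" by (simp flip: right_diff_distrib)
  then have "m - n = N * r" using s t by linarith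
  then show ?thesis by simp
qed

lemma cocentral_images_coincide:
  fixes G (structure) and i j :: "(int \<Rightarrow> 'k::field_char_0) \<Rightarrow> 'a"
  assumes "cyclic_group (G\<lparr>carrier := group_center G\<rparr>)"
    and "cocentral_action (integer_mod_group 2) G i \<alpha>"
    and "cocentral_action (integer_mod_group 2) G j \<beta>"
  shows "i ` carrier (dual_group (integer_mod_group 2)) = j ` carrier (dual_group (integer_mod_group 2))"
proof -
  interpret group G using assms by (simp add: cocentral_action_def)
  let ?Z = "G\<lparr>carrier := group_center G\<rparr>"
  have sub: "subgroup (group_center G) G"
  proof (rule subgroupI)
    show "inv a \<in> group_center G" if "a \<in> group_center G" for a
    proof -
      have a: "a \<in> carrier G" "\<And>x. x \<in> carrier G \<Longrightarrow> a \<otimes> x = x \<otimes> a" using that by (auto simp: group_center_def)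
      have "inv a \<otimes> x = x \<otimes> inv a" if "x \<in> carrier G" for x
      proof -
        have "inv a \<otimes> x = inv a \<otimes> (x \<otimes> a) \<otimes> inv a" using a(1) that by (simp add: m_assoc)
        also have "\<dots> = inv a \<otimes> (a \<otimes> x) \<otimes> inv a" by (simp only: a(2)[OF that])
        also have "\<dots> = x \<otimes> inv a" using a(1) that by (simp add: m_assoc[symmetric])
        finally show ?thesis .
      qed
      then show ?thesis using a by (auto simp: group_center_def)
    qed
    show "a \<otimes> b \<in> group_center G" if "a \<in> group_center G" "b \<in> group_center G" for a b
    proof -
      have a: "a \<in> carrier G" "\<And>x. x \<in> carrier G \<Longrightarrow> a \<otimes> x = x \<otimes> a"
        and b: "b \<in> carrier G" "\<And>x. x \<in> carrier G \<Longrightarrow> b \<otimes> x = x \<otimes> b"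
        using that by (auto simp: group_center_def)
      have "a \<otimes> b \<otimes> x = x \<otimes> (a \<otimes> b)" if x: "x \<in> carrier G" for x
      proof -
        have "a \<otimes> b \<otimes> x = a \<otimes> (b \<otimes> x)" using a(1) b(1) x by (simp add: m_assoc)
        also have "\<dots> = a \<otimes> x \<otimes> b" using a(1) b(1) x by (simp only: b(2) m_assoc)
        also have "\<dots> = x \<otimes> (a \<otimes> b)" using a(1) b(1) x by (simp only: a(2)[OF x] m_assoc)
        finally show ?thesis .
      qed
      then show ?thesis using a(1) b(1) by (simp add: group_center_def)
    qed
    have "\<one> \<in> group_center G" by (simp add: group_center_def)
    then show "group_center G \<noteq> {}" by blast
  qed (simp add: group_center_def subset_eq)
  interpret Z: group ?Z by (rule subgroup_imp_group[OF sub])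
  obtain z where z: "z \<in> carrier ?Z" "carrier ?Z = range (\<lambda>n::int. z [^]\<^bsub>?Z\<^esub> n)"
    using assms(1) Z.cyclic_group by auto
  have uniq: "a = b" if ab: "a \<in> group_center G" "b \<in> group_center G" "a \<noteq> \<one>" "b \<noteq> \<one>" "a \<otimes> a = \<one>" "b \<otimes> b = \<one>" for a b
  proof -
    have "a \<in> range (\<lambda>n::int. z [^]\<^bsub>?Z\<^esub> n)" "b \<in> range (\<lambda>n::int. z [^]\<^bsub>?Z\<^esub> n)"
      using z(2) ab(1,2) by simp_all
    then obtain m n :: int where mn: "a = z [^]\<^bsub>?Z\<^esub> m" "b = z [^]\<^bsub>?Z\<^esub> n"
      by (elim rangeE)
    define N where "N = int (Z.ord z)"
    have N: "z [^]\<^bsub>?Z\<^esub> k = \<one> \<longleftrightarrow> N dvd k" for k :: int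
      using Z.int_pow_eq_id[OF z(1), of k] by (simp add: N_def)
    have "a \<otimes> a = z [^]\<^bsub>?Z\<^esub> (m + m)" "b \<otimes> b = z [^]\<^bsub>?Z\<^esub> (n + n)"
      using Z.int_pow_mult[OF z(1), of m m] Z.int_pow_mult[OF z(1), of n n] mn by simp_all
    then have "N dvd m + m" "N dvd n + n"
      using ab(5,6) N[of "m + m"] N[of "n + n"] by metis+
    moreover have "\<not> N dvd m" "\<not> N dvd n" using N mn ab by auto
    ultimately have "N dvd m - n" by (rule dvd_diff_of_double)
    then show ?thesis using mn Z.int_pow_eq[OF z(1)] unfolding N_def by (simp add: dvd_diff_commute)
  qed
  obtain a where a: "i ` carrier (dual_group (integer_mod_group 2)) = {\<one>, a}"
      "a \<in> group_center G" "a \<noteq> \<one>" "a \<otimes> a = \<one>"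
    by (rule cocentral_image_2[OF assms(2)])
  obtain b where b: "j ` carrier (dual_group (integer_mod_group 2)) = {\<one>, b}"
      "b \<in> group_center G" "b \<noteq> \<one>" "b \<otimes> b = \<one>"
    by (rule cocentral_image_2[OF assms(3)])
  have "a = b" by (rule uniq) (fact a b)+
  then show ?thesis by (simp only: a(1) b(1))
qed

end

theory Submission
  imports Defs
begin

text \<open>Write \<open>a\<close> for the generator of the common image of \<open>i\<close> and \<open>j\<close> and call a function even or odd
  according to its behaviour under translation by \<open>a\<close>.

  An isomorphism \<open>F\<close> between the twistings turns evaluation at \<open>a\<close> into a character of the first
  twisting, which is supported on a single coset \<open>{x, a x}\<close> and is central for convolution, so \<open>x\<close> is
  central in \<open>G\<close>.  Either the character is evaluation at \<open>a\<close>, or \<open>x\<^sup>2 = a\<close>; in the latter case the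
  commutativity of the even part forces \<open>\<alpha>\<close> to act on \<open>G\<close> through a nontrivial character
  \<open>y \<mapsto> y\<^sup>-\<^sup>1 \<alpha>(y) \<in> \<langle>x\<rangle>\<close>, contrary to \<open>Hom(H, \<int>\<^sub>2) = 1\<close>.  Hence \<open>F\<close> preserves the even part
  \<open>\<O>(H)\<close>, and the automorphism of \<open>H\<close> so obtained intertwines the two actions because an odd
  function \<open>\<phi>\<close> satisfies \<open>\<phi> \<cdot> \<psi> = \<alpha>(\<psi>) \<cdot> \<phi>\<close> for even \<open>\<psi>\<close>.

  Conversely an automorphism \<open>f\<close> of \<open>H\<close> lifts to \<open>G\<close>: \<open>G\<close> is given by a sign-valued cocycle \<open>\<sigma>\<close>, and
  \<open>\<sigma>\<close> and \<open>\<sigma> \<circ> (f \<times> f)\<close> have order at most two in the cyclic group \<open>H\<^sup>2(H, k\<^sup>\<times>)\<close> and are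
  trivial simultaneously, hence cohomologous.  Characters of \<open>H\<close> have odd order, so the cochain
  connecting them may be chosen sign-valued.  The lift intertwines the actions on \<open>G\<close> since
  the obstruction is a homomorphism \<open>H \<rightarrow> {1, -1}\<close>.\<close>

section \<open>Second cohomology\<close>

lemma cocycle_group2_simps:
  "\<sigma> \<in> carrier (cocycle_group2 H M) \<longleftrightarrow> \<sigma> \<in> carrier H \<times> carrier H \<rightarrow>\<^sub>E carrier M \<and>
    (\<forall>x\<in>carrier H. \<forall>y\<in>carrier H. \<forall>z\<in>carrier H.
       \<sigma> (y, z) \<otimes>\<^bsub>M\<^esub> \<sigma> (x, y \<otimes>\<^bsub>H\<^esub> z) = \<sigma> (x \<otimes>\<^bsub>H\<^esub> y, z) \<otimes>\<^bsub>M\<^esub> \<sigma> (x, y))"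
  "\<sigma> \<otimes>\<^bsub>cocycle_group2 H M\<^esub> \<tau> = (\<lambda>p\<in>carrier H \<times> carrier H. \<sigma> p \<otimes>\<^bsub>M\<^esub> \<tau> p)"
  "\<one>\<^bsub>cocycle_group2 H M\<^esub> = (\<lambda>p\<in>carrier H \<times> carrier H. \<one>\<^bsub>M\<^esub>)"
  by (simp_all add: cocycle_group2_def)

lemma (in comm_group) comm_group_cocycle_group2:
  assumes "group H"
  shows "comm_group (cocycle_group2 H G)"
proof -
  interpret H: group H by fact
  have val: "\<sigma> (x, y) \<in> carrier G"
    if "\<sigma> \<in> carrier (cocycle_group2 H G)" "x \<in> carrier H" "y \<in> carrier H" for \<sigma> x y
    using that by (auto simp: cocycle_group2_simps)
  have coc: "\<sigma> (y, z) \<otimes> \<sigma> (x, y \<otimes>\<^bsub>H\<^esub> z) = \<sigma> (x \<otimes>\<^bsub>H\<^esub> y, z) \<otimes> \<sigma> (x, y)"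
    if "\<sigma> \<in> carrier (cocycle_group2 H G)" "x \<in> carrier H" "y \<in> carrier H" "z \<in> carrier H" for \<sigma> x y z
    using that by (auto simp: cocycle_group2_simps)
  show ?thesis
  proof (rule comm_groupI)
    fix \<sigma> \<tau> assume st: "\<sigma> \<in> carrier (cocycle_group2 H G)" "\<tau> \<in> carrier (cocycle_group2 H G)"
    have "\<sigma> (y, z) \<otimes> \<tau> (y, z) \<otimes> (\<sigma> (x, y \<otimes>\<^bsub>H\<^esub> z) \<otimes> \<tau> (x, y \<otimes>\<^bsub>H\<^esub> z)) =
        \<sigma> (x \<otimes>\<^bsub>H\<^esub> y, z) \<otimes> \<tau> (x \<otimes>\<^bsub>H\<^esub> y, z) \<otimes> (\<sigma> (x, y) \<otimes> \<tau> (x, y))"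
      if "x \<in> carrier H" "y \<in> carrier H" "z \<in> carrier H" for x y z
    proof -
      have "\<sigma> (y, z) \<otimes> \<tau> (y, z) \<otimes> (\<sigma> (x, y \<otimes>\<^bsub>H\<^esub> z) \<otimes> \<tau> (x, y \<otimes>\<^bsub>H\<^esub> z)) =
        (\<sigma> (y, z) \<otimes> \<sigma> (x, y \<otimes>\<^bsub>H\<^esub> z)) \<otimes> (\<tau> (y, z) \<otimes> \<tau> (x, y \<otimes>\<^bsub>H\<^esub> z))"
        using st that by (simp add: val m_ac)
      also have "\<dots> = \<sigma> (x \<otimes>\<^bsub>H\<^esub> y, z) \<otimes> \<tau> (x \<otimes>\<^bsub>H\<^esub> y, z) \<otimes> (\<sigma> (x, y) \<otimes> \<tau> (x, y))"
        unfolding coc[OF st(1) that] coc[OF st(2) that] using st that by (simp add: val m_ac)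
      finally show ?thesis .
    qed
    then show "\<sigma> \<otimes>\<^bsub>cocycle_group2 H G\<^esub> \<tau> \<in> carrier (cocycle_group2 H G)"
      using st by (auto simp: cocycle_group2_simps)
    show "\<sigma> \<otimes>\<^bsub>cocycle_group2 H G\<^esub> \<tau> = \<tau> \<otimes>\<^bsub>cocycle_group2 H G\<^esub> \<sigma>"
      using st by (auto simp: cocycle_group2_simps fun_eq_iff intro!: m_comm)
  next
    show "\<one>\<^bsub>cocycle_group2 H G\<^esub> \<in> carrier (cocycle_group2 H G)"
      by (auto simp: cocycle_group2_simps)
  next
    fix \<sigma> \<tau> \<rho> assume "\<sigma> \<in> carrier (cocycle_group2 H G)" "\<tau> \<in> carrier (cocycle_group2 H G)" "\<rho> \<in> carrier (cocycle_group2 H G)"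
    then show "\<sigma> \<otimes>\<^bsub>cocycle_group2 H G\<^esub> \<tau> \<otimes>\<^bsub>cocycle_group2 H G\<^esub> \<rho> = \<sigma> \<otimes>\<^bsub>cocycle_group2 H G\<^esub> (\<tau> \<otimes>\<^bsub>cocycle_group2 H G\<^esub> \<rho>)"
      by (auto simp: cocycle_group2_simps fun_eq_iff intro!: m_assoc)
  next
    fix \<sigma> assume s: "\<sigma> \<in> carrier (cocycle_group2 H G)"
    then show "\<one>\<^bsub>cocycle_group2 H G\<^esub> \<otimes>\<^bsub>cocycle_group2 H G\<^esub> \<sigma> = \<sigma>"
      using val[OF s] by (auto simp: cocycle_group2_simps fun_eq_iff PiE_def extensional_def)
    have "inv \<sigma> (y, z) \<otimes> inv \<sigma> (x, y \<otimes>\<^bsub>H\<^esub> z) = inv \<sigma> (x \<otimes>\<^bsub>H\<^esub> y, z) \<otimes> inv \<sigma> (x, y)"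
      if "x \<in> carrier H" "y \<in> carrier H" "z \<in> carrier H" for x y z
      using coc[OF s that] val[OF s] that by (metis H.m_closed inv_mult)
    then have "(\<lambda>p\<in>carrier H \<times> carrier H. inv \<sigma> p) \<in> carrier (cocycle_group2 H G)"
      using s by (auto simp: cocycle_group2_simps)
    moreover have "(\<lambda>p\<in>carrier H \<times> carrier H. inv \<sigma> p) \<otimes>\<^bsub>cocycle_group2 H G\<^esub> \<sigma> = \<one>\<^bsub>cocycle_group2 H G\<^esub>"
      using val[OF s] by (auto simp: cocycle_group2_simps fun_eq_iff)
    ultimately show "\<exists>\<tau>\<in>carrier (cocycle_group2 H G). \<tau> \<otimes>\<^bsub>cocycle_group2 H G\<^esub> \<sigma> = \<one>\<^bsub>cocycle_group2 H G\<^esub>"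
      by blast
  qed
qed

lemma (in comm_group) subgroup_coboundaries2:
  assumes "group H"
  shows "subgroup (coboundaries2 H G) (cocycle_group2 H G)"
proof -
  interpret H: group H by fact
  interpret Z: comm_group "cocycle_group2 H G" by (rule comm_group_cocycle_group2) fact
  let ?d = "\<lambda>\<mu>. \<lambda>(x, y)\<in>carrier H \<times> carrier H. \<mu> y \<otimes> inv (\<mu> (x \<otimes>\<^bsub>H\<^esub> y)) \<otimes> \<mu> x"
  have d_mult: "?d \<mu> \<otimes>\<^bsub>cocycle_group2 H G\<^esub> ?d \<nu> = ?d (\<lambda>x\<in>carrier H. \<mu> x \<otimes> \<nu> x)"
    if mn: "\<mu> \<in> carrier H \<rightarrow>\<^sub>E carrier G" "\<nu> \<in> carrier H \<rightarrow>\<^sub>E carrier G" for \<mu> \<nu>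
  proof -
    have "\<mu> x \<in> carrier G" "\<nu> x \<in> carrier G" if "x \<in> carrier H" for x using mn that by auto
    then show ?thesis
      by (auto simp: cocycle_group2_simps fun_eq_iff inv_mult m_ac)
  qed
  have d_closed: "?d \<mu> \<in> carrier (cocycle_group2 H G)"
    if m: "\<mu> \<in> carrier H \<rightarrow>\<^sub>E carrier G" for \<mu>
  proof -
    have c: "\<mu> x \<in> carrier G" if "x \<in> carrier H" for x using m that by auto
    have "\<mu> z \<otimes> inv \<mu> (y \<otimes>\<^bsub>H\<^esub> z) \<otimes> \<mu> y \<otimes> (\<mu> (y \<otimes>\<^bsub>H\<^esub> z) \<otimes> inv \<mu> (x \<otimes>\<^bsub>H\<^esub> (y \<otimes>\<^bsub>H\<^esub> z)) \<otimes> \<mu> x) =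
          \<mu> z \<otimes> inv \<mu> (x \<otimes>\<^bsub>H\<^esub> y \<otimes>\<^bsub>H\<^esub> z) \<otimes> \<mu> (x \<otimes>\<^bsub>H\<^esub> y) \<otimes> (\<mu> y \<otimes> inv \<mu> (x \<otimes>\<^bsub>H\<^esub> y) \<otimes> \<mu> x)"
      if x: "x \<in> carrier H" "y \<in> carrier H" "z \<in> carrier H" for x y z
    proof -
      \<comment> \<open>Both sides equal \<open>\<mu> x \<otimes> \<mu> y \<otimes> \<mu> z\<close>
        times the inverse of \<open>\<mu>\<close> at the triple product, each with its own
        cancelling pair in addition. The pairs are kept intact
        (\<open>del: r_inv Units_r_inv\<close>) so that commutative rearrangement alone matches the
        terms.\<close>
      have "\<mu> z \<otimes> inv \<mu> (y \<otimes>\<^bsub>H\<^esub> z) \<otimes> \<mu> y \<otimes> (\<mu> (y \<otimes>\<^bsub>H\<^esub> z) \<otimes> inv \<mu> (x \<otimes>\<^bsub>H\<^esub> (y \<otimes>\<^bsub>H\<^esub> z)) \<otimes> \<mu> x) =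
        (\<mu> (y \<otimes>\<^bsub>H\<^esub> z) \<otimes> inv \<mu> (y \<otimes>\<^bsub>H\<^esub> z)) \<otimes> (\<mu> x \<otimes> \<mu> y \<otimes> \<mu> z \<otimes> inv \<mu> (x \<otimes>\<^bsub>H\<^esub> (y \<otimes>\<^bsub>H\<^esub> z)))"
        using x by (simp add: c m_ac del: r_inv Units_r_inv)
      also have "\<dots> = (\<mu> (x \<otimes>\<^bsub>H\<^esub> y) \<otimes> inv \<mu> (x \<otimes>\<^bsub>H\<^esub> y)) \<otimes> (\<mu> x \<otimes> \<mu> y \<otimes> \<mu> z \<otimes> inv \<mu> (x \<otimes>\<^bsub>H\<^esub> (y \<otimes>\<^bsub>H\<^esub> z)))"
        using x by (simp add: c)
      also have "\<dots> = \<mu> z \<otimes> inv \<mu> (x \<otimes>\<^bsub>H\<^esub> y \<otimes>\<^bsub>H\<^esub> z) \<otimes> \<mu> (x \<otimes>\<^bsub>H\<^esub> y) \<otimes> (\<mu> y \<otimes> inv \<mu> (x \<otimes>\<^bsub>H\<^esub> y) \<otimes> \<mu> x)"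
        using x by (simp add: c m_ac H.m_assoc del: r_inv Units_r_inv)
      finally show ?thesis .
    qed
    then show ?thesis by (auto simp: cocycle_group2_simps c)
  qed
  have d_one: "?d (\<lambda>x\<in>carrier H. \<one>) = \<one>\<^bsub>cocycle_group2 H G\<^esub>"
    by (auto simp: cocycle_group2_simps fun_eq_iff)
  show ?thesis
  proof (rule Z.subgroupI)
    show "coboundaries2 H G \<subseteq> carrier (cocycle_group2 H G)"
      unfolding coboundaries2_def using d_closed by blast
    show "coboundaries2 H G \<noteq> {}"
      using one_closed by (auto simp add: coboundaries2_def PiE_eq_empty_iff simp del: one_closed)
    fix \<sigma> assume "\<sigma> \<in> coboundaries2 H G"
    then obtain \<mu> where m: "\<mu> \<in> carrier H \<rightarrow>\<^sub>E carrier G" "\<sigma> = ?d \<mu>" unfolding coboundaries2_def by blast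
    let ?\<nu> = "\<lambda>x\<in>carrier H. inv \<mu> x"
    have n: "?\<nu> \<in> carrier H \<rightarrow>\<^sub>E carrier G" using m by auto
    have "(\<lambda>x\<in>carrier H. ?\<nu> x \<otimes> \<mu> x) = (\<lambda>x\<in>carrier H. \<one>)"
      using m(1) PiE_mem[OF m(1)] by (auto simp: fun_eq_iff)
    then have "?d ?\<nu> \<otimes>\<^bsub>cocycle_group2 H G\<^esub> \<sigma> = \<one>\<^bsub>cocycle_group2 H G\<^esub>"
      unfolding m(2) d_mult[OF n m(1)] d_one[symmetric] by simp
    then have "inv\<^bsub>cocycle_group2 H G\<^esub> \<sigma> = ?d ?\<nu>"
      using d_closed[OF n] d_closed[OF m(1)] m(2) by (intro Z.inv_equality) auto
    then show "inv\<^bsub>cocycle_group2 H G\<^esub> \<sigma> \<in> coboundaries2 H G"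
      unfolding coboundaries2_def using n by blast
  next
    fix \<sigma> \<tau> assume "\<sigma> \<in> coboundaries2 H G" "\<tau> \<in> coboundaries2 H G"
    then obtain \<mu> \<nu> where m: "\<mu> \<in> carrier H \<rightarrow>\<^sub>E carrier G" "\<sigma> = ?d \<mu>" "\<nu> \<in> carrier H \<rightarrow>\<^sub>E carrier G" "\<tau> = ?d \<nu>"
      unfolding coboundaries2_def by blast
    have "(\<lambda>x\<in>carrier H. \<mu> x \<otimes> \<nu> x) \<in> carrier H \<rightarrow>\<^sub>E carrier G" using m by auto
    then show "\<sigma> \<otimes>\<^bsub>cocycle_group2 H G\<^esub> \<tau> \<in> coboundaries2 H G"
      unfolding m(2,4) d_mult[OF m(1,3)] coboundaries2_def by blast
  qed
qed

text \<open>In terms of a generator, the exponents of two involutions are odd multiples of half its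
  order, so they differ by a multiple of the order. An infinite cyclic group is covered too: there
  \<open>ord\<close> is 0, and divisibility by 0 leaves no involution at all.\<close>

lemma (in group) cyclic_group_involution_unique:
  assumes "cyclic_group G" "x \<in> carrier G" "y \<in> carrier G"
    and "x \<otimes> x = \<one>" "y \<otimes> y = \<one>" "x \<noteq> \<one>" "y \<noteq> \<one>"
  shows "x = y"
proof -
  obtain z where z: "z \<in> carrier G" "carrier G = range (\<lambda>n::int. z [^] n)"
    using assms(1) cyclic_group by auto
  obtain m n :: int where mn: "x = z [^] m" "y = z [^] n" using z assms(2,3) by blast
  define N where "N = int (ord z)"
  have N: "z [^] k = \<one> \<longleftrightarrow> N dvd k" for k :: int
    using int_pow_eq_id[OF z(1), of k] by (simp add: N_def)
  have "x \<otimes> x = z [^] (m + m)" "y \<otimes> y = z [^] (n + n)"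
    using int_pow_mult[OF z(1), of m m] int_pow_mult[OF z(1), of n n] mn by simp_all
  then have "N dvd m + m" "N dvd n + n"
    using assms N by metis+
  moreover have "\<not> N dvd m" "\<not> N dvd n" using N mn assms by auto
  ultimately have "N dvd m - n" by (rule dvd_diff_of_double)
  then show ?thesis using mn int_pow_eq[OF z(1)] unfolding N_def by (simp add: dvd_diff_commute)
qed

text \<open>A class whose square is trivial is, in a cyclic group, either the unit or the only
  involution, so two such classes agree as soon as they are trivial together.\<close>

lemma (in comm_group) cohomology2_square_trivial:
  assumes H: "group H" and cyc: "cyclic_group (cohomology2 H G)"
    and s: "\<sigma> \<in> carrier (cocycle_group2 H G)" "\<sigma> \<otimes>\<^bsub>cocycle_group2 H G\<^esub> \<sigma> \<in> coboundaries2 H G"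
    and t: "\<tau> \<in> carrier (cocycle_group2 H G)" "\<tau> \<otimes>\<^bsub>cocycle_group2 H G\<^esub> \<tau> \<in> coboundaries2 H G"
    and iff: "\<sigma> \<in> coboundaries2 H G \<longleftrightarrow> \<tau> \<in> coboundaries2 H G"
  shows "\<exists>\<rho>\<in>coboundaries2 H G. \<tau> = \<rho> \<otimes>\<^bsub>cocycle_group2 H G\<^esub> \<sigma>"
proof -
  interpret Z: comm_group "cocycle_group2 H G" by (rule comm_group_cocycle_group2) fact
  interpret B: subgroup "coboundaries2 H G" "cocycle_group2 H G" by (rule subgroup_coboundaries2) fact
  interpret B: normal "coboundaries2 H G" "cocycle_group2 H G"
    by (simp add: Z.normal_iff_subgroup B.subgroup_axioms)
  interpret Q: group "cohomology2 H G" unfolding cohomology2_def by (rule B.factorgroup_is_group)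
  let ?c = "\<lambda>\<sigma>. coboundaries2 H G #>\<^bsub>cocycle_group2 H G\<^esub> \<sigma>"
  have one: "?c \<rho> = \<one>\<^bsub>cohomology2 H G\<^esub> \<longleftrightarrow> \<rho> \<in> coboundaries2 H G"
    if "\<rho> \<in> carrier (cocycle_group2 H G)" for \<rho>
    using that B.subgroup_axioms unfolding cohomology2_def one_FactGroup
    by (metis Z.coset_join1 Z.coset_join2 B.subset)
  have sq: "?c \<rho> \<otimes>\<^bsub>cohomology2 H G\<^esub> ?c \<rho> = \<one>\<^bsub>cohomology2 H G\<^esub>"
    if "\<rho> \<in> carrier (cocycle_group2 H G)" "\<rho> \<otimes>\<^bsub>cocycle_group2 H G\<^esub> \<rho> \<in> coboundaries2 H G" for \<rho>
    using that one[of "\<rho> \<otimes>\<^bsub>cocycle_group2 H G\<^esub> \<rho>"] by (simp add: cohomology2_def B.rcos_sum)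
  have carr: "?c \<rho> \<in> carrier (cohomology2 H G)" if "\<rho> \<in> carrier (cocycle_group2 H G)" for \<rho>
    using that by (simp add: cohomology2_def carrier_FactGroup)
  have "?c \<sigma> = ?c \<tau>"
  proof (cases "\<sigma> \<in> coboundaries2 H G")
    case True
    then show ?thesis using iff one s(1) t(1) by metis
  next
    case False
    then show ?thesis
      using Q.cyclic_group_involution_unique[OF cyc carr[OF s(1)] carr[OF t(1)] sq[OF s] sq[OF t]]
        one[OF s(1)] one[OF t(1)] iff by blast
  qed
  then have "\<tau> \<in> ?c \<sigma>" using t(1) Z.rcos_self[OF t(1) B.subgroup_axioms] by metis
  then show ?thesis by (auto simp: r_coset_def)
qed

section \<open>Central extensions by a group of order two\<close>

lemma field_units_simps:
  "carrier (field_units :: 'k::field monoid) = - {0}"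
  "x \<otimes>\<^bsub>field_units\<^esub> y = (x * y :: 'k)" "\<one>\<^bsub>field_units\<^esub> = (1 :: 'k)"
  by (auto simp: ring_of_type_algebra_def)

lemma comm_group_field_units: "comm_group (field_units :: 'k::field monoid)"
proof (rule comm_groupI)
  fix x :: 'k assume "x \<in> carrier field_units"
  then show "\<exists>y\<in>carrier field_units. y \<otimes>\<^bsub>field_units\<^esub> x = \<one>\<^bsub>field_units\<^esub>"
    by (intro bexI[of _ "inverse x"])
      (simp_all add: field_units_simps del: carrier_mult_of mult_mult_of one_mult_of)
qed (simp_all add: field_units_simps mult_ac del: carrier_mult_of mult_mult_of one_mult_of)

lemma inv_field_units: "x \<noteq> 0 \<Longrightarrow> inv\<^bsub>field_units\<^esub> x = inverse (x :: 'k::field)"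
proof -
  interpret comm_group "field_units :: 'k monoid" by (rule comm_group_field_units)
  show "inv\<^bsub>field_units\<^esub> x = inverse x" if "x \<noteq> 0"
    by (rule inv_equality) (use that in \<open>simp_all add: field_units_simps del: carrier_mult_of mult_mult_of one_mult_of\<close>)
qed

section \<open>Groups with a distinguished central involution and the quotient by it\<close>

locale central_involution = group G for G (structure) +
  fixes a
  assumes finite_carrier: "finite (carrier G)"
    and a_closed [simp]: "a \<in> carrier G"
    and a_neq_one: "a \<noteq> \<one>"
    and a_square: "a \<otimes> a = \<one>"
    and a_comm: "x \<in> carrier G \<Longrightarrow> x \<otimes> a = a \<otimes> x"
begin

abbreviation quot :: "'a set monoid" where
  "quot \<equiv> G Mod {\<one>, a}"

lemma a_a_mult [simp]: "x \<in> carrier G \<Longrightarrow> a \<otimes> (a \<otimes> x) = x"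
  by (simp add: a_square flip: m_assoc)

lemma a_lcomm: "x \<in> carrier G \<Longrightarrow> y \<in> carrier G \<Longrightarrow> x \<otimes> (a \<otimes> y) = a \<otimes> (x \<otimes> y)"
  by (simp add: a_comm flip: m_assoc)

lemma a_mult_neq: "x \<in> carrier G \<Longrightarrow> a \<otimes> x \<noteq> x"
  using a_neq_one by (metis a_closed r_cancel_one')

lemma coset_eq: "x \<in> carrier G \<Longrightarrow> {\<one>, a} #> x = {x, a \<otimes> x}"
  by (auto simp: r_coset_def)

lemma normal_a: "{\<one>, a} \<lhd> G"
proof -
  have "inv a = a" by (rule inv_equality) (simp_all add: a_square)
  then have "subgroup {\<one>, a} G"
    by (intro subgroupI) (auto simp: a_square)
  then show ?thesis
    unfolding normal_inv_iff using a_comm by (auto simp: m_assoc[symmetric]) (simp add: m_assoc)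
qed

lemma group_quot: "group quot"
  by (rule normal.factorgroup_is_group[OF normal_a])

lemma carrier_quot: "carrier quot = (\<lambda>x. {x, a \<otimes> x}) ` carrier G"
  by (auto simp: carrier_FactGroup coset_eq)

lemma coset_in_quot: "x \<in> carrier G \<Longrightarrow> {x, a \<otimes> x} \<in> carrier quot"
  by (simp add: carrier_quot)

lemma quot_mult: "x \<in> carrier G \<Longrightarrow> y \<in> carrier G \<Longrightarrow> {x, a \<otimes> x} <#> {y, a \<otimes> y} = {x \<otimes> y, a \<otimes> (x \<otimes> y)}"
  using normal.rcos_sum[OF normal_a, of x y] by (simp add: coset_eq)

lemma coset_rep: "C \<in> carrier quot \<Longrightarrow> x \<in> C \<Longrightarrow> x \<in> carrier G \<and> C = {x, a \<otimes> x}"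
  by (auto simp: carrier_quot)

lemma coset_nonempty: "C \<in> carrier quot \<Longrightarrow> C \<noteq> {}"
  by (auto simp: carrier_quot)

end

section \<open>Consequences of Hom(H, Z_2) = 1: sign characters and lifting of automorphisms\<close>

locale no_sign_quotient = central_involution +
  assumes hom_Z2: "carrier (hom_group (G Mod {\<one>\<^bsub>G\<^esub>, a}) (integer_mod_group 2)) =
    {\<one>\<^bsub>hom_group (G Mod {\<one>\<^bsub>G\<^esub>, a}) (integer_mod_group 2)\<^esub>}"
begin

text \<open>The hypotheses make \<open>\<chi>\<close> a character with values 1 and -1 that is
  constant on the cosets of \<open>{\<one>, a}\<close>; writing its values additively gives an
  element of Hom(H, Z_2), which is trivial. The target field is left open because the lemma serves
  both over \<open>'k\<close> and over \<open>rat\<close>.\<close>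

lemma sign_trivial:
  fixes \<chi> :: "'a \<Rightarrow> 'k::field_char_0"
  assumes mult: "\<And>x y. x \<in> carrier G \<Longrightarrow> y \<in> carrier G \<Longrightarrow> \<chi> (x \<otimes> y) = \<chi> x * \<chi> y"
    and sq: "\<And>x. x \<in> carrier G \<Longrightarrow> \<chi> x * \<chi> x = 1" and a: "\<chi> a = 1" and x: "x \<in> carrier G"
  shows "\<chi> x = 1"
proof -
  define \<theta> where "\<theta> = (\<lambda>C\<in>carrier quot. if \<forall>x\<in>C. \<chi> x = 1 then 0 else 1 :: int)"
  have th: "\<theta> {x, a \<otimes> x} = (if \<chi> x = 1 then 0 else 1)" if "x \<in> carrier G" for x
    using that by (auto simp: \<theta>_def coset_in_quot mult a)
  have pm: "\<chi> x = 1 \<or> \<chi> x = -1" if "x \<in> carrier G" for x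
    using sq[OF that] by (simp add: square_eq_1_iff)
  have "\<theta> (C \<otimes>\<^bsub>quot\<^esub> D) = (\<theta> C + \<theta> D) mod 2" if CD: "C \<in> carrier quot" "D \<in> carrier quot" for C D
  proof -
    obtain x y where "C = {x, a \<otimes> x}" "D = {y, a \<otimes> y}" "x \<in> carrier G" "y \<in> carrier G"
      using CD unfolding carrier_quot by auto
    then show ?thesis using pm[of x] pm[of y] by (auto simp: quot_mult th mult)
  qed
  then have "\<theta> \<in> carrier (hom_group quot (integer_mod_group 2))"
    by (auto simp: hom_group_def hom_def carrier_integer_mod_group \<theta>_def)
  then have "\<theta> = (\<lambda>C\<in>carrier quot. 0)" by (simp add: hom_Z2) (simp add: hom_group_def)
  then have "\<theta> {x, a \<otimes> x} = 0" using x by (simp add: coset_in_quot)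
  then show ?thesis using th[OF x] by (simp split: if_splits)
qed

text \<open>Descent on the exponent, starting from the order of G: if 2k is an exponent, then the
  k-th power of \<open>\<chi>\<close> squares to 1, so \<open>sign_trivial\<close> makes k an
  exponent as well. Halving stops at an odd number.\<close>

lemma character_odd_order:
  fixes \<chi> :: "'a \<Rightarrow> 'k::field_char_0"
  assumes mult: "\<And>x y. x \<in> carrier G \<Longrightarrow> y \<in> carrier G \<Longrightarrow> \<chi> (x \<otimes> y) = \<chi> x * \<chi> y"
    and nz: "\<And>x. x \<in> carrier G \<Longrightarrow> \<chi> x \<noteq> 0" and a: "\<chi> a = 1"
  obtains m where "odd m" "\<And>x. x \<in> carrier G \<Longrightarrow> \<chi> x ^ m = 1"
proof -
  have "\<exists>m. odd m \<and> (\<forall>x\<in>carrier G. \<chi> x ^ m = 1)"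
    if "n > 0" "\<forall>x\<in>carrier G. \<chi> x ^ n = 1" for n :: nat
    using that
  proof (induction n rule: less_induct)
    case (less n)
    show ?case
    proof (cases "odd n")
      case False
      then obtain k where k: "n = 2 * k" by auto
      have "\<chi> x ^ k = 1" if "x \<in> carrier G" for x
      proof (rule sign_trivial[OF _ _ _ that])
        show "\<chi> x ^ k * \<chi> x ^ k = 1" if "x \<in> carrier G" for x
          using less.prems(2) that by (simp add: k flip: power_add mult_2)
      qed (simp_all add: mult power_mult_distrib a)
      then show ?thesis using less.IH[of k] less.prems k by auto
    qed (use less.prems in blast)
  qed
  moreover have "\<chi> \<one> * \<chi> \<one> = \<chi> \<one>" using mult[of \<one> \<one>] by simp
  then have "\<chi> \<one> = 1" using nz[of \<one>] by simp
  have "\<chi> (x [^] n) = \<chi> x ^ n" if "x \<in> carrier G" for x and n :: nat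
    by (induction n) (use that \<open>\<chi> \<one> = 1\<close> in \<open>simp_all add: mult\<close>)
  then have "\<forall>x\<in>carrier G. \<chi> x ^ Coset.order G = 1"
    using pow_order_eq_1 \<open>\<chi> \<one> = 1\<close> by metis
  moreover have "Coset.order G > 0" using finite_carrier order_gt_0_iff_finite by blast
  ultimately show ?thesis using that by blast
qed

text \<open>The classes of \<open>\<sigma>\<close> and of its pullback along f have order at most
  two, so cyclicity of the cohomology group makes them cohomologous through some cochain
  \<open>\<mu>\<close> with values in the units of the field. Since \<open>\<sigma>\<close> is a
  sign, the square of \<open>\<mu>\<close> is a character of H; its odd order allows
  \<open>\<mu>\<close> to be replaced by a sign-valued cochain.\<close>

lemma sign_cocycle_cohomologous:
  fixes \<sigma> :: "'a set \<times> 'a set \<Rightarrow> 'k::field_char_0"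
  assumes cyc: "cyclic_group (cohomology2 quot (field_units :: 'k monoid))"
    and sq: "\<And>C D. C \<in> carrier quot \<Longrightarrow> D \<in> carrier quot \<Longrightarrow> \<sigma> (C, D) * \<sigma> (C, D) = 1"
    and coc: "\<And>C D E. C \<in> carrier quot \<Longrightarrow> D \<in> carrier quot \<Longrightarrow> E \<in> carrier quot \<Longrightarrow>
      \<sigma> (D, E) * \<sigma> (C, D \<otimes>\<^bsub>quot\<^esub> E) = \<sigma> (C \<otimes>\<^bsub>quot\<^esub> D, E) * \<sigma> (C, D)"
    and f: "f \<in> iso quot quot"
  obtains \<mu> where "\<And>C. C \<in> carrier quot \<Longrightarrow> \<mu> C * \<mu> C = 1"
    "\<And>C D. C \<in> carrier quot \<Longrightarrow> D \<in> carrier quot \<Longrightarrow>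
      \<sigma> (f C, f D) = \<mu> C * \<mu> D * \<mu> (C \<otimes>\<^bsub>quot\<^esub> D) * \<sigma> (C, D)"
proof -
  let ?M = "field_units :: 'k monoid"
  let ?P = "carrier quot \<times> carrier quot"
  interpret H: group quot by (rule group_quot)
  interpret M: comm_group ?M by (rule comm_group_field_units)
  note [simp del] = carrier_mult_of mult_mult_of one_mult_of mult_FactGroup one_FactGroup
  note [simp] = field_units_simps inv_field_units
  have fc: "f C \<in> carrier quot" "f (C \<otimes>\<^bsub>quot\<^esub> D) = f C \<otimes>\<^bsub>quot\<^esub> f D"
    if "C \<in> carrier quot" "D \<in> carrier quot" for C D
    using f that by (auto simp: iso_def hom_def)
  have nz: "\<sigma> (C, D) \<noteq> 0" if "C \<in> carrier quot" "D \<in> carrier quot" for C D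
    using sq[OF that] by auto
  \<comment> \<open>Pulling back along the identity only makes \<open>\<sigma>\<close> extensional,
    so that \<open>\<sigma>\<close> and its pullback along f are treated alike.\<close>
  define pull where "pull g = (\<lambda>p\<in>?P. \<sigma> (g (fst p), g (snd p)))" for g
  have cocycle: "pull g \<in> carrier (cocycle_group2 quot ?M)" if "g \<in> iso quot quot" for g
  proof -
    have "g C \<in> carrier quot" "g (C \<otimes>\<^bsub>quot\<^esub> D) = g C \<otimes>\<^bsub>quot\<^esub> g D"
      if "C \<in> carrier quot" "D \<in> carrier quot" for C D
      using \<open>g \<in> iso quot quot\<close> that by (auto simp: iso_def hom_def)
    then show ?thesis by (auto simp: cocycle_group2_simps pull_def coc nz)
  qed
  have one_B: "\<one>\<^bsub>cocycle_group2 quot ?M\<^esub> \<in> coboundaries2 quot ?M"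
    by (rule subgroup.one_closed[OF M.subgroup_coboundaries2[OF H.is_group]])
  have square: "pull g \<otimes>\<^bsub>cocycle_group2 quot ?M\<^esub> pull g \<in> coboundaries2 quot ?M" if "g \<in> iso quot quot" for g
  proof -
    have "g C \<in> carrier quot" if "C \<in> carrier quot" for C
      using \<open>g \<in> iso quot quot\<close> that by (auto simp: iso_def hom_def)
    then have "pull g \<otimes>\<^bsub>cocycle_group2 quot ?M\<^esub> pull g = \<one>\<^bsub>cocycle_group2 quot ?M\<^esub>"
      by (auto simp: cocycle_group2_simps pull_def sq fun_eq_iff)
    then show ?thesis using one_B by simp
  qed
  have pull_B: "(\<lambda>p\<in>?P. \<tau> (g (fst p), g (snd p))) \<in> coboundaries2 quot ?M"
    if g: "g \<in> iso quot quot" and t: "\<tau> \<in> coboundaries2 quot ?M" for g \<tau>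
  proof -
    have gc: "g C \<in> carrier quot" "g (C \<otimes>\<^bsub>quot\<^esub> D) = g C \<otimes>\<^bsub>quot\<^esub> g D"
      if "C \<in> carrier quot" "D \<in> carrier quot" for C D
      using g that by (auto simp: iso_def hom_def)
    obtain \<mu> where m: "\<mu> \<in> carrier quot \<rightarrow>\<^sub>E carrier ?M"
      "\<tau> = (\<lambda>(x, y)\<in>?P. \<mu> y \<otimes>\<^bsub>?M\<^esub> inv\<^bsub>?M\<^esub> (\<mu> (x \<otimes>\<^bsub>quot\<^esub> y)) \<otimes>\<^bsub>?M\<^esub> \<mu> x)"
      using t unfolding coboundaries2_def by blast
    have n: "(\<lambda>x\<in>carrier quot. \<mu> (g x)) \<in> carrier quot \<rightarrow>\<^sub>E carrier ?M"
      using PiE_mem[OF m(1)] gc by auto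
    have "(\<lambda>p\<in>?P. \<tau> (g (fst p), g (snd p))) = (\<lambda>(x, y)\<in>?P. (\<lambda>x\<in>carrier quot. \<mu> (g x)) y \<otimes>\<^bsub>?M\<^esub>
       inv\<^bsub>?M\<^esub> ((\<lambda>x\<in>carrier quot. \<mu> (g x)) (x \<otimes>\<^bsub>quot\<^esub> y)) \<otimes>\<^bsub>?M\<^esub> (\<lambda>x\<in>carrier quot. \<mu> (g x)) x)"
      unfolding m(2) by (intro restrict_ext) (auto simp: gc)
    then show ?thesis unfolding coboundaries2_def using n by blast
  qed
  have id: "(\<lambda>x. x) \<in> iso quot quot" by (simp add: iso_def hom_def bij_betw_def)
  \<comment> \<open>Pullback along f and along its inverse both preserve coboundaries, so the two
    cocycles are trivial together.\<close>
  have "pull (\<lambda>x. x) \<in> coboundaries2 quot ?M \<longleftrightarrow> pull f \<in> coboundaries2 quot ?M"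
  proof
    assume "pull (\<lambda>x. x) \<in> coboundaries2 quot ?M"
    from pull_B[OF f this] show "pull f \<in> coboundaries2 quot ?M"
      by (rule back_subst[of "\<lambda>x. x \<in> _"]) (auto simp: pull_def fc fun_eq_iff)
  next
    let ?g = "inv_into (carrier quot) f"
    have g: "?g \<in> iso quot quot" by (rule H.iso_set_sym[OF f])
    then have gc: "?g C \<in> carrier quot" if "C \<in> carrier quot" for C
      using that by (auto simp: iso_def hom_def)
    have fg: "f (?g C) = C" if "C \<in> carrier quot" for C
      using f that by (simp add: iso_def bij_betw_def f_inv_into_f)
    assume "pull f \<in> coboundaries2 quot ?M"
    from pull_B[OF g this] show "pull (\<lambda>x. x) \<in> coboundaries2 quot ?M"
      by (rule back_subst[of "\<lambda>x. x \<in> _"]) (auto simp: pull_def gc fg fun_eq_iff)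
  qed
  then obtain \<rho> where r: "\<rho> \<in> coboundaries2 quot ?M"
    and eq: "pull f = \<rho> \<otimes>\<^bsub>cocycle_group2 quot ?M\<^esub> pull (\<lambda>x. x)"
    using M.cohomology2_square_trivial[OF H.is_group cyc cocycle[OF id] square[OF id] cocycle[OF f] square[OF f]]
    by blast
  obtain \<mu> where m: "\<mu> \<in> carrier quot \<rightarrow>\<^sub>E carrier ?M"
    "\<rho> = (\<lambda>(x, y)\<in>?P. \<mu> y \<otimes>\<^bsub>?M\<^esub> inv\<^bsub>?M\<^esub> (\<mu> (x \<otimes>\<^bsub>quot\<^esub> y)) \<otimes>\<^bsub>?M\<^esub> \<mu> x)"
    using r unfolding coboundaries2_def by blast
  have mnz: "\<mu> C \<noteq> 0" if "C \<in> carrier quot" for C using PiE_mem[OF m(1) that] by simp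
  have s: "\<sigma> (f C, f D) = \<mu> D * inverse (\<mu> (C \<otimes>\<^bsub>quot\<^esub> D)) * \<mu> C * \<sigma> (C, D)"
    if "C \<in> carrier quot" "D \<in> carrier quot" for C D
    using fun_cong[OF eq, of "(C, D)"] that by (simp add: pull_def m(2) cocycle_group2_simps mnz)
  \<comment> \<open>Squaring the cohomology relation removes both values of \<open>\<sigma>\<close>
    and leaves multiplicativity of the square of \<open>\<mu>\<close>.\<close>
  have mm: "\<mu> (C \<otimes>\<^bsub>quot\<^esub> D) ^ 2 = \<mu> C ^ 2 * \<mu> D ^ 2"
    if "C \<in> carrier quot" "D \<in> carrier quot" for C D
  proof -
    have "(\<sigma> (f C, f D))\<^sup>2 = (\<mu> D * inverse (\<mu> (C \<otimes>\<^bsub>quot\<^esub> D)) * \<mu> C)\<^sup>2 * (\<sigma> (C, D))\<^sup>2"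
      by (simp add: s[OF that] power_mult_distrib)
    then have "(\<mu> D * inverse (\<mu> (C \<otimes>\<^bsub>quot\<^esub> D)) * \<mu> C)\<^sup>2 = 1"
      using sq that fc by (simp add: power2_eq_square)
    then show ?thesis using mnz[OF H.m_closed[OF that]] by (simp add: field_simps power2_eq_square)
  qed
  have "\<mu> (\<one>\<^bsub>quot\<^esub>) ^ 2 = 1"
    using mm[OF H.one_closed H.one_closed] mnz[OF H.one_closed]
    by (simp del: power2_eq_iff add: power2_eq_square)
  \<comment> \<open>The coset of \<open>a\<close> is the unit of H; this supplies the value 1 at
    \<open>a\<close> that \<open>character_odd_order\<close> asks for.\<close>
  moreover have "{a, \<one>} = \<one>\<^bsub>quot\<^esub>" by (auto simp: one_FactGroup)
  ultimately have "\<mu> {a, a \<otimes> a} ^ 2 = 1" by (simp add: a_square)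
  moreover have "\<mu> {x \<otimes> y, a \<otimes> (x \<otimes> y)} ^ 2 = \<mu> {x, a \<otimes> x} ^ 2 * \<mu> {y, a \<otimes> y} ^ 2"
    if "x \<in> carrier G" "y \<in> carrier G" for x y
    using mm[OF coset_in_quot coset_in_quot] that by (simp add: quot_mult mult_FactGroup)
  moreover have "\<mu> {x, a \<otimes> x} ^ 2 \<noteq> 0" if "x \<in> carrier G" for x
    using mnz[OF coset_in_quot[OF that]] by simp
  ultimately obtain n where n: "odd n" "\<And>x. x \<in> carrier G \<Longrightarrow> (\<mu> {x, a \<otimes> x} ^ 2) ^ n = 1"
    using character_odd_order[of "\<lambda>x. \<mu> {x, a \<otimes> x} ^ 2"] by blast
  obtain k where k: "n = 2 * k + 1" using n(1) by (elim oddE)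
  have m1: "(\<mu> C ^ 2) ^ n = 1" if "C \<in> carrier quot" for C
    using n(2) that unfolding carrier_quot by auto
  show ?thesis
  proof
    \<comment> \<open>For n = 2k + 1, \<open>?\<nu>\<close> is \<open>\<mu>\<close> times the k-th
      power of the character given by the square of \<open>\<mu>\<close>. That factor has trivial
      coboundary, so the coboundary is unchanged, while \<open>?\<nu>\<close> squares to the n-th
      power of the character, which is 1.\<close>
    let ?\<nu> = "\<lambda>C. \<mu> C ^ n"
    show m2: "?\<nu> C * ?\<nu> C = 1" if "C \<in> carrier quot" for C
      using m1[OF that] by (simp add: power2_eq_square power_mult_distrib)
    show "\<sigma> (f C, f D) = ?\<nu> C * ?\<nu> D * ?\<nu> (C \<otimes>\<^bsub>quot\<^esub> D) * \<sigma> (C, D)"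
      if CD: "C \<in> carrier quot" "D \<in> carrier quot" for C D
    proof -
      have "?\<nu> (C \<otimes>\<^bsub>quot\<^esub> D) = \<mu> (C \<otimes>\<^bsub>quot\<^esub> D) * (\<mu> (C \<otimes>\<^bsub>quot\<^esub> D) ^ 2) ^ k"
        by (simp add: k power_mult)
      also have "\<dots> = \<mu> (C \<otimes>\<^bsub>quot\<^esub> D) * (\<mu> C ^ 2) ^ k * (\<mu> D ^ 2) ^ k"
        by (simp add: mm CD power_mult_distrib)
      finally have nu: "?\<nu> (C \<otimes>\<^bsub>quot\<^esub> D) = \<mu> (C \<otimes>\<^bsub>quot\<^esub> D) * ?\<nu> C * ?\<nu> D * inverse (\<mu> C * \<mu> D)"
        using mnz CD by (simp add: k power_mult) (simp add: field_simps)
      \<comment> \<open>A sign equals its inverse, which brings the value at the product into the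
        denominator, as in the coboundary of \<open>\<mu>\<close>.\<close>
      have "?\<nu> C * ?\<nu> D * ?\<nu> (C \<otimes>\<^bsub>quot\<^esub> D) = inverse (?\<nu> C * ?\<nu> D * ?\<nu> (C \<otimes>\<^bsub>quot\<^esub> D))"
      proof (rule inverse_unique[symmetric])
        have *: "p * q * r * (p * q * r) = (p * p) * (q * q) * (r * r)" for p q r :: 'k
          by (simp add: mult_ac)
        show "?\<nu> C * ?\<nu> D * ?\<nu> (C \<otimes>\<^bsub>quot\<^esub> D) * (?\<nu> C * ?\<nu> D * ?\<nu> (C \<otimes>\<^bsub>quot\<^esub> D)) = 1"
          unfolding * m2[OF CD(1)] m2[OF CD(2)] m2[OF H.m_closed[OF CD]] by simp
      qed
      also have "\<dots> = inverse (?\<nu> C * ?\<nu> C * (?\<nu> D * ?\<nu> D) * (\<mu> (C \<otimes>\<^bsub>quot\<^esub> D) * inverse (\<mu> C * \<mu> D)))"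
        unfolding nu by (simp add: mult_ac)
      also have "\<dots> = \<mu> D * inverse (\<mu> (C \<otimes>\<^bsub>quot\<^esub> D)) * \<mu> C"
        using CD mnz by (simp add: m2 field_simps)
      finally show ?thesis by (simp add: s CD)
    qed
  qed
qed

text \<open>A section of G over H identifies G with pairs of a sign and a coset, multiplied through
  a cocycle \<open>\<sigma>\<close>. In this description the lift applies f to the coset and
  multiplies the sign by the cochain \<open>\<mu>\<close> that compares \<open>\<sigma>\<close> with
  its pullback; the relation satisfied by \<open>\<mu>\<close> is exactly multiplicativity of the
  lift.\<close>

lemma lift_quotient_automorphism:
  assumes cyc: "cyclic_group (cohomology2 quot (field_units :: 'k::field_char_0 monoid))"
    and f: "f \<in> iso quot quot"
  obtains g where "g \<in> iso G G" "g a = a" "\<And>x. x \<in> carrier G \<Longrightarrow> g x \<in> f {x, a \<otimes> x}"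
proof -
  interpret H: group quot by (rule group_quot)
  note [simp del] = mult_FactGroup one_FactGroup
  note [simp] = quot_mult[folded mult_FactGroup[of G "{\<one>, a}"]]
  have fc: "f C \<in> carrier quot" if "C \<in> carrier quot" for C
    using f that by (auto simp: iso_def hom_def)
  have f_mult: "f (C \<otimes>\<^bsub>quot\<^esub> D) = f C \<otimes>\<^bsub>quot\<^esub> f D"
    if "C \<in> carrier quot" "D \<in> carrier quot" for C D
    using f that by (auto simp: iso_def hom_def)
  define r where "r C = (SOME x. x \<in> C)" for C :: "'a set"
  have rin: "r C \<in> C" if "C \<in> carrier quot" for C
    unfolding r_def using coset_nonempty[OF that] by (simp add: some_in_eq)
  have rc: "r C \<in> carrier G" "{r C, a \<otimes> r C} = C" if "C \<in> carrier quot" for C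
    using coset_rep[OF that rin[OF that]] by auto
  \<comment> \<open>\<open>e\<close> carries the signs 1 and -1 of the field to
    \<open>\<one>\<close> and \<open>a\<close>. Its multiplicativity is claimed for signs only,
    hence the side conditions of the form \<open>c * c = 1\<close>.\<close>
  define e where "e c = (if c = 1 then \<one> else a)" for c :: 'k
  have ec [simp]: "e c \<in> carrier G" for c by (simp add: e_def)
  have e_mult: "e (c * d) = e c \<otimes> e d" if "c * c = 1" "d * d = 1" for c d
    using that by (auto simp: e_def a_square square_eq_1_iff)
  have e_comm: "x \<otimes> e c = e c \<otimes> x" if "x \<in> carrier G" for x c
    using that by (auto simp: e_def a_comm)
  have e_inj: "c = d" if "e c \<otimes> x = e d \<otimes> x" "x \<in> carrier G" "c * c = 1" "d * d = 1" for c d x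
    using that a_mult_neq[of x] by (auto simp: e_def square_eq_1_iff split: if_splits)
  have e_coset: "\<exists>c. c * c = 1 \<and> x = e c \<otimes> r C" if "C \<in> carrier quot" "x \<in> C" for x C
  proof (cases "x = r C")
    case True
    then show ?thesis using rc[OF that(1)] by (intro exI[of _ 1]) (simp add: e_def)
  next
    case False
    then have "x = a \<otimes> r C" using that rc(2)[OF that(1)] by auto
    then show ?thesis by (intro exI[of _ "-1"]) (simp add: e_def)
  qed
  have prod: "(e c \<otimes> x) \<otimes> (e d \<otimes> y) = e (c * d) \<otimes> (x \<otimes> y)"
    if "x \<in> carrier G" "y \<in> carrier G" "c * c = 1" "d * d = 1" for c d x y
  proof -
    have "(e c \<otimes> x) \<otimes> (e d \<otimes> y) = e c \<otimes> (x \<otimes> e d) \<otimes> y" using that by (simp add: m_assoc)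
    also have "\<dots> = e (c * d) \<otimes> (x \<otimes> y)" using that by (simp add: e_comm[of x] e_mult m_assoc)
    finally show ?thesis .
  qed
  have "\<exists>c. c * c = 1 \<and> r C \<otimes> r D = e c \<otimes> r (C \<otimes>\<^bsub>quot\<^esub> D)" if "C \<in> carrier quot" "D \<in> carrier quot" for C D
  proof (rule e_coset)
    have "{r C, a \<otimes> r C} \<otimes>\<^bsub>quot\<^esub> {r D, a \<otimes> r D} = {r C \<otimes> r D, a \<otimes> (r C \<otimes> r D)}"
      using rc(1) that by simp
    then show "r C \<otimes> r D \<in> C \<otimes>\<^bsub>quot\<^esub> D" using that rc(2) by simp
  qed (use that in simp)
  then have "\<forall>C D. \<exists>c. C \<in> carrier quot \<longrightarrow> D \<in> carrier quot \<longrightarrow>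
      c * c = 1 \<and> r C \<otimes> r D = e c \<otimes> r (C \<otimes>\<^bsub>quot\<^esub> D)" by blast
  then obtain s where s: "\<And>C D. C \<in> carrier quot \<Longrightarrow> D \<in> carrier quot \<Longrightarrow>
      s C D * s C D = 1 \<and> r C \<otimes> r D = e (s C D) \<otimes> r (C \<otimes>\<^bsub>quot\<^esub> D)"
    unfolding choice_iff by blast
  define \<sigma> where "\<sigma> = (\<lambda>(C, D). s C D)"
  have \<sigma>: "\<sigma> (C, D) * \<sigma> (C, D) = 1" "r C \<otimes> r D = e (\<sigma> (C, D)) \<otimes> r (C \<otimes>\<^bsub>quot\<^esub> D)"
    if "C \<in> carrier quot" "D \<in> carrier quot" for C D
    using s[OF that] by (simp_all add: \<sigma>_def)
  have coc: "\<sigma> (D, E) * \<sigma> (C, D \<otimes>\<^bsub>quot\<^esub> E) = \<sigma> (C \<otimes>\<^bsub>quot\<^esub> D, E) * \<sigma> (C, D)"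
    if "C \<in> carrier quot" "D \<in> carrier quot" "E \<in> carrier quot" for C D E
  proof (rule e_inj)
    \<comment> \<open>The cocycle identity is associativity of the product of \<open>r C\<close>,
      \<open>r D\<close>, \<open>r E\<close>, expanded from both sides with \<open>e\<close> moved
      to the front.\<close>
    have "e (\<sigma> (D, E) * \<sigma> (C, D \<otimes>\<^bsub>quot\<^esub> E)) \<otimes> r (C \<otimes>\<^bsub>quot\<^esub> (D \<otimes>\<^bsub>quot\<^esub> E)) =
        e (\<sigma> (D, E)) \<otimes> (r C \<otimes> r (D \<otimes>\<^bsub>quot\<^esub> E))"
      using that by (simp add: e_mult \<sigma> rc m_assoc)
    also have "\<dots> = r C \<otimes> (e (\<sigma> (D, E)) \<otimes> r (D \<otimes>\<^bsub>quot\<^esub> E))"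
      using that by (simp add: rc e_comm[of "r C"] flip: m_assoc)
    also have "\<dots> = r C \<otimes> r D \<otimes> r E" using that by (simp add: \<sigma>(2)[symmetric] rc m_assoc)
    also have "\<dots> = e (\<sigma> (C, D)) \<otimes> (r (C \<otimes>\<^bsub>quot\<^esub> D) \<otimes> r E)" using that by (simp add: \<sigma>(2) rc m_assoc)
    also have "\<dots> = e (\<sigma> (C, D) * \<sigma> (C \<otimes>\<^bsub>quot\<^esub> D, E)) \<otimes> r (C \<otimes>\<^bsub>quot\<^esub> (D \<otimes>\<^bsub>quot\<^esub> E))"
      using that by (simp add: e_mult \<sigma> rc m_assoc H.m_assoc)
    also have "\<sigma> (C, D) * \<sigma> (C \<otimes>\<^bsub>quot\<^esub> D, E) = \<sigma> (C \<otimes>\<^bsub>quot\<^esub> D, E) * \<sigma> (C, D)"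
      by (rule mult.commute)
    finally show "e (\<sigma> (D, E) * \<sigma> (C, D \<otimes>\<^bsub>quot\<^esub> E)) \<otimes> r (C \<otimes>\<^bsub>quot\<^esub> (D \<otimes>\<^bsub>quot\<^esub> E)) =
        e (\<sigma> (C \<otimes>\<^bsub>quot\<^esub> D, E) * \<sigma> (C, D)) \<otimes> r (C \<otimes>\<^bsub>quot\<^esub> (D \<otimes>\<^bsub>quot\<^esub> E))" .
    show "r (C \<otimes>\<^bsub>quot\<^esub> (D \<otimes>\<^bsub>quot\<^esub> E)) \<in> carrier G" using that rc by simp
  qed (use that \<sigma>(1) in \<open>simp_all add: mult.assoc mult.left_commute\<close>)
  obtain \<mu> where \<mu>: "\<And>C. C \<in> carrier quot \<Longrightarrow> \<mu> C * \<mu> C = 1"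
    "\<And>C D. C \<in> carrier quot \<Longrightarrow> D \<in> carrier quot \<Longrightarrow>
      \<sigma> (f C, f D) = \<mu> C * \<mu> D * \<mu> (C \<otimes>\<^bsub>quot\<^esub> D) * \<sigma> (C, D)"
    using sign_cocycle_cohomologous[OF cyc \<sigma>(1) coc f] by blast
  define g where "g x = e (\<mu> {x, a \<otimes> x} * (if x = r {x, a \<otimes> x} then 1 else -1)) \<otimes> r (f {x, a \<otimes> x})" for x
  have g: "g (e c \<otimes> r C) = e (\<mu> C * c) \<otimes> r (f C)" if C: "C \<in> carrier quot" and c: "c * c = 1" for C c
  proof -
    have "{e c \<otimes> r C, a \<otimes> (e c \<otimes> r C)} = C"
      using rc[OF C] by (auto simp: e_def)
    moreover have "(if e c \<otimes> r C = r C then 1 else -1) = c"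
      using c rc(1)[OF C] a_mult_neq[of "r C"] by (auto simp: e_def square_eq_1_iff)
    ultimately show ?thesis by (simp add: g_def)
  qed
  have rep: "\<exists>c. c * c = 1 \<and> x = e c \<otimes> r {x, a \<otimes> x}" if "x \<in> carrier G" for x
    using e_coset[OF coset_in_quot[OF that], of x] by simp
  have gc: "g x \<in> carrier G" if "x \<in> carrier G" for x
    using that by (simp add: g_def rc fc coset_in_quot)
  have ga: "g (a \<otimes> x) = a \<otimes> g x" if x: "x \<in> carrier G" for x
  proof -
    obtain c where c: "c * c = 1" "x = e c \<otimes> r {x, a \<otimes> x}" using rep[OF x] by blast
    let ?C = "{x, a \<otimes> x}"
    have a': "a \<otimes> (e d \<otimes> y) = e (- d) \<otimes> y" if "d * d = 1" "y \<in> carrier G" for d y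
      using that by (auto simp: e_def square_eq_1_iff)
    have C: "?C \<in> carrier quot" using x by (rule coset_in_quot)
    have "g (a \<otimes> x) = g (a \<otimes> (e c \<otimes> r ?C))" using c(2) by simp
    also have "\<dots> = e (\<mu> ?C * (- c)) \<otimes> r (f ?C)" using C c(1) by (simp add: a' rc g)
    also have "\<dots> = a \<otimes> (e (\<mu> ?C * c) \<otimes> r (f ?C))"
      using C c(1) \<mu>(1)[OF C] by (subst a') (simp_all add: rc fc mult.assoc mult.left_commute)
    also have "\<dots> = a \<otimes> g x" using g[OF C c(1)] c(2) by simp
    finally show ?thesis .
  qed
  have gf: "{g x, a \<otimes> g x} = f {x, a \<otimes> x}" if "x \<in> carrier G" for x
  proof -
    have "{r (f {x, a \<otimes> x}), a \<otimes> r (f {x, a \<otimes> x})} = f {x, a \<otimes> x}" "r (f {x, a \<otimes> x}) \<in> carrier G"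
      using rc fc coset_in_quot[OF that] by auto
    then show ?thesis by (auto simp: g_def e_def)
  qed
  have hom: "g (x \<otimes> y) = g x \<otimes> g y" if x: "x \<in> carrier G" and y: "y \<in> carrier G" for x y
  proof -
    define C D where "C = {x, a \<otimes> x}" and "D = {y, a \<otimes> y}"
    have CD: "C \<in> carrier quot" "D \<in> carrier quot" using x y by (simp_all add: C_def D_def coset_in_quot)
    obtain c d where c: "c * c = 1" "x = e c \<otimes> r C" and d: "d * d = 1" "y = e d \<otimes> r D"
      using rep x y unfolding C_def D_def by metis
    have cd: "c * d * (c * d) = 1" using c(1) d(1) by (simp add: mult.assoc mult.left_commute)
    have "x \<otimes> y = e (c * d) \<otimes> (e (\<sigma> (C, D)) \<otimes> r (C \<otimes>\<^bsub>quot\<^esub> D))"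
      using prod[OF rc(1)[OF CD(1)] rc(1)[OF CD(2)] c(1) d(1)] c(2) d(2) \<sigma>(2)[OF CD] by simp
    also have "\<dots> = e (c * d * \<sigma> (C, D)) \<otimes> r (C \<otimes>\<^bsub>quot\<^esub> D)"
      using CD c(1) d(1) cd \<sigma>(1)[OF CD] by (subst e_mult) (simp_all add: rc m_assoc)
    finally have "g (x \<otimes> y) = e (\<mu> (C \<otimes>\<^bsub>quot\<^esub> D) * (c * d * \<sigma> (C, D))) \<otimes> r (f C \<otimes>\<^bsub>quot\<^esub> f D)"
      using CD c(1) d(1) by (simp add: g \<sigma> f_mult mult.assoc mult.left_commute)
    also have "\<mu> (C \<otimes>\<^bsub>quot\<^esub> D) * (c * d * \<sigma> (C, D)) = (\<mu> C * c) * (\<mu> D * d) * \<sigma> (f C, f D)"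
    proof -
      have "(\<mu> C * c) * (\<mu> D * d) * \<sigma> (f C, f D) =
          (\<mu> C * \<mu> C) * (\<mu> D * \<mu> D) * (\<mu> (C \<otimes>\<^bsub>quot\<^esub> D) * (c * d * \<sigma> (C, D)))"
        unfolding \<mu>(2)[OF CD] by (simp add: mult_ac)
      then show ?thesis unfolding \<mu>(1)[OF CD(1)] \<mu>(1)[OF CD(2)] by (metis mult_1)
    qed
    also have "e \<dots> \<otimes> r (f C \<otimes>\<^bsub>quot\<^esub> f D) = e ((\<mu> C * c) * (\<mu> D * d)) \<otimes> (r (f C) \<otimes> r (f D))"
      using CD c(1) d(1) \<mu>(1)[OF CD(1)] \<mu>(1)[OF CD(2)]
      by (subst e_mult) (simp_all add: \<sigma> rc fc m_assoc mult.assoc mult.left_commute)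
    also have "\<dots> = g (e c \<otimes> r C) \<otimes> g (e d \<otimes> r D)"
      using CD c(1) d(1) \<mu>(1)[OF CD(1)] \<mu>(1)[OF CD(2)]
      by (simp add: g prod rc fc mult.assoc mult.left_commute)
    finally show ?thesis using c(2) d(2) by simp
  qed
  \<comment> \<open>Equal values force equal cosets because f is injective; two distinct points of
    one coset differ by \<open>a\<close>, which g carries along. Surjectivity then comes from
    finiteness.\<close>
  have "g x \<noteq> g y" if "x \<in> carrier G" "y \<in> carrier G" "x \<noteq> y" for x y
  proof
    assume eq: "g x = g y"
    then have "f {x, a \<otimes> x} = f {y, a \<otimes> y}" using gf that(1,2) by metis
    then have "{x, a \<otimes> x} = {y, a \<otimes> y}"
      using f that by (auto simp: iso_def bij_betw_def inj_on_def coset_in_quot)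
    then have "x = a \<otimes> y" using that(3) by auto
    then show False using eq ga[OF that(2)] a_mult_neq[OF gc[OF that(2)]] by simp
  qed
  then have inj: "inj_on g (carrier G)" by (auto simp: inj_on_def)
  have "g ` carrier G = carrier G"
    by (rule endo_inj_surj[OF finite_carrier _ inj]) (use gc in blast)
  then have iso: "g \<in> iso G G" using inj gc hom by (auto simp: iso_def hom_def bij_betw_def)
  have "g \<one> \<otimes> g \<one> = g \<one>" using hom[of \<one> \<one>] by simp
  then have "g \<one> = \<one>" using gc[of \<one>] by simp
  then have "g a = a" using ga[of \<one>] by simp
  with iso show ?thesis by (rule that) (use gf in blast)
qed

text \<open>The quotient of the homomorphisms \<open>s \<circ> g\<close> and
  \<open>g \<circ> t\<close> takes values in the central subgroup \<open>{\<one>, a}\<close>, so it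
  is a sign character of G. It is trivial at \<open>a\<close>, hence everywhere by
  \<open>sign_trivial\<close>.\<close>

lemma intertwines_if_intertwines_mod:
  assumes s: "s \<in> hom G G" "s a = a" and t: "t \<in> hom G G" "t a = a"
    and g: "g \<in> hom G G" "g a = a"
    and mod: "\<And>x. x \<in> carrier G \<Longrightarrow> s (g x) \<in> {g (t x), a \<otimes> g (t x)}"
    and x: "x \<in> carrier G"
  shows "s (g x) = g (t x)"
proof -
  have hom: "h x \<in> carrier G" "h (x \<otimes> y) = h x \<otimes> h y"
    if "h \<in> {s, t, g}" "x \<in> carrier G" "y \<in> carrier G" for h x y
    using s(1) t(1) g(1) that by (auto simp: hom_def)
  define \<chi> where "\<chi> x = (if s (g x) = g (t x) then 1 else -1 :: rat)" for x
  have "\<chi> x = 1"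
  proof (rule sign_trivial[OF _ _ _ x])
    show "\<chi> a = 1" by (simp add: \<chi>_def s t g)
    show "\<chi> (x \<otimes> y) = \<chi> x * \<chi> y" if xy: "x \<in> carrier G" "y \<in> carrier G" for x y
    proof -
      have c: "g (t x) \<in> carrier G" "g (t y) \<in> carrier G" using hom xy by auto
      have "s (g (x \<otimes> y)) = s (g x) \<otimes> s (g y)" "g (t (x \<otimes> y)) = g (t x) \<otimes> g (t y)"
        using hom xy by auto
      then show ?thesis
        using mod[OF xy(1)] mod[OF xy(2)] c a_mult_neq[of "g (t x)"] a_mult_neq[of "g (t y)"]
          a_mult_neq[of "g (t x) \<otimes> g (t y)"]
        by (elim insertE emptyE) (simp_all add: \<chi>_def m_assoc a_lcomm[of "g (t x)"])
    qed
  qed (simp add: \<chi>_def)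
  then show ?thesis by (simp add: \<chi>_def split: if_splits)
qed

lemma lift_weak_equivalence:
  assumes cyc: "cyclic_group (cohomology2 quot (field_units :: 'k::field_char_0 monoid))"
    and f: "f \<in> iso quot quot"
    and s: "s \<in> hom G G" "s a = a" and t: "t \<in> hom G G" "t a = a"
    and inter: "\<And>C. C \<in> carrier quot \<Longrightarrow> s ` f C = f (t ` C)"
  obtains g where "g \<in> iso G G" "g a = a" "\<And>x. x \<in> carrier G \<Longrightarrow> s (g x) = g (t x)"
proof -
  obtain g where g: "g \<in> iso G G" "g a = a" and gf: "\<And>x. x \<in> carrier G \<Longrightarrow> g x \<in> f {x, a \<otimes> x}"
    using lift_quotient_automorphism[OF cyc f] by blast
  have gh: "g \<in> hom G G" using g(1) by (simp add: iso_def)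
  have "s (g x) \<in> {g (t x), a \<otimes> g (t x)}" if x: "x \<in> carrier G" for x
  proof -
    have tx: "t x \<in> carrier G" "t (a \<otimes> x) = a \<otimes> t x" using t x by (auto simp: hom_def)
    have "s (g x) \<in> s ` f {x, a \<otimes> x}" using gf[OF x] by blast
    also have "\<dots> = f {t x, a \<otimes> t x}" using inter[OF coset_in_quot[OF x]] tx by simp
    also have "\<dots> = {g (t x), a \<otimes> g (t x)}"
      using coset_rep[OF _ gf[OF tx(1)]] f coset_in_quot[OF tx(1)] by (auto simp: iso_def hom_def)
    finally show ?thesis .
  qed
  then have "s (g x) = g (t x)" if "x \<in> carrier G" for x
    using intertwines_if_intertwines_mod[OF s t gh g(2)] that by blast
  with g show ?thesis using that by blast
qed

end

section \<open>Isomorphisms of twisted function algebras\<close>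

context central_involution
begin

abbreviation funs :: "('a \<Rightarrow> 'k::field) set" where
  "funs \<equiv> carrier G \<rightarrow>\<^sub>E UNIV"

text \<open>\<open>(\<phi> x \<plusminus> \<phi> (a x)) / 2\<close> are the homogeneous components of \<open>\<phi>\<close>.\<close>

definition twisted_mult :: "('a \<Rightarrow> 'a) \<Rightarrow> ('a \<Rightarrow> 'k::field) \<Rightarrow> ('a \<Rightarrow> 'k) \<Rightarrow> 'a \<Rightarrow> 'k" where
  "twisted_mult s \<phi> \<psi> = (\<lambda>x\<in>carrier G.
     (\<phi> x + \<phi> (a \<otimes> x)) / 2 * \<psi> x + (\<phi> x - \<phi> (a \<otimes> x)) / 2 * \<psi> (s x))"

lemma twisted_mult_in [simp]: "twisted_mult s \<phi> \<psi> \<in> funs"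
  by (simp add: twisted_mult_def)

lemma twisted_mult_even:
  fixes \<phi> \<psi> :: "'a \<Rightarrow> 'k::field_char_0"
  assumes "\<And>x. x \<in> carrier G \<Longrightarrow> \<phi> (a \<otimes> x) = \<phi> x"
  shows "twisted_mult s \<phi> \<psi> = (\<lambda>x\<in>carrier G. \<phi> x * \<psi> x)"
  unfolding twisted_mult_def using assms by (intro restrict_ext) simp

lemma twisted_mult_odd:
  fixes \<phi> \<psi> :: "'a \<Rightarrow> 'k::field_char_0"
  assumes "\<And>x. x \<in> carrier G \<Longrightarrow> \<phi> (a \<otimes> x) = - \<phi> x"
  shows "twisted_mult s \<phi> \<psi> = (\<lambda>x\<in>carrier G. \<phi> x * \<psi> (s x))"
  unfolding twisted_mult_def using assms by (intro restrict_ext) simp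

lemma mult_bij: "x \<in> carrier G \<Longrightarrow> bij_betw (\<lambda>y. x \<otimes> y) (carrier G) (carrier G)"
  by (rule bij_betwI[where g = "\<lambda>y. inv x \<otimes> y"]) (simp_all add: m_assoc[symmetric])

lemma sum_delta_mult:
  fixes \<phi> :: "'a \<Rightarrow> 'k::field"
  shows "x \<in> carrier G \<Longrightarrow> (\<Sum>y\<in>carrier G. delta G x y * \<phi> y) = \<phi> x"
    "x \<in> carrier G \<Longrightarrow> (\<Sum>y\<in>carrier G. \<phi> y * delta G x y) = \<phi> x"
  by (simp_all add: delta_def if_distrib[of "\<lambda>c. c * _"] if_distrib[of "\<lambda>c. _ * c"] finite_carrier cong: if_cong)

text \<open>On even functions, which form a product of copies of the field indexed by the cosets, T
  is a character and hence lives on one coset. Multiplying by the indicator of that coset does not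
  change T, so on arbitrary functions T depends only on the two values there, with weights adding up
  to 1.\<close>

lemma twisted_character:
  fixes T :: "('a \<Rightarrow> 'k::field_char_0) \<Rightarrow> 'k"
  assumes lin: "\<And>\<phi>. \<phi> \<in> funs \<Longrightarrow> T \<phi> = (\<Sum>y\<in>carrier G. \<phi> y * m y)"
    and one: "T (\<lambda>x\<in>carrier G. 1) = 1"
    and mult: "\<And>\<phi> \<psi>. \<phi> \<in> funs \<Longrightarrow> \<psi> \<in> funs \<Longrightarrow>
      (\<And>x. x \<in> carrier G \<Longrightarrow> \<phi> (a \<otimes> x) = \<phi> x) \<Longrightarrow> T (\<lambda>x\<in>carrier G. \<phi> x * \<psi> x) = T \<phi> * T \<psi>"
  shows "\<exists>x\<in>carrier G. \<exists>p. \<forall>\<psi>\<in>funs. T \<psi> = p * \<psi> x + (1 - p) * \<psi> (a \<otimes> x)"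
proof -
  have 1: "(\<Sum>y\<in>carrier G. m y) = 1" using lin[of "\<lambda>x\<in>carrier G. 1"] one by simp
  have "(\<Sum>y\<in>carrier G. m (a \<otimes> y)) = (\<Sum>y\<in>carrier G. m y)"
    by (rule sum.reindex_bij_betw[OF mult_bij]) simp
  then have "(\<Sum>y\<in>carrier G. m y + m (a \<otimes> y)) = 2" using 1 by (simp add: sum.distrib)
  then have "\<not> (\<forall>y\<in>carrier G. m y + m (a \<otimes> y) = 0)" by (intro notI) simp
  then obtain x where x: "x \<in> carrier G" "m x + m (a \<otimes> x) \<noteq> 0" by blast
  define \<epsilon> where "\<epsilon> = (\<lambda>y\<in>carrier G. if y = x \<or> y = a \<otimes> x then 1 else 0 :: 'k)"
  have eps_sum: "(\<Sum>y\<in>carrier G. (if y = x \<or> y = a \<otimes> x then f y else 0)) = f x + f (a \<otimes> x)" for f :: "'a \<Rightarrow> 'k"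
  proof -
    have "(\<Sum>y\<in>carrier G. (if y = x \<or> y = a \<otimes> x then f y else 0)) = (\<Sum>y\<in>{x, a \<otimes> x}. f y)"
      using x finite_carrier by (intro sum.mono_neutral_cong_right) auto
    then show ?thesis using a_mult_neq[OF x(1)] by auto
  qed
  have eps_in: "\<epsilon> \<in> funs" by (simp add: \<epsilon>_def)
  have eps_even: "\<epsilon> (a \<otimes> y) = \<epsilon> y" if "y \<in> carrier G" for y
    using that x by (auto simp: \<epsilon>_def)
  have T_eps_mult: "T (\<lambda>y\<in>carrier G. \<epsilon> y * \<psi> y) = \<psi> x * m x + \<psi> (a \<otimes> x) * m (a \<otimes> x)" for \<psi>
  proof -
    have "T (\<lambda>y\<in>carrier G. \<epsilon> y * \<psi> y) =
        (\<Sum>y\<in>carrier G. if y = x \<or> y = a \<otimes> x then \<psi> y * m y else 0)"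
      by (subst lin) (auto simp: \<epsilon>_def intro!: sum.cong)
    then show ?thesis unfolding eps_sum .
  qed
  \<comment> \<open>The indicator is even and idempotent, so T takes the value 0 or 1 on it, and 0
    is excluded by the choice of x.\<close>
  have ee: "(\<lambda>y\<in>carrier G. \<epsilon> y * \<epsilon> y) = \<epsilon>" by (auto simp: \<epsilon>_def fun_eq_iff)
  have "\<epsilon> x = 1" "\<epsilon> (a \<otimes> x) = 1" using x(1) by (simp_all add: \<epsilon>_def)
  then have "T \<epsilon> = m x + m (a \<otimes> x)" "T \<epsilon> = T \<epsilon> * T \<epsilon>"
    using T_eps_mult[of \<epsilon>] mult[OF eps_in eps_in eps_even] unfolding ee by simp_all
  then have T1: "T \<epsilon> = 1" "m (a \<otimes> x) = 1 - m x" using x(2) by (auto simp: eq_diff_eq add.commute)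
  have "T \<psi> = m x * \<psi> x + (1 - m x) * \<psi> (a \<otimes> x)" if "\<psi> \<in> funs" for \<psi>
    using mult[OF eps_in that eps_even] T_eps_mult[of \<psi>] T1 by (simp add: mult.commute)
  with x(1) show ?thesis by blast
qed

end

text \<open>The traces of a Hopf algebra isomorphism F on plain functions. \<open>s\<close> and
  \<open>t\<close> stand for the actions of the generator on the two sides, and
  \<open>center\<close> says that \<open>a\<close> is the only central involution.
  \<open>F_comult\<close> is compatibility with comultiplication read off at the pair (g, h) in the
  basis of delta functions; linearity of F is recovered from it and the counit.\<close>

locale twist_isomorphism = no_sign_quotient +
  fixes s t :: "'a \<Rightarrow> 'a" and F :: "('a \<Rightarrow> 'k::field_char_0) \<Rightarrow> 'a \<Rightarrow> 'k"
  assumes center: "\<And>z. z \<in> carrier G \<Longrightarrow> (\<And>x. x \<in> carrier G \<Longrightarrow> z \<otimes> x = x \<otimes> z) \<Longrightarrow>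
      z \<otimes> z = \<one> \<Longrightarrow> z \<noteq> \<one> \<Longrightarrow> z = a"
    and s_hom: "s \<in> hom G G" and s_a: "s a = a"
    and t_hom: "t \<in> hom G G" and t_a: "t a = a"
    and F_bij: "bij_betw F funs funs"
    and F_one: "F (\<lambda>x\<in>carrier G. 1) = (\<lambda>x\<in>carrier G. 1)"
    and F_mult: "\<And>\<phi> \<psi>. \<phi> \<in> funs \<Longrightarrow> \<psi> \<in> funs \<Longrightarrow>
      F (twisted_mult s \<phi> \<psi>) = twisted_mult t (F \<phi>) (F \<psi>)"
    and F_counit: "\<And>\<phi>. \<phi> \<in> funs \<Longrightarrow> F \<phi> \<one> = \<phi> \<one>"
    and F_comult: "\<And>\<phi> g h. \<phi> \<in> funs \<Longrightarrow> g \<in> carrier G \<Longrightarrow> h \<in> carrier G \<Longrightarrow>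
      F \<phi> (g \<otimes> h) = (\<Sum>x\<in>carrier G. \<Sum>y\<in>carrier G. \<phi> (x \<otimes> y) * (F (delta G x) g * F (delta G y) h))"
begin

lemma s_closed [simp]: "x \<in> carrier G \<Longrightarrow> s x \<in> carrier G"
  and s_mult: "x \<in> carrier G \<Longrightarrow> y \<in> carrier G \<Longrightarrow> s (x \<otimes> y) = s x \<otimes> s y"
  and t_closed [simp]: "x \<in> carrier G \<Longrightarrow> t x \<in> carrier G"
  and t_mult: "x \<in> carrier G \<Longrightarrow> y \<in> carrier G \<Longrightarrow> t (x \<otimes> y) = t x \<otimes> t y"
  using s_hom t_hom by (auto simp: hom_def)

lemma F_in [simp]: "\<phi> \<in> funs \<Longrightarrow> F \<phi> \<in> funs"
  using F_bij by (auto simp: bij_betw_def)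

lemma F_inj: "\<phi> \<in> funs \<Longrightarrow> \<psi> \<in> funs \<Longrightarrow> F \<phi> = F \<psi> \<Longrightarrow> \<phi> = \<psi>"
  using F_bij by (auto simp: bij_betw_def inj_on_def)

lemma F_surj:
  assumes "\<psi> \<in> funs"
  obtains \<phi> where "\<phi> \<in> funs" "F \<phi> = \<psi>"
proof -
  have "\<psi> \<in> F ` funs" using assms bij_betw_imp_surj_on[OF F_bij] by (simp only:)
  then show ?thesis by (rule imageE) (rule that, simp_all only:)
qed

lemma delta_in [simp]: "delta G x \<in> funs"
  by (simp add: delta_def)

text \<open>Setting h to the unit in \<open>F_comult\<close> removes the second factor, because the
  counit turns \<open>F (delta G y) \<one>\<close> into \<open>delta G \<one> y\<close>.\<close>

lemma F_linear:
  assumes "\<phi> \<in> funs" "g \<in> carrier G"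
  shows "F \<phi> g = (\<Sum>y\<in>carrier G. \<phi> y * F (delta G y) g)"
proof -
  have "F (delta G y) \<one> = delta G \<one> y" if "y \<in> carrier G" for y
    using F_counit[of "delta G y"] that by (auto simp: delta_def)
  then have "F \<phi> (g \<otimes> \<one>) = (\<Sum>x\<in>carrier G. \<Sum>y\<in>carrier G. (\<phi> (x \<otimes> y) * F (delta G x) g) * delta G \<one> y)"
    unfolding F_comult[OF assms one_closed] by (auto intro!: sum.cong)
  then show ?thesis using assms(2) by (simp add: sum_delta_mult)
qed

text \<open>Points act as functionals through evaluation after F, and the product of points becomes
  the convolution of functionals. Here the first leg is evaluated first;
  \<open>F_comult_right\<close> is the mirror image.\<close>

lemma F_comult_left:
  assumes "\<phi> \<in> funs" "g \<in> carrier G" "h \<in> carrier G"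
  shows "F \<phi> (g \<otimes> h) = F (\<lambda>v\<in>carrier G. F (\<lambda>u\<in>carrier G. \<phi> (u \<otimes> v)) g) h"
proof -
  have "F \<phi> (g \<otimes> h) = (\<Sum>y\<in>carrier G. \<Sum>x\<in>carrier G. \<phi> (x \<otimes> y) * (F (delta G x) g * F (delta G y) h))"
    unfolding F_comult[OF assms] by (rule sum.swap)
  also have "\<dots> = (\<Sum>y\<in>carrier G. (\<Sum>x\<in>carrier G. \<phi> (x \<otimes> y) * F (delta G x) g) * F (delta G y) h)"
    by (simp add: sum_distrib_right mult.assoc)
  also have "\<dots> = (\<Sum>y\<in>carrier G. F (\<lambda>u\<in>carrier G. \<phi> (u \<otimes> y)) g * F (delta G y) h)"
    using assms(2) by (intro sum.cong refl) (subst F_linear, simp_all)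
  also have "\<dots> = F (\<lambda>v\<in>carrier G. F (\<lambda>u\<in>carrier G. \<phi> (u \<otimes> v)) g) h"
    using assms(3) by (subst F_linear[of _ h]) simp_all
  finally show ?thesis .
qed

lemma F_comult_right:
  assumes "\<phi> \<in> funs" "g \<in> carrier G" "h \<in> carrier G"
  shows "F \<phi> (g \<otimes> h) = F (\<lambda>u\<in>carrier G. F (\<lambda>v\<in>carrier G. \<phi> (u \<otimes> v)) h) g"
proof -
  have "F \<phi> (g \<otimes> h) = (\<Sum>x\<in>carrier G. (\<Sum>y\<in>carrier G. \<phi> (x \<otimes> y) * F (delta G y) h) * F (delta G x) g)"
    unfolding F_comult[OF assms] by (simp add: sum_distrib_left sum_distrib_right mult_ac)
  also have "\<dots> = (\<Sum>x\<in>carrier G. F (\<lambda>v\<in>carrier G. \<phi> (x \<otimes> v)) h * F (delta G x) g)"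
    using assms(3) by (intro sum.cong refl) (subst F_linear, simp_all)
  also have "\<dots> = F (\<lambda>u\<in>carrier G. F (\<lambda>v\<in>carrier G. \<phi> (u \<otimes> v)) h) g"
    using assms(2) by (subst F_linear[of _ g]) simp_all
  finally show ?thesis .
qed

section \<open>The character of the first twisting obtained from evaluation at
  \<open>a\<close>\<close>

lemma twisted_mult_at_a:
  "twisted_mult t \<phi> \<psi> a = (\<phi> a * \<psi> a :: 'k)"
proof -
  have "p * c + q * c = (p + q) * c" for p q c :: 'k by (simp add: algebra_simps)
  then show ?thesis by (simp add: twisted_mult_def t_a diff_divide_distrib add_divide_distrib)
qed

text \<open>Because \<open>t\<close> fixes \<open>a\<close>, evaluation at \<open>a\<close> is
  multiplicative on the second twisting; composed with F it satisfies the hypotheses of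
  \<open>twisted_character\<close>.\<close>

lemma F_at_a:
  "\<exists>x\<in>carrier G. \<exists>p. \<forall>\<psi>\<in>funs. F \<psi> a = p * \<psi> x + (1 - p) * \<psi> (a \<otimes> x)"
proof (rule twisted_character)
  show "F \<psi> a = (\<Sum>y\<in>carrier G. \<psi> y * F (delta G y) a)" if "\<psi> \<in> funs" for \<psi>
    by (rule F_linear[OF that]) simp
  show "F (\<lambda>x\<in>carrier G. 1) a = 1" by (simp add: F_one)
  show "F (\<lambda>x\<in>carrier G. \<phi> x * \<psi> x) a = F \<phi> a * F \<psi> a"
    if "\<phi> \<in> funs" "\<psi> \<in> funs" "\<And>x. x \<in> carrier G \<Longrightarrow> \<phi> (a \<otimes> x) = \<phi> x" for \<phi> \<psi>
    unfolding twisted_mult_at_a[symmetric] F_mult[OF that(1,2), symmetric]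
    using that(3) by (simp add: twisted_mult_even)
qed

text \<open>Translation by \<open>a\<close> corresponds under F to convolution with the functional
  of weights p and 1 - p at x and \<open>a \<otimes> x\<close>. Both sides are recorded:
  \<open>a\<close> is central, whereas centrality of x is still to be deduced by comparing
  them.\<close>

lemma F_translate:
  assumes x: "x \<in> carrier G" and ev: "\<And>\<psi>. \<psi> \<in> funs \<Longrightarrow> F \<psi> a = p * \<psi> x + (1 - p) * \<psi> (a \<otimes> x)"
    and \<phi>: "\<phi> \<in> funs" and h: "h \<in> carrier G"
  shows "F \<phi> (a \<otimes> h) = F (\<lambda>v\<in>carrier G. p * \<phi> (x \<otimes> v) + (1 - p) * \<phi> (a \<otimes> (x \<otimes> v))) h"
    and "F \<phi> (h \<otimes> a) = F (\<lambda>v\<in>carrier G. p * \<phi> (v \<otimes> x) + (1 - p) * \<phi> (a \<otimes> (v \<otimes> x))) h"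
proof -
  have "(\<lambda>v\<in>carrier G. F (\<lambda>u\<in>carrier G. \<phi> (u \<otimes> v)) a) =
      (\<lambda>v\<in>carrier G. p * \<phi> (x \<otimes> v) + (1 - p) * \<phi> (a \<otimes> (x \<otimes> v)))"
    using x by (intro restrict_ext) (simp add: ev m_assoc)
  then show "F \<phi> (a \<otimes> h) = F (\<lambda>v\<in>carrier G. p * \<phi> (x \<otimes> v) + (1 - p) * \<phi> (a \<otimes> (x \<otimes> v))) h"
    using F_comult_left[OF \<phi> a_closed h] by simp
  have "(\<lambda>u\<in>carrier G. F (\<lambda>v\<in>carrier G. \<phi> (u \<otimes> v)) a) =
      (\<lambda>v\<in>carrier G. p * \<phi> (v \<otimes> x) + (1 - p) * \<phi> (a \<otimes> (v \<otimes> x)))"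
    using x by (intro restrict_ext) (simp add: ev a_lcomm[OF _ x])
  then show "F \<phi> (h \<otimes> a) = F (\<lambda>v\<in>carrier G. p * \<phi> (v \<otimes> x) + (1 - p) * \<phi> (a \<otimes> (v \<otimes> x))) h"
    using F_comult_right[OF \<phi> h a_closed] by simp
qed

text \<open>The convolution square of the transported evaluation at \<open>a\<close> is the counit, as \<open>a\<^sup>2 = 1\<close>.\<close>

lemma F_at_a_cases:
  assumes x: "x \<in> carrier G" and ev: "\<And>\<psi>. \<psi> \<in> funs \<Longrightarrow> F \<psi> a = p * \<psi> x + (1 - p) * \<psi> (a \<otimes> x)"
  shows "x \<otimes> x = \<one> \<and> (p = 0 \<or> p = 1) \<or> x \<otimes> x = a \<and> 2 * p * (1 - p) = 1"
proof -
  let ?\<delta> = "delta G \<one> :: 'a \<Rightarrow> 'k"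
  \<comment> \<open>The convolution square puts weight \<open>p * p + (1 - p) * (1 - p)\<close> at
    \<open>x \<otimes> x\<close> and \<open>2 * p * (1 - p)\<close> at
    \<open>a \<otimes> (x \<otimes> x)\<close>. The delta function at the unit reads off the weight
    at the unit, which has to be 1.\<close>
  have "?\<delta> \<one> = F ?\<delta> (a \<otimes> a)" by (simp add: a_square F_counit)
  also have "\<dots> = p * (p * ?\<delta> (x \<otimes> x) + (1 - p) * ?\<delta> (a \<otimes> (x \<otimes> x))) +
      (1 - p) * (p * ?\<delta> (a \<otimes> (x \<otimes> x)) + (1 - p) * ?\<delta> (x \<otimes> x))"
    using x F_translate(1)[OF x ev, of ?\<delta> a] by (simp add: ev a_lcomm[OF x])
  finally have eq: "1 = (p * p + (1 - p) * (1 - p)) * ?\<delta> (x \<otimes> x) + 2 * p * (1 - p) * ?\<delta> (a \<otimes> (x \<otimes> x))"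
    by (simp add: delta_def algebra_simps)
  consider "x \<otimes> x = \<one>" | "x \<otimes> x = a" | "x \<otimes> x \<noteq> \<one>" "a \<otimes> (x \<otimes> x) \<noteq> \<one>"
    using x by (metis a_a_mult a_closed m_closed r_one)
  then show ?thesis
  proof cases
    case 1
    with eq have "p * p + (1 - p) * (1 - p) = 1" by (simp add: delta_def a_neq_one)
    then have "2 * (p * (p - 1)) = 0" by (simp add: algebra_simps)
    then show ?thesis using 1 by simp
  next
    case 2
    with eq show ?thesis by (simp add: delta_def a_neq_one a_square)
  next
    case 3
    with eq x show ?thesis by (simp add: delta_def)
  qed
qed

text \<open>Left and right translation by the central element \<open>a\<close> agree, and F is
  injective, so the corresponding convolutions agree too.\<close>

lemma F_at_a_central:
  assumes x: "x \<in> carrier G" and ev: "\<And>\<psi>. \<psi> \<in> funs \<Longrightarrow> F \<psi> a = p * \<psi> x + (1 - p) * \<psi> (a \<otimes> x)"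
    and z: "z \<in> carrier G"
  shows "x \<otimes> z = z \<otimes> x"
proof (rule ccontr)
  assume neq: "x \<otimes> z \<noteq> z \<otimes> x"
  \<comment> \<open>An odd test function on the coset of \<open>x \<otimes> z\<close>. At z the left
    convolution gives \<open>2 * p - 1\<close>; the right one gives \<open>1 - 2 * p\<close> if
    \<open>z \<otimes> x\<close> is the other point of that coset and 0 if it lies outside. Either
    way p would be 1/2, which \<open>F_at_a_cases\<close> rules out.\<close>
  let ?\<eta> = "\<lambda>y\<in>carrier G. if y = x \<otimes> z then 1 else if y = a \<otimes> (x \<otimes> z) then -1 else 0 :: 'k"
  let ?L = "\<lambda>v\<in>carrier G. p * ?\<eta> (x \<otimes> v) + (1 - p) * ?\<eta> (a \<otimes> (x \<otimes> v))"
  let ?R = "\<lambda>v\<in>carrier G. p * ?\<eta> (v \<otimes> x) + (1 - p) * ?\<eta> (a \<otimes> (v \<otimes> x))"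
  have eta_in: "?\<eta> \<in> funs" by simp
  have "F ?L h = F ?R h" if "h \<in> carrier G" for h
    using F_translate[OF x ev eta_in that] unfolding a_comm[OF that] by (rule trans[OF sym])
  moreover have "F ?L \<in> funs" "F ?R \<in> funs" by simp_all
  ultimately have "F ?L = F ?R" by (intro PiE_ext)
  then have "?L = ?R" by (rule F_inj[rotated 2]) simp_all
  then have LR: "?L z = ?R z" by (rule fun_cong)
  have L: "?L z = 2 * p - 1"
    using x z a_mult_neq[of "x \<otimes> z"] by (simp add: algebra_simps)
  have "a \<otimes> (z \<otimes> x) = x \<otimes> z \<longleftrightarrow> z \<otimes> x = a \<otimes> (x \<otimes> z)"
    using x z by (metis a_a_mult m_closed)
  then have "?R z = 0 \<or> ?R z = 1 - 2 * p"
    using x z a_mult_neq[of "x \<otimes> z"] neq by auto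
  then have "2 * p - 1 = 0 \<or> 2 * p - 1 = 1 - 2 * p" unfolding LR[symmetric] L .
  then have "2 * (2 * p - 1) = 0" by (elim disjE) (simp_all add: algebra_simps)
  then have "2 * p = 1" by simp
  moreover have "p = 0 \<or> p = 1 \<or> 2 * p * (1 - p) = 1"
    using F_at_a_cases[OF x ev] by blast
  ultimately show False by auto
qed

text \<open>Here \<open>1 - 2 * p\<close> is a square root of -1. Functions that F sends to even
  functions commute, and testing this on functions supported on a coset of the cyclic group
  generated by x shows that \<open>y \<mapsto> inv y \<otimes> s y\<close> takes values in that
  central group. Following it by a faithful character gives a character of G that is trivial at
  \<open>a\<close> and takes the value -1 at x, against Hom(H, Z_2) = 1.\<close>

lemma F_at_a_not_order_four:
  assumes x: "x \<in> carrier G" and ev: "\<And>\<psi>. \<psi> \<in> funs \<Longrightarrow> F \<psi> a = p * \<psi> x + (1 - p) * \<psi> (a \<otimes> x)"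
    and xx: "x \<otimes> x = a"
  shows False
proof -
  have p: "2 * p * (1 - p) = 1" using F_at_a_cases[OF x ev] a_neq_one unfolding xx by blast
  define \<omega> where "\<omega> = 1 - 2 * p"
  have "\<omega> * \<omega> = 1 - 2 * (2 * p * (1 - p))" by (simp add: \<omega>_def algebra_simps)
  then have \<omega>: "\<omega> * \<omega> = -1" by (simp add: p)
  note xc = F_at_a_central[OF x ev]
  have ax: "a \<otimes> x \<in> carrier G" "x \<otimes> a = a \<otimes> x" using x by (simp_all add: a_comm)
  have xxz: "x \<otimes> (x \<otimes> z) = a \<otimes> z" if "z \<in> carrier G" for z
    using x that by (simp add: xx flip: m_assoc)
  \<comment> \<open>The character obtained from \<open>a\<close> takes the odd test function to
    \<open>- \<omega>\<close>, whose square is -1, and takes its twisted square to its value at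
    \<open>s x\<close>. So \<open>s x\<close> is the other point of the coset of x.\<close>
  have sx: "s x = a \<otimes> x"
  proof -
    let ?\<eta> = "\<lambda>y\<in>carrier G. if y = x then 1 else if y = a \<otimes> x then -1 else 0 :: 'k"
    have odd: "?\<eta> (a \<otimes> y) = - ?\<eta> y" if "y \<in> carrier G" for y
      using that x a_mult_neq[of x] by auto
    have eta_in: "?\<eta> \<in> funs" by simp
    have "?\<eta> (s x) = p * (?\<eta> x * ?\<eta> (s x)) + (1 - p) * (?\<eta> (a \<otimes> x) * ?\<eta> (a \<otimes> s x))"
      using x a_mult_neq[of x] odd[of "s x"] by (simp add: algebra_simps)
    also have "\<dots> = F (\<lambda>y\<in>carrier G. ?\<eta> y * ?\<eta> (s y)) a"
      using x by (subst ev) (simp_all add: s_mult s_a)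
    also have "\<dots> = F (twisted_mult s ?\<eta> ?\<eta>) a"
      by (simp only: twisted_mult_odd[of ?\<eta>, OF odd])
    also have "\<dots> = F ?\<eta> a * F ?\<eta> a"
      unfolding F_mult[OF eta_in eta_in] twisted_mult_at_a ..
    also have "F ?\<eta> a = p - (1 - p)"
      using x a_mult_neq[of x] by (subst ev) simp_all
    also have "(p - (1 - p)) * (p - (1 - p)) = \<omega> * \<omega>" by (simp add: \<omega>_def algebra_simps)
    finally have "?\<eta> (s x) = -1" unfolding \<omega> .
    then show ?thesis using x by (simp split: if_splits)
  qed
  \<comment> \<open>\<open>\<Phi>\<close> extends the character \<open>x \<mapsto> \<omega>\<close> of \<open>\<langle>x\<rangle>\<close> by zero; \<open>F\<close> maps its left translates and their
    fourth powers to even functions, which commute.\<close>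
  define \<Phi> where "\<Phi> z = (if z = \<one> then 1 else if z = x then \<omega> else if z = a then -1
    else if z = a \<otimes> x then -\<omega> else 0)" for z
  have "x \<noteq> \<one>" "x \<noteq> a" using xx a_neq_one a_square by force+
  then have dist: "x \<noteq> \<one>" "x \<noteq> a" "a \<otimes> x \<noteq> \<one>" "a \<otimes> x \<noteq> a" "a \<otimes> x \<noteq> x"
    using a_a_mult[OF x] a_mult_neq[OF x] by (auto simp: a_square)
  have \<Phi>x: "\<Phi> (x \<otimes> z) = \<omega> * \<Phi> z" if z: "z \<in> carrier G" for z
  proof -
    have "x \<otimes> z = x \<otimes> w \<longleftrightarrow> z = w" if "w \<in> carrier G" for w
      using x z that by simp
    from this[of \<one>] this[of x] this[of a] this[of "a \<otimes> x"]
    have "x \<otimes> z = x \<longleftrightarrow> z = \<one>" "x \<otimes> z = a \<longleftrightarrow> z = x" "x \<otimes> z = a \<otimes> x \<longleftrightarrow> z = a" "x \<otimes> z = \<one> \<longleftrightarrow> z = a \<otimes> x"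
      using x by (simp_all add: xx ax(2) a_lcomm[OF x] a_square)
    then show ?thesis using dist dist[symmetric] a_neq_one \<omega> by (simp add: \<Phi>_def)
  qed
  have \<Phi>a: "\<Phi> (a \<otimes> z) = - \<Phi> z" if z: "z \<in> carrier G" for z
    using \<Phi>x[of "x \<otimes> z"] \<Phi>x[OF z] x z \<omega> by (simp add: xxz flip: mult.assoc)
  have \<Phi>_supp: "u = \<one> \<or> u = x \<or> u = a \<or> u = a \<otimes> x" if "\<Phi> u \<noteq> 0" for u
    using that by (simp add: \<Phi>_def split: if_splits)
  have \<Phi>_val: "\<Phi> \<one> = 1" "\<Phi> x = \<omega>" "\<Phi> a = -1" "\<Phi> (a \<otimes> x) = -\<omega>"
    using dist dist[symmetric] a_neq_one by (simp_all add: \<Phi>_def)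
  have \<Phi>_mult: "\<Phi> (u \<otimes> z) = \<Phi> u * \<Phi> z" if "\<Phi> u \<noteq> 0" "z \<in> carrier G" for u z
    using \<Phi>_supp[OF that(1)] x that(2) by (elim disjE) (simp_all add: \<Phi>_val \<Phi>x \<Phi>a m_assoc)
  have \<Phi>_comm: "u \<otimes> z = z \<otimes> u" if "\<Phi> u \<noteq> 0" "z \<in> carrier G" for u z
    using \<Phi>_supp[OF that(1)] x that(2) by (elim disjE) (simp_all add: xc a_comm[of z] a_lcomm[of z] m_assoc)
  have \<Phi>4: "(\<Phi> u * \<Phi> u) * (\<Phi> u * \<Phi> u) = 1" if "\<Phi> u \<noteq> 0" for u
    using \<Phi>_supp[OF that] \<omega> by (elim disjE) (simp_all add: \<Phi>_val)
  \<comment> \<open>The last condition is invariance under the convolution of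
    \<open>F_translate\<close>, so F turns it into invariance under translation by
    \<open>a\<close>.\<close>
  have even: "F \<phi> (a \<otimes> h) = F \<phi> h"
    if "\<phi> \<in> funs" "h \<in> carrier G" "\<And>v. v \<in> carrier G \<Longrightarrow> p * \<phi> (x \<otimes> v) + (1 - p) * \<phi> (a \<otimes> (x \<otimes> v)) = \<phi> v" for \<phi> h
  proof -
    have "(\<lambda>v\<in>carrier G. p * \<phi> (x \<otimes> v) + (1 - p) * \<phi> (a \<otimes> (x \<otimes> v))) = \<phi>"
      using that(1,3) by (intro PiE_ext[of _ "carrier G" "\<lambda>_. UNIV"]) auto
    then show ?thesis using F_translate(1)[OF x ev that(1,2)] by simp
  qed
  \<comment> \<open>Even functions of the second twisting multiply pointwise and hence commute;
    injectivity of F brings this back.\<close>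
  have comm: "twisted_mult s \<phi> \<psi> = twisted_mult s \<psi> \<phi>"
    if "\<phi> \<in> funs" "\<psi> \<in> funs"
      "\<And>v. v \<in> carrier G \<Longrightarrow> p * \<phi> (x \<otimes> v) + (1 - p) * \<phi> (a \<otimes> (x \<otimes> v)) = \<phi> v"
      "\<And>v. v \<in> carrier G \<Longrightarrow> p * \<psi> (x \<otimes> v) + (1 - p) * \<psi> (a \<otimes> (x \<otimes> v)) = \<psi> v" for \<phi> \<psi>
  proof (rule F_inj)
    have "F \<phi> (a \<otimes> h) = F \<phi> h" "F \<psi> (a \<otimes> h) = F \<psi> h" if "h \<in> carrier G" for h
      using even that \<open>\<phi> \<in> funs\<close> \<open>\<psi> \<in> funs\<close> \<open>\<And>v. v \<in> carrier G \<Longrightarrow> _ = \<phi> v\<close> \<open>\<And>v. v \<in> carrier G \<Longrightarrow> _ = \<psi> v\<close> by blast+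
    then show "F (twisted_mult s \<phi> \<psi>) = F (twisted_mult s \<psi> \<phi>)"
      by (simp add: F_mult that(1,2) twisted_mult_even mult.commute)
  qed simp_all
  define \<kappa> where "\<kappa> y = \<Phi> (inv y \<otimes> s y)" for y
  have \<kappa>0: "\<kappa> y \<noteq> 0" if y: "y \<in> carrier G" for y
  proof -
    \<comment> \<open>\<open>\<phi>\<close> is odd and \<open>\<psi>\<close>, built from fourth
      powers, is even, so their commutation compares \<open>\<psi>\<close> at \<open>s y\<close>
      with \<open>\<psi>\<close> at y. The latter is 1, hence \<open>inv y \<otimes> s y\<close>
      lies in the support of \<open>\<Phi>\<close>.\<close>
    define \<phi> \<psi> where "\<phi> = (\<lambda>z\<in>carrier G. \<Phi> (inv y \<otimes> z))"
      and "\<psi> = (\<lambda>z\<in>carrier G. (\<Phi> (inv y \<otimes> z) * \<Phi> (inv y \<otimes> z)) * (\<Phi> (inv y \<otimes> z) * \<Phi> (inv y \<otimes> z)))"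
    have lc: "inv y \<otimes> (x \<otimes> z) = x \<otimes> (inv y \<otimes> z)" if "z \<in> carrier G" for z
      using x y that xc[of "inv y"] by (simp flip: m_assoc)
    have lca: "inv y \<otimes> (a \<otimes> z) = a \<otimes> (inv y \<otimes> z)" if "z \<in> carrier G" for z
      using y that by (simp add: a_lcomm[of "inv y"])
    have \<omega>c: "p * (\<omega> * c) - (1 - p) * (\<omega> * c) = c" for c
    proof -
      have "p * (\<omega> * c) - (1 - p) * (\<omega> * c) = - (\<omega> * \<omega>) * c" by (simp add: \<omega>_def algebra_simps)
      then show ?thesis by (simp add: \<omega>)
    qed
    have \<omega>4: "\<omega> * c * (\<omega> * c) * (\<omega> * c * (\<omega> * c)) = c * c * (c * c)" for c
    proof -
      have "\<omega> * c * (\<omega> * c) * (\<omega> * c * (\<omega> * c)) = (\<omega> * \<omega>) * (\<omega> * \<omega>) * (c * c * (c * c))" by (simp add: mult_ac)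
      then show ?thesis by (simp add: \<omega>)
    qed
    have pq: "p * c + (1 - p) * c = c" for c by (simp add: algebra_simps)
    have "twisted_mult s \<phi> \<psi> = twisted_mult s \<psi> \<phi>"
    proof (rule comm)
      fix v assume v: "v \<in> carrier G"
      show "p * \<phi> (x \<otimes> v) + (1 - p) * \<phi> (a \<otimes> (x \<otimes> v)) = \<phi> v"
        using v x y \<omega>c by (simp add: \<phi>_def lc lca \<Phi>x \<Phi>a)
      show "p * \<psi> (x \<otimes> v) + (1 - p) * \<psi> (a \<otimes> (x \<otimes> v)) = \<psi> v"
        using v x y pq by (simp add: \<psi>_def lc lca \<Phi>x \<Phi>a \<omega>4)
    qed (simp_all add: \<phi>_def \<psi>_def)
    moreover have "\<phi> (a \<otimes> z) = - \<phi> z" "\<psi> (a \<otimes> z) = \<psi> z" if "z \<in> carrier G" for z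
      using y that by (simp_all add: \<phi>_def \<psi>_def lca \<Phi>a)
    ultimately have "(\<lambda>z\<in>carrier G. \<phi> z * \<psi> (s z)) = (\<lambda>z\<in>carrier G. \<psi> z * \<phi> z)"
      by (simp add: twisted_mult_odd twisted_mult_even)
    from fun_cong[OF this, of y] have "\<phi> y * \<psi> (s y) = \<psi> y * \<phi> y" using y by simp
    then show ?thesis using y by (auto simp: \<phi>_def \<psi>_def \<kappa>_def \<Phi>_val)
  qed
  \<comment> \<open>Values in the center make \<open>y \<mapsto> inv y \<otimes> s y\<close> a
    homomorphism, and \<open>\<Phi>\<close> is multiplicative on its support.\<close>
  have \<kappa>_mult: "\<kappa> (y \<otimes> z) = \<kappa> y * \<kappa> z" if y: "y \<in> carrier G" and z: "z \<in> carrier G" for y z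
  proof -
    have "inv (y \<otimes> z) \<otimes> s (y \<otimes> z) = inv z \<otimes> ((inv y \<otimes> s y) \<otimes> s z)"
      using y z by (simp add: inv_mult_group s_mult m_assoc)
    also have "(inv y \<otimes> s y) \<otimes> s z = s z \<otimes> (inv y \<otimes> s y)"
      using \<kappa>0[OF y] y z unfolding \<kappa>_def by (intro \<Phi>_comm) simp_all
    also have "inv z \<otimes> (s z \<otimes> (inv y \<otimes> s y)) = (inv y \<otimes> s y) \<otimes> (inv z \<otimes> s z)"
      using \<kappa>0[OF y] y z unfolding \<kappa>_def
      by (subst \<Phi>_comm[of "inv y \<otimes> s y"]) (simp_all add: m_assoc)
    finally show ?thesis using \<kappa>0[OF y] y z by (simp add: \<kappa>_def \<Phi>_mult)
  qed
  have "\<kappa> a = 1" by (simp add: \<kappa>_def s_a \<Phi>_val)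
  \<comment> \<open>The fourth powers of \<open>\<kappa>\<close> are 1, so
    \<open>sign_trivial\<close> applies first to its square and then to \<open>\<kappa>\<close>
    itself.\<close>
  have "\<kappa> y * \<kappa> y = 1" if "y \<in> carrier G" for y
  proof (rule sign_trivial[OF _ _ _ that])
    show "\<kappa> y * \<kappa> y * (\<kappa> y * \<kappa> y) = 1" if "y \<in> carrier G" for y
      using \<kappa>0[OF that] unfolding \<kappa>_def by (rule \<Phi>4)
  qed (simp_all add: \<kappa>_mult \<open>\<kappa> a = 1\<close> mult_ac)
  from \<kappa>_mult this \<open>\<kappa> a = 1\<close> x have "\<kappa> x = 1" by (rule sign_trivial)
  moreover have "inv x \<otimes> s x = a"
    unfolding sx ax(2)[symmetric] using x by (simp flip: m_assoc)
  ultimately show False by (simp add: \<kappa>_def \<Phi>_val)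
qed

text \<open>With order four excluded, the transported character is evaluation at a single central
  point z whose square is the unit. As F is onto, evaluation at \<open>a\<close> and at
  \<open>\<one>\<close> remain different after F, so z is not the unit and \<open>center\<close>
  identifies it.\<close>

lemma F_at_a_eq:
  assumes "\<phi> \<in> funs"
  shows "F \<phi> a = \<phi> a"
proof -
  obtain x p where x: "x \<in> carrier G" and all: "\<forall>\<psi>\<in>funs. F \<psi> a = p * \<psi> x + (1 - p) * \<psi> (a \<otimes> x)"
    using F_at_a by (elim bexE exE)
  note ev = bspec[OF all]
  have xx: "x \<otimes> x = \<one>" and p: "p = 0 \<or> p = 1"
    using F_at_a_cases[OF x ev] F_at_a_not_order_four[OF x ev] by blast+
  define z where "z = (if p = 1 then x else a \<otimes> x)"
  have z: "z \<in> carrier G" using x by (simp add: z_def)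
  have at_z: "F \<psi> a = \<psi> z" if "\<psi> \<in> funs" for \<psi>
    using x p ev[OF that] by (auto simp: z_def)
  have "F (delta G \<one>) a = 0"
  proof (rule ccontr)
    assume "F (delta G \<one>) a \<noteq> 0"
    then have "z = \<one>" using at_z[of "delta G \<one>"] z by (simp add: delta_def split: if_splits)
    then have "F \<psi> a = F \<psi> \<one>" if "\<psi> \<in> funs" for \<psi>
      using at_z[OF that] F_counit[OF that] by simp
    moreover obtain \<psi> where "\<psi> \<in> funs" "F \<psi> = delta G a" by (rule F_surj[OF delta_in])
    ultimately have "delta G a a = (delta G a \<one> :: 'k)" by metis
    then show False using a_neq_one by (simp add: delta_def)
  qed
  then have "z \<noteq> \<one>" using at_z[of "delta G \<one>"] by (auto simp: delta_def)
  moreover note z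
  moreover have "z \<otimes> y = y \<otimes> z" if y: "y \<in> carrier G" for y
    using F_at_a_central[OF x ev y] x y by (simp add: z_def a_lcomm[OF y] m_assoc)
  moreover have "z \<otimes> z = \<one>"
    using x xx by (simp add: z_def a_lcomm[OF x] m_assoc a_square)
  ultimately have "z = a" by (intro center)
  then show ?thesis using at_z[OF assms] by simp
qed

section \<open>Parity of functions under F\<close>

lemma F_shift:
  assumes "\<phi> \<in> funs" "h \<in> carrier G"
  shows "F \<phi> (a \<otimes> h) = F (\<lambda>v\<in>carrier G. \<phi> (a \<otimes> v)) h"
proof -
  have ev: "F \<psi> a = 1 * \<psi> a + (1 - 1) * \<psi> (a \<otimes> a)" if "\<psi> \<in> funs" for \<psi>
    using F_at_a_eq[OF that] by simp
  show ?thesis using F_translate(1)[OF a_closed ev assms] by simp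
qed

lemma F_even_iff:
  assumes "\<phi> \<in> funs"
  shows "(\<forall>h\<in>carrier G. F \<phi> (a \<otimes> h) = F \<phi> h) \<longleftrightarrow> (\<forall>x\<in>carrier G. \<phi> (a \<otimes> x) = \<phi> x)"
proof
  assume even: "\<forall>h\<in>carrier G. F \<phi> (a \<otimes> h) = F \<phi> h"
  have "F (\<lambda>v\<in>carrier G. \<phi> (a \<otimes> v)) \<in> funs" "F \<phi> \<in> funs" using assms by simp_all
  moreover have "F (\<lambda>v\<in>carrier G. \<phi> (a \<otimes> v)) h = F \<phi> h" if "h \<in> carrier G" for h
    using F_shift[OF assms that] even that by simp
  ultimately have "F (\<lambda>v\<in>carrier G. \<phi> (a \<otimes> v)) = F \<phi>" by (rule PiE_ext)
  then have eq: "(\<lambda>v\<in>carrier G. \<phi> (a \<otimes> v)) = \<phi>"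
    by (rule F_inj[rotated 2]) (simp_all add: assms)
  show "\<forall>x\<in>carrier G. \<phi> (a \<otimes> x) = \<phi> x"
  proof
    show "\<phi> (a \<otimes> x) = \<phi> x" if "x \<in> carrier G" for x using fun_cong[OF eq, of x] that by simp
  qed
next
  assume even: "\<forall>x\<in>carrier G. \<phi> (a \<otimes> x) = \<phi> x"
  have "(\<lambda>v\<in>carrier G. \<phi> (a \<otimes> v)) = \<phi>"
    by (rule PiE_ext[of _ "carrier G" "\<lambda>_. UNIV"]) (use even assms in auto)
  then show "\<forall>h\<in>carrier G. F \<phi> (a \<otimes> h) = F \<phi> h" using F_shift[OF assms] by simp
qed

lemma F_odd:
  assumes \<phi>: "\<phi> \<in> funs" and odd: "\<And>h. h \<in> carrier G \<Longrightarrow> F \<phi> (a \<otimes> h) = - F \<phi> h" and x: "x \<in> carrier G"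
  shows "\<phi> (a \<otimes> x) = - \<phi> x"
proof -
  have "F (\<lambda>v\<in>carrier G. \<phi> (a \<otimes> v)) h = F (\<lambda>v\<in>carrier G. - \<phi> v) h" if h: "h \<in> carrier G" for h
  proof -
    have "F (\<lambda>v\<in>carrier G. - \<phi> v) h = - F \<phi> h"
      unfolding F_linear[OF \<phi> h] by (subst F_linear[OF _ h]) (simp_all add: sum_negf)
    then show ?thesis using F_shift[OF \<phi> h] odd[OF h] by simp
  qed
  then have "F (\<lambda>v\<in>carrier G. \<phi> (a \<otimes> v)) = F (\<lambda>v\<in>carrier G. - \<phi> v)"
    by (intro PiE_ext[of _ "carrier G" "\<lambda>_. UNIV"]) simp_all
  then have "(\<lambda>v\<in>carrier G. \<phi> (a \<otimes> v)) = (\<lambda>v\<in>carrier G. - \<phi> v)"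
    by (rule F_inj[rotated 2]) simp_all
  from fun_cong[OF this, of x] show ?thesis using x by simp
qed

section \<open>The automorphism of H induced by F\<close>

abbreviation coset_indicator :: "'a \<Rightarrow> 'a \<Rightarrow> 'k" where
  "coset_indicator x \<equiv> \<lambda>y\<in>carrier G. if y = x \<or> y = a \<otimes> x then 1 else 0"

lemma coset_indicator_even:
  "x \<in> carrier G \<Longrightarrow> y \<in> carrier G \<Longrightarrow> coset_indicator x (a \<otimes> y) = coset_indicator x y"
  by auto

text \<open>F preserves evenness, so for an even left factor evaluation at any point g is
  multiplicative and \<open>twisted_character\<close> applies. On even functions the two weights
  merge, and evaluation at g after F is evaluation at a point \<open>P g\<close>, determined up to
  \<open>a\<close>.\<close>

lemma ex_point_map:
  "\<exists>P. \<forall>g\<in>carrier G. P g \<in> carrier G \<and>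
    (\<forall>\<phi>\<in>funs. (\<forall>x\<in>carrier G. \<phi> (a \<otimes> x) = \<phi> x) \<longrightarrow> F \<phi> g = \<phi> (P g))"
proof (rule bchoice, rule ballI)
  fix g assume g: "g \<in> carrier G"
  have "\<exists>x\<in>carrier G. \<exists>p. \<forall>\<psi>\<in>funs. F \<psi> g = p * \<psi> x + (1 - p) * \<psi> (a \<otimes> x)"
  proof (rule twisted_character)
    show "F \<psi> g = (\<Sum>y\<in>carrier G. \<psi> y * F (delta G y) g)" if "\<psi> \<in> funs" for \<psi>
      by (rule F_linear[OF that g])
    show "F (\<lambda>x\<in>carrier G. 1) g = 1" using g by (simp add: F_one)
    show "F (\<lambda>x\<in>carrier G. \<phi> x * \<psi> x) g = F \<phi> g * F \<psi> g"
      if "\<phi> \<in> funs" "\<psi> \<in> funs" and even: "\<And>x. x \<in> carrier G \<Longrightarrow> \<phi> (a \<otimes> x) = \<phi> x" for \<phi> \<psi>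
    proof -
      have F_even: "F \<phi> (a \<otimes> h) = F \<phi> h" if "h \<in> carrier G" for h
        using F_even_iff[OF \<open>\<phi> \<in> funs\<close>] even that by blast
      show ?thesis
        using fun_cong[OF F_mult[OF that(1,2)], of g] g
        by (simp add: twisted_mult_even even F_even)
    qed
  qed
  then obtain x p where x: "x \<in> carrier G" and ev: "\<forall>\<psi>\<in>funs. F \<psi> g = p * \<psi> x + (1 - p) * \<psi> (a \<otimes> x)"
    by (elim bexE exE)
  have "F \<phi> g = \<phi> x" if "\<phi> \<in> funs" "\<forall>x\<in>carrier G. \<phi> (a \<otimes> x) = \<phi> x" for \<phi>
    using bspec[OF ev that(1)] bspec[OF that(2) x] by (simp add: algebra_simps)
  with x show "\<exists>x. x \<in> carrier G \<and>
      (\<forall>\<phi>\<in>funs. (\<forall>x\<in>carrier G. \<phi> (a \<otimes> x) = \<phi> x) \<longrightarrow> F \<phi> g = \<phi> x)"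
    by (intro exI[of _ x] conjI ballI impI)
qed

text \<open>\<open>P\<close> induces the map of H dual to F on even functions. It is a homomorphism
  by \<open>F_comult\<close>, injective because even functions have even preimages, and compatible
  with the actions because an odd factor moves past an even one at the cost of the action.\<close>

lemma ex_quotient_automorphism:
  "\<exists>f\<in>iso quot quot. \<forall>C\<in>carrier quot. s ` f C = f (t ` C)"
proof -
  obtain P where P: "\<And>g. g \<in> carrier G \<Longrightarrow> P g \<in> carrier G"
    and FP: "\<And>g \<phi>. g \<in> carrier G \<Longrightarrow> \<phi> \<in> funs \<Longrightarrow> (\<And>x. x \<in> carrier G \<Longrightarrow> \<phi> (a \<otimes> x) = \<phi> x) \<Longrightarrow> F \<phi> g = \<phi> (P g)"
  proof -
    from ex_point_map obtain P where P: "\<forall>g\<in>carrier G. P g \<in> carrier G \<and>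
      (\<forall>\<phi>\<in>funs. (\<forall>x\<in>carrier G. \<phi> (a \<otimes> x) = \<phi> x) \<longrightarrow> F \<phi> g = \<phi> (P g))" by (rule exE)
    show ?thesis
    proof (rule that)
      fix g \<phi> assume g: "g \<in> carrier G"
      show "P g \<in> carrier G" by (rule conjunct1[OF bspec[OF P g]])
      show "F \<phi> g = \<phi> (P g)" if "\<phi> \<in> funs" "\<And>x. x \<in> carrier G \<Longrightarrow> \<phi> (a \<otimes> x) = \<phi> x"
        by (rule mp[OF bspec[OF conjunct2[OF bspec[OF P g]] that(1)]]) (rule ballI, rule that(2))
    qed
  qed
  \<comment> \<open>Even functions separate the cosets; the next claims about \<open>\<pi>\<close>
    are checked against them.\<close>
  have sep: "{x, a \<otimes> x} = {y, a \<otimes> y}"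
    if "x \<in> carrier G" "y \<in> carrier G"
      "\<And>\<phi>. \<phi> \<in> funs \<Longrightarrow> (\<And>x. x \<in> carrier G \<Longrightarrow> \<phi> (a \<otimes> x) = \<phi> x) \<Longrightarrow> \<phi> x = (\<phi> y :: 'k)" for x y
  proof -
    have "coset_indicator x x = coset_indicator x y"
      by (rule that(3)[of "coset_indicator x"]) (simp, rule coset_indicator_even[OF that(1)])
    then have "y = x \<or> y = a \<otimes> x" using that(1,2) by (simp split: if_splits)
    then show ?thesis using that(1,2) by auto
  qed
  define \<pi> where "\<pi> g = {P g, a \<otimes> P g}" for g
  have \<pi>_mult: "\<pi> (g \<otimes> h) = \<pi> g \<otimes>\<^bsub>quot\<^esub> \<pi> h" if g: "g \<in> carrier G" and h: "h \<in> carrier G" for g h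
  proof -
    have "{P (g \<otimes> h), a \<otimes> P (g \<otimes> h)} = {P g \<otimes> P h, a \<otimes> (P g \<otimes> P h)}"
    proof (rule sep)
      fix \<phi> assume \<phi>: "\<phi> \<in> funs" and even: "\<And>x. x \<in> carrier G \<Longrightarrow> \<phi> (a \<otimes> x) = (\<phi> x :: 'k)"
      have "\<phi> (P (g \<otimes> h)) = F \<phi> (g \<otimes> h)" using FP[OF _ \<phi> even] g h by simp
      also have "\<dots> = F (\<lambda>u\<in>carrier G. F (\<lambda>v\<in>carrier G. \<phi> (u \<otimes> v)) h) g"
        by (rule F_comult_right[OF \<phi> g h])
      also have "(\<lambda>u\<in>carrier G. F (\<lambda>v\<in>carrier G. \<phi> (u \<otimes> v)) h) = (\<lambda>u\<in>carrier G. \<phi> (u \<otimes> P h))"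
      proof (rule restrict_ext)
        fix u assume u: "u \<in> carrier G"
        have "F (\<lambda>v\<in>carrier G. \<phi> (u \<otimes> v)) h = (\<lambda>v\<in>carrier G. \<phi> (u \<otimes> v)) (P h)"
          by (rule FP[OF h]) (use u even in \<open>simp_all add: a_lcomm[OF u]\<close>)
        then show "F (\<lambda>v\<in>carrier G. \<phi> (u \<otimes> v)) h = \<phi> (u \<otimes> P h)" using P[OF h] by simp
      qed
      also have "F (\<lambda>u\<in>carrier G. \<phi> (u \<otimes> P h)) g = (\<lambda>u\<in>carrier G. \<phi> (u \<otimes> P h)) (P g)"
        by (rule FP[OF g]) (use P[OF h] even in \<open>simp_all add: m_assoc\<close>)
      finally show "\<phi> (P (g \<otimes> h)) = \<phi> (P g \<otimes> P h)" using P[OF g] by simp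
    qed (use P g h in simp_all)
    then show ?thesis using P g h by (simp add: \<pi>_def quot_mult)
  qed
  have \<pi>_inj: "{g, a \<otimes> g} = {h, a \<otimes> h}" if g: "g \<in> carrier G" and h: "h \<in> carrier G" and eq: "\<pi> g = \<pi> h" for g h
  proof (rule sep[OF g h])
    fix \<psi> assume \<psi>: "\<psi> \<in> funs" and even: "\<And>x. x \<in> carrier G \<Longrightarrow> \<psi> (a \<otimes> x) = (\<psi> x :: 'k)"
    obtain \<phi> where \<phi>: "\<phi> \<in> funs" "F \<phi> = \<psi>" by (rule F_surj[OF \<psi>])
    have e: "\<phi> (a \<otimes> x) = \<phi> x" if "x \<in> carrier G" for x
      using F_even_iff[OF \<phi>(1)] even that unfolding \<phi>(2) by blast
    have "P g = P h \<or> P g = a \<otimes> P h" using eq by (auto simp: \<pi>_def)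
    then have "\<phi> (P g) = \<phi> (P h)" using e P[OF h] by auto
    then show "\<psi> g = \<psi> h" using FP[OF g \<phi>(1) e] FP[OF h \<phi>(1) e] by (simp add: \<phi>(2))
  qed
  have \<pi>_a: "\<pi> (a \<otimes> g) = \<pi> g" if g: "g \<in> carrier G" for g
    unfolding \<pi>_def
  proof (rule sep)
    fix \<phi> assume \<phi>: "\<phi> \<in> funs" and even: "\<And>x. x \<in> carrier G \<Longrightarrow> \<phi> (a \<otimes> x) = (\<phi> x :: 'k)"
    show "\<phi> (P (a \<otimes> g)) = \<phi> (P g)"
      using FP[OF _ \<phi> even] F_even_iff[OF \<phi>] even g by (metis a_closed m_closed)
  qed (use P g in simp_all)
  \<comment> \<open>In the first twisting the product of \<open>\<psi>\<close> and
    \<open>\<phi>\<close> equals that of \<open>?\<phi>'\<close> and \<open>\<psi>\<close>, where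
    \<open>\<psi>\<close> is the odd preimage of \<open>?\<eta>\<close>. Applying F and evaluating
    at g, where \<open>?\<eta>\<close> is 1, gives
    \<open>F \<phi> (t g) = F ?\<phi>' g\<close>.\<close>
  have \<pi>_t: "\<pi> (t g) = {s (P g), a \<otimes> s (P g)}" if g: "g \<in> carrier G" for g
    unfolding \<pi>_def
  proof (rule sep)
    fix \<phi> assume \<phi>: "\<phi> \<in> funs" and even: "\<And>x. x \<in> carrier G \<Longrightarrow> \<phi> (a \<otimes> x) = (\<phi> x :: 'k)"
    let ?\<phi>' = "\<lambda>x\<in>carrier G. \<phi> (s x)"
    have even': "?\<phi>' (a \<otimes> x) = ?\<phi>' x" if "x \<in> carrier G" for x
      using that by (simp add: s_mult s_a even)
    let ?\<eta> = "\<lambda>y\<in>carrier G. if y = g then 1 else if y = a \<otimes> g then -1 else 0 :: 'k"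
    have eta_in: "?\<eta> \<in> funs" and \<phi>'_in: "?\<phi>' \<in> funs" by simp_all
    have eta_odd: "?\<eta> (a \<otimes> y) = - ?\<eta> y" if "y \<in> carrier G" for y
      using that g a_mult_neq[of g] by auto
    obtain \<psi> where \<psi>: "\<psi> \<in> funs" "F \<psi> = ?\<eta>" by (rule F_surj[OF eta_in])
    have \<psi>_odd: "\<psi> (a \<otimes> x) = - \<psi> x" if "x \<in> carrier G" for x
      by (rule F_odd[OF \<psi>(1) _ that]) (unfold \<psi>(2), rule eta_odd)
    have F_even: "F ?\<phi>' (a \<otimes> h) = F ?\<phi>' h" if "h \<in> carrier G" for h
      using F_even_iff[OF \<phi>'_in] even' that by blast
    have "twisted_mult s \<psi> \<phi> = twisted_mult s ?\<phi>' \<psi>"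
      by (subst twisted_mult_odd[of \<psi>], erule \<psi>_odd, subst twisted_mult_even[of ?\<phi>'], erule even')
        (intro restrict_ext, simp)
    then have "twisted_mult t ?\<eta> (F \<phi>) = twisted_mult t (F ?\<phi>') ?\<eta>"
      using F_mult[OF \<psi>(1) \<phi>] F_mult[OF \<phi>'_in \<psi>(1)] unfolding \<psi>(2) by argo
    moreover have "twisted_mult t ?\<eta> (F \<phi>) = (\<lambda>x\<in>carrier G. ?\<eta> x * F \<phi> (t x))"
      by (rule twisted_mult_odd) (erule eta_odd)
    moreover have "twisted_mult t (F ?\<phi>') ?\<eta> = (\<lambda>x\<in>carrier G. F ?\<phi>' x * ?\<eta> x)"
      by (rule twisted_mult_even) (erule F_even)
    ultimately have "(\<lambda>x\<in>carrier G. ?\<eta> x * F \<phi> (t x)) = (\<lambda>x\<in>carrier G. F ?\<phi>' x * ?\<eta> x)" by argo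
    from fun_cong[OF this, of g] have "F \<phi> (t g) = F ?\<phi>' g" using g by simp
    then show "\<phi> (P (t g)) = \<phi> (s (P g))"
      using FP[OF _ \<phi> even, of "t g"] FP[OF g \<phi>'_in even'] P[OF g] g by simp
  qed (use P g in simp_all)
  interpret H: group quot by (rule group_quot)
  have \<pi>_hom: "\<pi> \<in> hom G quot" using \<pi>_mult P by (auto simp: hom_def \<pi>_def coset_in_quot)
  interpret \<pi>: group_hom G quot \<pi> by unfold_locales (rule \<pi>_hom)
  have \<pi>1: "\<pi> \<one> = {\<one>, a}" using \<pi>.hom_one by simp
  have ker: "kernel G quot \<pi> = {\<one>, a}"
  proof -
    have "x = \<one> \<or> x = a" if "x \<in> carrier G" "\<pi> x = {\<one>, a}" for x
      using \<pi>_inj[OF that(1) one_closed] that(2) \<pi>1 by auto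
    moreover have "\<pi> a = {\<one>, a}" using \<pi>_a[OF one_closed] \<pi>1 by simp
    ultimately show ?thesis using \<pi>1 by (auto simp: kernel_def)
  qed
  let ?f = "\<lambda>C. the_elem (\<pi> ` C)"
  have f: "?f {g, a \<otimes> g} = \<pi> g" if "g \<in> carrier G" for g using \<pi>_a[OF that] by simp
  have hom: "?f \<in> hom quot quot" and inj: "inj_on ?f (carrier quot)"
    using \<pi>.FactGroup_hom \<pi>.FactGroup_inj_on unfolding ker by blast+
  have "finite (carrier quot)" using finite_carrier by (simp add: carrier_quot)
  moreover have "?f ` carrier quot \<subseteq> carrier quot" using hom unfolding hom_def by blast
  ultimately have "?f ` carrier quot = carrier quot" using inj by (rule endo_inj_surj)
  then have "?f \<in> iso quot quot" using hom inj by (simp add: iso_def bij_betw_def)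
  moreover have "s ` ?f C = ?f (t ` C)" if "C \<in> carrier quot" for C
  proof -
    obtain g where g: "g \<in> carrier G" "C = {g, a \<otimes> g}" using \<open>C \<in> carrier quot\<close> unfolding carrier_quot by blast
    have "t ` C = {t g, a \<otimes> t g}" using g by (simp add: t_mult t_a)
    then have "?f (t ` C) = \<pi> (t g)" using f[of "t g"] g(1) by simp
    moreover have "s ` ?f C = {s (P g), a \<otimes> s (P g)}"
      unfolding g(2) f[OF g(1)] using P[OF g(1)] by (simp add: \<pi>_def s_mult s_a)
    ultimately show ?thesis using \<pi>_t[OF g(1)] by simp
  qed
  ultimately show ?thesis by (intro bexI[of _ ?f] ballI)
qed

end

section \<open>Tensor products\<close>

text \<open>The functional \<open>l \<otimes> m\<close> on representatives in the free vector space.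
  For linear l and m it vanishes on \<open>tensor_null\<close>, so it is well defined on tensor
  classes and can read off coefficients.\<close>

definition tensor_eval :: "('v \<Rightarrow> 'k) \<Rightarrow> ('w \<Rightarrow> 'k) \<Rightarrow> (('v \<times> 'w) \<Rightarrow>\<^sub>0 'k) \<Rightarrow> 'k::field" where
  "tensor_eval l m p = (\<Sum>(v, w)\<in>Poly_Mapping.keys p. Poly_Mapping.lookup p (v, w) * (l v * m w))"

lemma tensor_eval_zero [simp]: "tensor_eval l m 0 = 0"
  by (simp add: tensor_eval_def)

lemma tensor_eval_single [simp]: "tensor_eval l m (Poly_Mapping.single (v, w) c) = c * (l v * m w)"
  by (simp add: tensor_eval_def)

lemma tensor_eval_add: "tensor_eval l m (p + q) = tensor_eval l m p + tensor_eval l m q"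
  using setsum_keys_plus_distrib[of "\<lambda>(v, w) c. c * (l v * m w)" p q]
  by (simp add: tensor_eval_def case_prod_beta distrib_right)

lemma tensor_eval_sum: "tensor_eval l m (sum p A) = (\<Sum>i\<in>A. tensor_eval l m (p i))"
  by (induction A rule: infinite_finite_induct) (simp_all add: tensor_eval_add)

lemma tensor_eval_diff: "tensor_eval l m (p - q) = tensor_eval l m p - tensor_eval l m q"
  using tensor_eval_add[of l m "p - q" q] by simp

lemma tensor_eval_null:
  assumes "p \<in> tensor_null V W"
    and "\<And>v v'. v \<in> carrier V \<Longrightarrow> v' \<in> carrier V \<Longrightarrow> l (v \<oplus>\<^bsub>V\<^esub> v') = l v + l v'"
    and "\<And>c v. v \<in> carrier V \<Longrightarrow> l (c \<odot>\<^bsub>V\<^esub> v) = c * l v"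
    and "\<And>w w'. w \<in> carrier W \<Longrightarrow> w' \<in> carrier W \<Longrightarrow> m (w \<oplus>\<^bsub>W\<^esub> w') = m w + m w'"
    and "\<And>c w. w \<in> carrier W \<Longrightarrow> m (c \<odot>\<^bsub>W\<^esub> w) = c * m w"
  shows "tensor_eval l m p = 0"
  using assms(1)
  by induction (simp_all add: tensor_eval_add tensor_eval_diff assms(2-) algebra_simps)

definition tensor_push :: "('v \<Rightarrow> 'v2) \<Rightarrow> ('w \<Rightarrow> 'w2) \<Rightarrow> (('v \<times> 'w) \<Rightarrow>\<^sub>0 'k) \<Rightarrow> (('v2 \<times> 'w2) \<Rightarrow>\<^sub>0 'k::field)" where
  "tensor_push f h p =
    (\<Sum>(v, w)\<in>Poly_Mapping.keys p. Poly_Mapping.single (f v, h w) (Poly_Mapping.lookup p (v, w)))"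

lemma tensor_push_zero [simp]: "tensor_push f h 0 = 0"
  by (simp add: tensor_push_def)

lemma tensor_push_single [simp]:
  "tensor_push f h (Poly_Mapping.single (v, w) c) = Poly_Mapping.single (f v, h w) c"
  by (simp add: tensor_push_def)

lemma tensor_push_add: "tensor_push f h (p + q) = tensor_push f h p + tensor_push f h q"
  using setsum_keys_plus_distrib[of "\<lambda>(v, w) c. Poly_Mapping.single (f v, h w) c" p q]
  by (simp add: tensor_push_def case_prod_beta single_add)

lemma tensor_push_sum: "tensor_push f h (sum p A) = (\<Sum>i\<in>A. tensor_push f h (p i))"
  by (induction A rule: infinite_finite_induct) (simp_all add: tensor_push_add)

lemma tensor_push_diff: "tensor_push f h (p - q) = tensor_push f h p - tensor_push f h q"
  using tensor_push_add[of f h "p - q" q] by simp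

lemma tensor_eval_push: "tensor_eval l m (tensor_push f h p) = tensor_eval (l \<circ> f) (m \<circ> h) p"
  unfolding tensor_push_def tensor_eval_sum by (simp add: case_prod_beta)
    (simp add: tensor_eval_def case_prod_beta)

lemma tensor_push_null:
  assumes "p \<in> tensor_null V W"
    and "\<And>v. v \<in> carrier V \<Longrightarrow> f v \<in> carrier V'" and "\<And>w. w \<in> carrier W \<Longrightarrow> h w \<in> carrier W'"
    and "\<And>v v'. v \<in> carrier V \<Longrightarrow> v' \<in> carrier V \<Longrightarrow> f (v \<oplus>\<^bsub>V\<^esub> v') = f v \<oplus>\<^bsub>V'\<^esub> f v'"
    and "\<And>c v. v \<in> carrier V \<Longrightarrow> f (c \<odot>\<^bsub>V\<^esub> v) = c \<odot>\<^bsub>V'\<^esub> f v"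
    and "\<And>w w'. w \<in> carrier W \<Longrightarrow> w' \<in> carrier W \<Longrightarrow> h (w \<oplus>\<^bsub>W\<^esub> w') = h w \<oplus>\<^bsub>W'\<^esub> h w'"
    and "\<And>c w. w \<in> carrier W \<Longrightarrow> h (c \<odot>\<^bsub>W\<^esub> w) = c \<odot>\<^bsub>W'\<^esub> h w"
  shows "tensor_push f h p \<in> tensor_null V' W'"
  using assms(1)
  by induction (simp_all add: tensor_push_add tensor_push_diff assms(2-) tensor_null.intros)

text \<open>Each generating relation stays a relation when its coefficient c is negated, which
  compensates for closure under addition only.\<close>

lemma tensor_null_uminus:
  assumes "p \<in> tensor_null V W"
  shows "- p \<in> tensor_null V W"
  using assms
proof induction
  case (add p q)
  then show ?case using tensor_null.add[of "- p" V W "- q"] by simp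
next
  case (add_left v v' w c)
  then show ?case using tensor_null.add_left[of v V v' w W "- c"] by (simp add: single_uminus algebra_simps)
next
  case (add_right v w w' c)
  then show ?case using tensor_null.add_right[of v V w W w' "- c"] by (simp add: single_uminus algebra_simps)
next
  case (smult_left v w a c)
  then show ?case using tensor_null.smult_left[of v V w W a "- c"] by (simp add: single_uminus algebra_simps)
next
  case (smult_right v w a c)
  then show ?case using tensor_null.smult_right[of v V w W a "- c"] by (simp add: single_uminus algebra_simps)
qed (simp add: tensor_null.zero)

lemma tensor_class_add_null:
  assumes "n \<in> tensor_null V W"
  shows "tensor_class V W (p + n) = tensor_class V W p"
  unfolding tensor_class_def
proof (intro equalityI subsetI)
  show "q \<in> (\<lambda>n. p + n) ` tensor_null V W" if "q \<in> (\<lambda>m. p + n + m) ` tensor_null V W" for q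
    using that assms by (auto simp: add.assoc intro: tensor_null.add)
  fix q assume "q \<in> (\<lambda>n. p + n) ` tensor_null V W"
  then obtain m where m: "m \<in> tensor_null V W" "q = p + m" by blast
  then have "- n + m \<in> tensor_null V W" using tensor_null_uminus[OF assms] by (intro tensor_null.add)
  then show "q \<in> (\<lambda>m. p + n + m) ` tensor_null V W"
    by (rule rev_image_eqI) (simp add: m(2))
qed

lemma tensor_map_alt: "tensor_map V' W' f h T = (\<Union>p\<in>T. tensor_class V' W' (tensor_push f h p))"
  by (simp add: tensor_map_def tensor_push_def)

text \<open>Representatives of one class differ by a null element, which linear maps send to a null
  element, so all classes united in \<open>tensor_map\<close> coincide.\<close>

lemma tensor_map_class:
  assumes "\<And>v. v \<in> carrier V \<Longrightarrow> f v \<in> carrier V'" and "\<And>w. w \<in> carrier W \<Longrightarrow> h w \<in> carrier W'"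
    and "\<And>v v'. v \<in> carrier V \<Longrightarrow> v' \<in> carrier V \<Longrightarrow> f (v \<oplus>\<^bsub>V\<^esub> v') = f v \<oplus>\<^bsub>V'\<^esub> f v'"
    and "\<And>c v. v \<in> carrier V \<Longrightarrow> f (c \<odot>\<^bsub>V\<^esub> v) = c \<odot>\<^bsub>V'\<^esub> f v"
    and "\<And>w w'. w \<in> carrier W \<Longrightarrow> w' \<in> carrier W \<Longrightarrow> h (w \<oplus>\<^bsub>W\<^esub> w') = h w \<oplus>\<^bsub>W'\<^esub> h w'"
    and "\<And>c w. w \<in> carrier W \<Longrightarrow> h (c \<odot>\<^bsub>W\<^esub> w) = c \<odot>\<^bsub>W'\<^esub> h w"
  shows "tensor_map V' W' f h (tensor_class V W p) = tensor_class V' W' (tensor_push f h p)"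
proof -
  have "tensor_class V' W' (tensor_push f h q) = tensor_class V' W' (tensor_push f h p)"
    if q: "q \<in> tensor_class V W p" for q
  proof -
    obtain n where n: "n \<in> tensor_null V W" "q = p + n" using q unfolding tensor_class_def by blast
    show ?thesis unfolding n(2) tensor_push_add
      by (rule tensor_class_add_null[OF tensor_push_null[OF n(1)]]) (fact assms)+
  qed
  moreover have "p \<in> tensor_class V W p"
    unfolding tensor_class_def by (rule image_eqI[OF _ tensor_null.zero]) simp
  ultimately show ?thesis unfolding tensor_map_alt by blast
qed

lemma tensor_null_subset:
  assumes "carrier V = carrier V'" "add V = add V'" "module.smult V = module.smult V'"
    and "carrier W = carrier W'" "add W = add W'" "module.smult W = module.smult W'"
  shows "tensor_null V W \<subseteq> tensor_null V' W'"
proof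
  show "p \<in> tensor_null V' W'" if "p \<in> tensor_null V W" for p
    using that by induction (simp_all add: assms tensor_null.intros)
qed

text \<open>Twisting leaves carrier, addition and scalar multiplication alone, so this identifies
  the tensor squares of both twistings with that of \<open>function_algebra G\<close>.\<close>

lemma tensor_null_cong:
  assumes "carrier V = carrier V'" "add V = add V'" "module.smult V = module.smult V'"
    and "carrier W = carrier W'" "add W = add W'" "module.smult W = module.smult W'"
  shows "tensor_null V W = tensor_null V' W'"
  by (intro equalityI tensor_null_subset) (simp_all only: assms)

section \<open>Graded twistings by the group of order two\<close>

lemma function_hopf_simps [simp]:
  "carrier (function_hopf G) = carrier G \<rightarrow>\<^sub>E UNIV"
  "monoid.mult (function_hopf G) = (\<lambda>\<phi> \<psi>. \<lambda>x\<in>carrier G. \<phi> x * \<psi> x)"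
  "one (function_hopf G) = (\<lambda>x\<in>carrier G. 1)"
  "ring.zero (function_hopf G) = (\<lambda>x\<in>carrier G. 0)"
  "add (function_hopf G) = (\<lambda>\<phi> \<psi>. \<lambda>x\<in>carrier G. \<phi> x + \<psi> x)"
  "module.smult (function_hopf G) = (\<lambda>c \<phi>. \<lambda>x\<in>carrier G. c * \<phi> x)"
  "comult (function_hopf G) = (\<lambda>\<phi>. tensor_class (function_algebra G) (function_algebra G)
        (\<Sum>(x, y)\<in>carrier G \<times> carrier G.
           Poly_Mapping.single (delta G x, delta G y) (\<phi> (x \<otimes>\<^bsub>G\<^esub> y))))"
  "counit (function_hopf G) = (\<lambda>\<phi>. \<phi> \<one>\<^bsub>G\<^esub>)"
  "antipode (function_hopf G) = (\<lambda>\<phi>. \<lambda>x\<in>carrier G. \<phi> (inv\<^bsub>G\<^esub> x))"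
  by (simp_all add: function_hopf_def function_algebra_def module.extend_def hopf.fields_def)

lemma function_algebra_simps [simp]:
  "carrier (function_algebra G) = carrier G \<rightarrow>\<^sub>E UNIV"
  "add (function_algebra G) = (\<lambda>\<phi> \<psi>. \<lambda>x\<in>carrier G. \<phi> x + \<psi> x)"
  "module.smult (function_algebra G) = (\<lambda>c \<phi>. \<lambda>x\<in>carrier G. c * \<phi> x)"
  by (simp_all add: function_algebra_def)

lemma graded_twist_simps [simp]:
  "carrier (graded_twist \<Gamma> G i \<alpha>) = carrier G \<rightarrow>\<^sub>E UNIV"
  "one (graded_twist \<Gamma> G i \<alpha>) = (\<lambda>x\<in>carrier G. 1)"
  "ring.zero (graded_twist \<Gamma> G i \<alpha>) = (\<lambda>x\<in>carrier G. 0)"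
  "add (graded_twist \<Gamma> G i \<alpha>) = (\<lambda>\<phi> \<psi>. \<lambda>x\<in>carrier G. \<phi> x + \<psi> x)"
  "module.smult (graded_twist \<Gamma> G i \<alpha>) = (\<lambda>c \<phi>. \<lambda>x\<in>carrier G. c * \<phi> x)"
  "comult (graded_twist \<Gamma> G i \<alpha>) = (\<lambda>\<phi>. tensor_class (function_algebra G) (function_algebra G)
        (\<Sum>(x, y)\<in>carrier G \<times> carrier G.
           Poly_Mapping.single (delta G x, delta G y) (\<phi> (x \<otimes>\<^bsub>G\<^esub> y))))"
  "counit (graded_twist \<Gamma> G i \<alpha>) = (\<lambda>\<phi>. \<phi> \<one>\<^bsub>G\<^esub>)"
  by (simp_all add: graded_twist_def)

abbreviation sign_character :: "int \<Rightarrow> 'k::field" where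
  "sign_character \<equiv> \<lambda>g\<in>{0, 1}. if g = 0 then 1 else -1"

section \<open>One cocentral action of Z_2 in terms of its central involution\<close>

locale cocentral_Z2 = central_involution +
  fixes i :: "(int \<Rightarrow> 'k::field_char_0) \<Rightarrow> 'a" and \<alpha> :: "int \<Rightarrow> 'a \<Rightarrow> 'a"
  assumes cocentral: "cocentral_action (integer_mod_group 2) G i \<alpha>"
    and image: "i ` carrier (dual_group (integer_mod_group 2)) = {\<one>, a}"
begin

lemma Z2_carrier: "carrier (integer_mod_group 2) = {0, 1}"
  by (auto simp: carrier_integer_mod_group)

lemma i_trivial: "i (\<lambda>g\<in>{0, 1}. 1) = \<one>"
  and i_sign: "i sign_character = a"
proof -
  let ?D = "dual_group (integer_mod_group 2) :: (int \<Rightarrow> 'k) monoid"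
  let ?t = "\<lambda>g\<in>{0, 1::int}. 1 :: 'k"
  have D: "carrier ?D = {?t, sign_character}" by (rule dual_integer_mod_group_2)
  have "?t \<otimes>\<^bsub>?D\<^esub> ?t = ?t"
    by (auto simp: hom_group_def carrier_integer_mod_group ring_of_type_algebra_def fun_eq_iff)
  moreover have "i (?t \<otimes>\<^bsub>?D\<^esub> ?t) = i ?t \<otimes> i ?t" "i ?t \<in> carrier G"
    using cocentral D unfolding cocentral_action_def hom_def by blast+
  ultimately show "i ?t = \<one>" by (metis r_cancel_one')
  then show "i sign_character = a" using image a_neq_one unfolding D by auto
qed

lemma action_auto:
  assumes "g \<in> {0, 1}"
  shows "\<alpha> g \<in> auto G"
proof -
  have "\<alpha> \<in> hom (integer_mod_group 2) (AutoGroup G)" using cocentral by (simp add: cocentral_action_def)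
  then have "\<alpha> g \<in> carrier (AutoGroup G)" by (rule hom_in_carrier) (simp only: Z2_carrier assms)
  then show ?thesis by (simp add: AutoGroup_def)
qed

lemma action_hom: "g \<in> {0, 1} \<Longrightarrow> \<alpha> g \<in> hom G G"
  using action_auto[of g] unfolding auto_def by (rule IntD1)

lemma action_closed: "g \<in> {0, 1} \<Longrightarrow> x \<in> carrier G \<Longrightarrow> \<alpha> g x \<in> carrier G"
  by (rule hom_in_carrier[OF action_hom])

lemma action_inj:
  assumes "g \<in> {0, 1}"
  shows "inj_on (\<alpha> g) (carrier G)"
  using action_auto[OF assms] by (simp add: auto_def Bij_def bij_betw_def)

lemma action_add:
  assumes "g \<in> {0, 1}" "h \<in> {0, 1}" "x \<in> carrier G"
  shows "\<alpha> ((g + h) mod 2) x = \<alpha> g (\<alpha> h x)"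
proof -
  have "\<alpha> \<in> hom (integer_mod_group 2) (AutoGroup G)" using cocentral by (simp add: cocentral_action_def)
  then have "\<alpha> (g \<otimes>\<^bsub>integer_mod_group 2\<^esub> h) = \<alpha> g \<otimes>\<^bsub>AutoGroup G\<^esub> \<alpha> h"
    by (rule hom_mult) (simp_all only: Z2_carrier assms)
  moreover have "\<alpha> g \<in> Bij (carrier G)" "\<alpha> h \<in> Bij (carrier G)"
    using action_auto[OF assms(1)] action_auto[OF assms(2)] by (simp_all add: auto_def)
  ultimately show ?thesis
    using assms(3) by (simp add: AutoGroup_def BijGroup_def compose_eq)
qed

lemma action_zero:
  assumes "x \<in> carrier G"
  shows "\<alpha> 0 x = x"
proof (rule inj_onD[OF action_inj[of 0]])
  show "\<alpha> 0 (\<alpha> 0 x) = \<alpha> 0 x" using action_add[of 0 0 x, symmetric] assms by simp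
qed (simp_all add: assms action_closed)

lemma action_one_one: "x \<in> carrier G \<Longrightarrow> \<alpha> 1 (\<alpha> 1 x) = x"
  using action_add[of 1 1 x] by (simp add: action_zero)

lemma action_a: "\<alpha> 1 a = a"
proof -
  have "\<alpha> 1 (i sign_character) = i sign_character"
    using cocentral unfolding cocentral_action_def Z2_carrier dual_integer_mod_group_2 by blast
  then show ?thesis by (simp add: i_sign)
qed

lemma inv_action: "g \<in> {0, 1} \<Longrightarrow> x \<in> carrier G \<Longrightarrow> inv_into (carrier G) (\<alpha> g) x = \<alpha> g x"
  by (rule inv_into_f_eq[OF action_inj]) (auto simp: action_closed action_zero action_one_one)

lemma homogeneous_iff:
  assumes "\<phi> \<in> funs"
  shows "\<phi> \<in> homogeneous (integer_mod_group 2) G i 0 \<longleftrightarrow> (\<forall>x\<in>carrier G. \<phi> (a \<otimes> x) = \<phi> x)"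
    and "\<phi> \<in> homogeneous (integer_mod_group 2) G i 1 \<longleftrightarrow> (\<forall>x\<in>carrier G. \<phi> (a \<otimes> x) = - \<phi> x)"
  using assms unfolding homogeneous_def dual_integer_mod_group_2
  by (simp_all add: i_sign i_trivial a_comm cong: ball_cong)

text \<open>The components are the even and odd parts. In any decomposition, translation by
  \<open>a\<close> fixes one summand and negates the other, so averaging recovers both; this gives
  the uniqueness that \<open>THE\<close> requires.\<close>

lemma components_eq:
  assumes \<phi>: "\<phi> \<in> funs"
  shows "components (integer_mod_group 2) G i \<phi> =
    (\<lambda>g\<in>{0, 1}. \<lambda>x\<in>carrier G. (if g = 0 then \<phi> x + \<phi> (a \<otimes> x) else \<phi> x - \<phi> (a \<otimes> x)) / 2)"
    (is "_ = ?c")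
  unfolding components_def Z2_carrier
proof (rule the_equality)
  have "(\<lambda>x\<in>carrier G. (\<phi> x + \<phi> (a \<otimes> x)) / 2) \<in> homogeneous (integer_mod_group 2) G i 0"
    by (subst homogeneous_iff(1)) (simp_all add: add.commute)
  moreover have "(\<lambda>x\<in>carrier G. (\<phi> x - \<phi> (a \<otimes> x)) / 2) \<in> homogeneous (integer_mod_group 2) G i 1"
    by (subst homogeneous_iff(2)) (simp_all add: field_simps)
  moreover have "\<phi> = (\<lambda>x\<in>carrier G. \<Sum>g\<in>{0, 1}. ?c g x)"
  proof (rule PiE_ext[OF \<phi>])
    have half: "(u + v) / 2 + (u - v) / 2 = u" for u v :: 'k by (simp add: field_simps)
    show "\<phi> x = (\<lambda>x\<in>carrier G. \<Sum>g\<in>{0, 1}. ?c g x) x" if "x \<in> carrier G" for x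
      using that by (simp add: half)
  qed simp
  ultimately show "?c \<in> (\<Pi>\<^sub>E g\<in>{0, 1}. homogeneous (integer_mod_group 2) G i g) \<and>
      \<phi> = (\<lambda>x\<in>carrier G. \<Sum>g\<in>{0, 1}. ?c g x)"
    by (intro conjI PiE_I) auto
next
  fix c assume c: "c \<in> (\<Pi>\<^sub>E g\<in>{0, 1}. homogeneous (integer_mod_group 2) G i g) \<and>
      \<phi> = (\<lambda>x\<in>carrier G. \<Sum>g\<in>{0, 1}. c g x)"
  have hom: "c 0 \<in> homogeneous (integer_mod_group 2) G i 0" "c 1 \<in> homogeneous (integer_mod_group 2) G i 1"
    using c by (auto simp: PiE_iff)
  then have in_funs: "c 0 \<in> funs" "c 1 \<in> funs" by (simp_all add: homogeneous_def)
  have ev: "c 0 (a \<otimes> x) = c 0 x" "c 1 (a \<otimes> x) = - c 1 x" if "x \<in> carrier G" for x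
    using homogeneous_iff[OF in_funs(1)] homogeneous_iff[OF in_funs(2)] hom that by blast+
  have \<phi>x: "\<phi> x = c 0 x + c 1 x" if "x \<in> carrier G" for x
    using c that by simp
  show "c = ?c"
  proof (rule PiE_ext[of _ "{0, 1}" "\<lambda>_. funs"])
    show "c \<in> {0, 1} \<rightarrow>\<^sub>E funs" using c in_funs by (auto simp: PiE_iff)
    show "c g = ?c g" if "g \<in> {0, 1}" for g
      by (rule PiE_ext[of _ "carrier G" "\<lambda>_. UNIV"]) (use that in_funs in \<open>auto simp: \<phi>x ev\<close>)
  qed simp
qed

lemma function_act_eq:
  assumes "g \<in> {0, 1}"
  shows "function_act G \<alpha> g \<phi> = (\<lambda>x\<in>carrier G. \<phi> (\<alpha> g x))"
  unfolding function_act_def compose_def by (rule restrict_ext) (simp only: inv_action[OF assms])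

lemma graded_twist_mult:
  assumes "\<phi> \<in> funs"
  shows "\<phi> \<otimes>\<^bsub>graded_twist (integer_mod_group 2) G i \<alpha>\<^esub> \<psi> = twisted_mult (\<alpha> 1) \<phi> \<psi>"
proof -
  have "\<phi> \<otimes>\<^bsub>graded_twist (integer_mod_group 2) G i \<alpha>\<^esub> \<psi> = (\<lambda>x\<in>carrier G.
      \<Sum>g\<in>{0, 1}. components (integer_mod_group 2) G i \<phi> g x * function_act G \<alpha> g \<psi> x)"
    unfolding graded_twist_def Z2_carrier by (simp cong: restrict_cong)
  also have "\<dots> = twisted_mult (\<alpha> 1) \<phi> \<psi>"
    unfolding twisted_mult_def components_eq[OF assms]
    by (rule restrict_ext) (simp add: function_act_eq action_zero)
  finally show ?thesis .
qed

lemma graded_twist_antipode: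
  assumes "\<phi> \<in> funs"
  shows "antipode (graded_twist (integer_mod_group 2) G i \<alpha>) \<phi> = (\<lambda>x\<in>carrier G.
    (\<phi> (inv x) + \<phi> (a \<otimes> inv x)) / 2 + (\<phi> (inv (\<alpha> 1 x)) - \<phi> (a \<otimes> inv (\<alpha> 1 x))) / 2)"
proof -
  have "antipode (graded_twist (integer_mod_group 2) G i \<alpha>) \<phi> = (\<lambda>x\<in>carrier G.
      \<Sum>g\<in>{0, 1}. function_act G \<alpha> ((- g) mod 2)
        (\<lambda>x\<in>carrier G. components (integer_mod_group 2) G i \<phi> g (inv x)) x)"
    unfolding graded_twist_def Z2_carrier
    by (simp add: inv_integer_mod_group Z2_carrier cong: restrict_cong)
  also have "\<dots> = (\<lambda>x\<in>carrier G.
    (\<phi> (inv x) + \<phi> (a \<otimes> inv x)) / 2 + (\<phi> (inv (\<alpha> 1 x)) - \<phi> (a \<otimes> inv (\<alpha> 1 x))) / 2)"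
    unfolding components_eq[OF assms]
    by (rule restrict_ext) (simp add: function_act_eq action_zero action_closed)
  finally show ?thesis .
qed

end

text \<open>The group of order two has only the identity automorphism, so the automorphism u
  disappears from both notions of equivalence.\<close>

lemma iso_Z2_id:
  assumes "u \<in> iso (integer_mod_group 2) (integer_mod_group 2)" and "g \<in> {0, 1}"
  shows "u g = g"
proof -
  have Z2: "carrier (integer_mod_group 2) = {0, 1}" by (auto simp: carrier_integer_mod_group)
  have "u 0 = 0"
    using hom_one[of u "integer_mod_group 2" "integer_mod_group 2"] assms(1) by (simp add: iso_def)
  moreover have "inj_on u {0, 1}" "u ` {0, 1} = {0, 1}"
    using assms(1) unfolding iso_def Z2 bij_betw_def by auto
  ultimately show ?thesis using assms(2) by (auto simp: inj_on_def)
qed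

section \<open>Two cocentral actions with the same central involution\<close>

locale cocentral_pair = i: cocentral_Z2 G a i \<alpha> + j: cocentral_Z2 G a j \<beta>
  for G :: "('a, 'x) monoid_scheme" (structure) and a
    and i j :: "(int \<Rightarrow> 'k::field_char_0) \<Rightarrow> 'a" and \<alpha> \<beta> :: "int \<Rightarrow> 'a \<Rightarrow> 'a"
begin

abbreviation "twist_i \<equiv> graded_twist (integer_mod_group 2) G i \<alpha>"
abbreviation "twist_j \<equiv> graded_twist (integer_mod_group 2) G j \<beta>"

text \<open>With u the identity, the condition on characters comes down to the sign character, which
  i and j both send to \<open>a\<close>, and the condition on actions to the nonzero element of Z_2,
  as the zero element acts trivially.\<close>

lemma equivalent_actions_iff:
  "equivalent_actions (integer_mod_group 2) G i \<alpha> j \<beta> \<longleftrightarrow>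
    (\<exists>f\<in>iso G G. f a = a \<and> (\<forall>x\<in>carrier G. \<alpha> 1 (f x) = f (\<beta> 1 x)))"
    (is "_ \<longleftrightarrow> ?R")
proof -
  let ?Z = "integer_mod_group 2"
  have id: "(\<lambda>g. g) \<in> iso ?Z ?Z" by (simp add: iso_def hom_def bij_betw_def)
  have dual: "dual_map ?Z u \<chi> = \<chi>"
    if "u \<in> iso ?Z ?Z" "\<chi> \<in> carrier (dual_group ?Z)" for u and \<chi> :: "int \<Rightarrow> 'k"
    using that(2) iso_Z2_id[OF that(1)]
    by (auto simp: dual_map_def compose_def i.Z2_carrier dual_integer_mod_group_2 fun_eq_iff)
  have inter: "(\<forall>g\<in>carrier ?Z. \<forall>x\<in>carrier G. inv_into (carrier G) f (\<alpha> g (f x)) = \<beta> (u g) x) \<longleftrightarrow>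
      (\<forall>x\<in>carrier G. \<alpha> 1 (f x) = f (\<beta> 1 x))" if f: "f \<in> iso G G" and u: "u \<in> iso ?Z ?Z" for f u
  proof -
    have inj: "inj_on f (carrier G)" and surj: "f ` carrier G = carrier G"
      using f by (auto simp: iso_def bij_betw_def)
    have fc: "f x \<in> carrier G" if "x \<in> carrier G" for x using surj that by blast
    have "inv_into (carrier G) f (\<alpha> g (f x)) = \<beta> g x \<longleftrightarrow> \<alpha> g (f x) = f (\<beta> g x)"
      if "g \<in> {0, 1}" "x \<in> carrier G" for g x
    proof
      assume "inv_into (carrier G) f (\<alpha> g (f x)) = \<beta> g x"
      then have "f (inv_into (carrier G) f (\<alpha> g (f x))) = f (\<beta> g x)" by simp
      moreover have "\<alpha> g (f x) \<in> f ` carrier G" unfolding surj by (rule i.action_closed[OF that(1) fc[OF that(2)]])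
      ultimately show "\<alpha> g (f x) = f (\<beta> g x)" by (simp add: f_inv_into_f)
    next
      assume "\<alpha> g (f x) = f (\<beta> g x)"
      then show "inv_into (carrier G) f (\<alpha> g (f x)) = \<beta> g x"
        using inv_into_f_f[OF inj j.action_closed[OF that]] by simp
    qed
    then show ?thesis
      using iso_Z2_id[OF u] fc by (simp add: i.Z2_carrier i.action_zero j.action_zero)
  qed
  have fixes_a: "(\<forall>\<chi>\<in>carrier (dual_group ?Z). i \<chi> = f (j \<chi>)) \<longleftrightarrow> f a = a" if f: "f \<in> iso G G" for f
  proof -
    have "f \<one> = \<one>" using hom_one[of f G G] f by (simp add: iso_def i.is_group)
    then show ?thesis
      by (auto simp: dual_integer_mod_group_2 i.i_trivial j.i_trivial i.i_sign j.i_sign)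
  qed
  show ?thesis
    unfolding equivalent_actions_def using id inter fixes_a dual by (auto cong: ball_cong bex_cong)
qed

lemma weakly_equivalent_actions_iff:
  "weakly_equivalent_actions (integer_mod_group 2) G i \<alpha> j \<beta> \<longleftrightarrow>
    (\<exists>f\<in>iso i.quot i.quot. \<forall>C\<in>carrier i.quot. \<alpha> 1 ` f C = f (\<beta> 1 ` C))"
proof -
  let ?Z = "integer_mod_group 2"
  have id: "(\<lambda>g. g) \<in> iso ?Z ?Z" by (simp add: iso_def hom_def bij_betw_def)
  have inter: "(\<forall>g\<in>carrier ?Z. \<forall>C\<in>carrier i.quot. inv_into (carrier i.quot) f (\<alpha> g ` f C) = \<beta> (u g) ` C) \<longleftrightarrow>
      (\<forall>C\<in>carrier i.quot. \<alpha> 1 ` f C = f (\<beta> 1 ` C))"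
    if f: "f \<in> iso i.quot i.quot" and u: "u \<in> iso ?Z ?Z" for f u
  proof -
    have inj: "inj_on f (carrier i.quot)" and surj: "f ` carrier i.quot = carrier i.quot"
      using f by (auto simp: iso_def bij_betw_def)
    have fc: "f C \<in> carrier i.quot" if "C \<in> carrier i.quot" for C using surj that by blast
    have ac: "\<alpha> 1 ` C \<in> carrier i.quot" "\<alpha> 0 ` C = C" if "C \<in> carrier i.quot" for C
      using that hom_mult[OF i.action_hom[of 1]]
      by (auto simp: i.carrier_quot i.action_closed i.action_zero i.action_a intro!: imageI)
    have bc: "\<beta> 1 ` C \<in> carrier i.quot" "\<beta> 0 ` C = C" if "C \<in> carrier i.quot" for C
      using that hom_mult[OF j.action_hom[of 1]]
      by (auto simp: i.carrier_quot j.action_closed j.action_zero j.action_a intro!: imageI)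
    have "inv_into (carrier i.quot) f (\<alpha> 1 ` f C) = \<beta> 1 ` C \<longleftrightarrow> \<alpha> 1 ` f C = f (\<beta> 1 ` C)"
      if "C \<in> carrier i.quot" for C
    proof
      assume "inv_into (carrier i.quot) f (\<alpha> 1 ` f C) = \<beta> 1 ` C"
      then have "f (inv_into (carrier i.quot) f (\<alpha> 1 ` f C)) = f (\<beta> 1 ` C)" by simp
      moreover have "\<alpha> 1 ` f C \<in> f ` carrier i.quot" unfolding surj by (rule ac(1)[OF fc[OF that]])
      ultimately show "\<alpha> 1 ` f C = f (\<beta> 1 ` C)" by (simp add: f_inv_into_f)
    next
      assume "\<alpha> 1 ` f C = f (\<beta> 1 ` C)"
      then show "inv_into (carrier i.quot) f (\<alpha> 1 ` f C) = \<beta> 1 ` C"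
        using inv_into_f_f[OF inj bc(1)[OF that]] by simp
    qed
    then show ?thesis
      using iso_Z2_id[OF u] fc ac(2) bc(2) inv_into_f_f[OF inj] by (simp add: i.Z2_carrier)
  qed
  show ?thesis
    unfolding weakly_equivalent_actions_def i.image j.image Let_def using id inter by (auto cong: bex_cong)
qed

lemma equivalent_imp_weakly_equivalent:
  assumes f: "f \<in> iso G G" and fa: "f a = a" and inter: "\<And>x. x \<in> carrier G \<Longrightarrow> \<alpha> 1 (f x) = f (\<beta> 1 x)"
  shows "\<exists>h\<in>iso i.quot i.quot. \<forall>C\<in>carrier i.quot. \<alpha> 1 ` h C = h (\<beta> 1 ` C)"
proof (intro bexI[of _ "\<lambda>C. f ` C"] ballI)
  have fc: "f x \<in> carrier G" if "x \<in> carrier G" for x using f that by (auto simp: iso_def hom_def)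
  have fm: "f (x \<otimes> y) = f x \<otimes> f y" if "x \<in> carrier G" "y \<in> carrier G" for x y
    using f that by (auto simp: iso_def hom_def)
  have inj: "inj_on f (carrier G)" and surj: "f ` carrier G = carrier G"
    using f by (auto simp: iso_def bij_betw_def)
  have coset: "f ` {x, a \<otimes> x} = {f x, a \<otimes> f x}" if "x \<in> carrier G" for x
    using that by (simp add: fm fa)
  show "\<alpha> 1 ` f ` C = f ` \<beta> 1 ` C" if "C \<in> carrier i.quot" for C
  proof -
    have "C \<subseteq> carrier G" using that by (auto simp: i.carrier_quot)
    then show ?thesis unfolding image_image by (intro image_cong refl inter) (rule subsetD)
  qed
  show "(\<lambda>C. f ` C) \<in> iso i.quot i.quot"
    unfolding iso_def
  proof (intro CollectI conjI homI)
    fix C D assume "C \<in> carrier i.quot" "D \<in> carrier i.quot"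
    then obtain x y where xy: "C = {x, a \<otimes> x}" "D = {y, a \<otimes> y}" "x \<in> carrier G" "y \<in> carrier G"
      unfolding i.carrier_quot by blast
    show "f ` C \<in> carrier i.quot" using xy by (simp only: coset i.coset_in_quot fc)
    show "f ` (C \<otimes>\<^bsub>i.quot\<^esub> D) = f ` C \<otimes>\<^bsub>i.quot\<^esub> f ` D"
      using xy by (simp only: mult_FactGroup i.quot_mult coset fc fm i.m_closed)
  next
    show "bij_betw (\<lambda>C. f ` C) (carrier i.quot) (carrier i.quot)"
      unfolding bij_betw_def
    proof
      show "inj_on (\<lambda>C. f ` C) (carrier i.quot)"
        by (rule inj_on_subset[OF inj_on_image_Pow[OF inj]]) (auto simp: i.carrier_quot)
      have "(\<lambda>C. f ` C) ` carrier i.quot = (\<lambda>x. {x, a \<otimes> x}) ` f ` carrier G"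
        unfolding i.carrier_quot image_image by (rule image_cong) (simp_all only: coset)
      then show "(\<lambda>C. f ` C) ` carrier i.quot = carrier i.quot" by (simp only: surj i.carrier_quot)
    qed
  qed
qed

text \<open>Pullback along f respects parity because f fixes \<open>a\<close>, and it turns
  \<open>\<alpha> 1\<close> into \<open>\<beta> 1\<close>, so it carries one twisted product and
  antipode to the other.\<close>

lemma equivalent_imp_hopf_isomorphic:
  assumes f: "f \<in> iso G G" and fa: "f a = a" and inter: "\<And>x. x \<in> carrier G \<Longrightarrow> \<alpha> 1 (f x) = f (\<beta> 1 x)"
  shows "hopf_isomorphic twist_i twist_j"
proof -
  have fc: "f x \<in> carrier G" if "x \<in> carrier G" for x using f that by (auto simp: iso_def hom_def)
  have fm: "f (x \<otimes> y) = f x \<otimes> f y" if "x \<in> carrier G" "y \<in> carrier G" for x y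
    using f that by (auto simp: iso_def hom_def)
  have bij: "bij_betw f (carrier G) (carrier G)" using f by (simp add: iso_def)
  have f1: "f \<one> = \<one>" using hom_one[of f G G] f by (simp add: iso_def i.is_group)
  interpret f: group_hom G G f by unfold_locales (use f in \<open>simp add: iso_def\<close>)
  have finv: "f (inv x) = inv (f x)" if "x \<in> carrier G" for x using that by (rule f.hom_inv)
  define F :: "('a \<Rightarrow> 'k) \<Rightarrow> 'a \<Rightarrow> 'k" where "F \<phi> = (\<lambda>x\<in>carrier G. \<phi> (f x))" for \<phi>
  define f' where "f' = inv_into (carrier G) f"
  have f': "f' x \<in> carrier G" "f (f' x) = x" "f' (f x) = x" if "x \<in> carrier G" for x
    using bij that inv_into_f_f[of f "carrier G" x] f_inv_into_f[of x f "carrier G"] inv_into_into[of x f "carrier G"]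
    by (simp_all add: f'_def bij_betw_def)
  have F_bij: "bij_betw F i.funs i.funs"
  proof (rule bij_betwI[where g = "\<lambda>\<psi>. \<lambda>x\<in>carrier G. \<psi> (f' x)"])
    show "(\<lambda>x\<in>carrier G. F \<phi> (f' x)) = \<phi>" if "\<phi> \<in> i.funs" for \<phi>
      by (rule PiE_ext[OF _ that]) (simp_all add: F_def f')
    show "F (\<lambda>x\<in>carrier G. \<psi> (f' x)) = \<psi>" if "\<psi> \<in> i.funs" for \<psi>
      by (rule PiE_ext[OF _ that]) (simp_all add: F_def f' fc)
  qed (simp_all add: F_def)
  have F_in: "F \<phi> \<in> i.funs" for \<phi> by (simp add: F_def)
  have delta: "F (delta G x) = delta G (f' x)" if "x \<in> carrier G" for x
  proof -
    have "f y = x \<longleftrightarrow> y = f' x" if "y \<in> carrier G" for y using f' that \<open>x \<in> carrier G\<close> by metis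
    then show ?thesis unfolding F_def delta_def by (intro restrict_ext) (simp add: fc)
  qed
  have mult: "F (i.twisted_mult (\<alpha> 1) \<phi> \<psi>) = i.twisted_mult (\<beta> 1) (F \<phi>) (F \<psi>)" for \<phi> \<psi>
    unfolding F_def i.twisted_mult_def
    by (rule restrict_ext) (simp add: fc fm fa inter i.action_closed j.action_closed)
  have ring: "F \<in> ring_iso twist_i twist_j"
    unfolding ring_iso_def
  proof (intro CollectI conjI ring_hom_memI)
    fix \<phi> \<psi> assume "\<phi> \<in> carrier twist_i" "\<psi> \<in> carrier twist_i"
    then have in_funs: "\<phi> \<in> i.funs" "\<psi> \<in> i.funs" by simp_all
    show "F (\<phi> \<otimes>\<^bsub>twist_i\<^esub> \<psi>) = F \<phi> \<otimes>\<^bsub>twist_j\<^esub> F \<psi>"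
      by (simp only: i.graded_twist_mult[OF in_funs(1)] j.graded_twist_mult[OF F_in] mult)
    show "F (\<phi> \<oplus>\<^bsub>twist_i\<^esub> \<psi>) = F \<phi> \<oplus>\<^bsub>twist_j\<^esub> F \<psi>"
      by (simp add: F_def fc fun_eq_iff)
  next
    show "F \<one>\<^bsub>twist_i\<^esub> = \<one>\<^bsub>twist_j\<^esub>" by (simp add: F_def fc fun_eq_iff)
  qed (simp_all add: F_in F_bij)
  have null: "tensor_class twist_j twist_j = tensor_class (function_algebra G) (function_algebra G)"
    unfolding tensor_class_def by (subst tensor_null_cong[of twist_j "function_algebra G" twist_j "function_algebra G"]) simp_all
  have comult: "comult twist_j (F \<phi>) = tensor_map twist_j twist_j F F (comult twist_i \<phi>)" for \<phi>
  proof -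
    have "tensor_map twist_j twist_j F F (comult twist_i \<phi>) = tensor_class twist_j twist_j
       (tensor_push F F (\<Sum>(x, y)\<in>carrier G \<times> carrier G.
           Poly_Mapping.single (delta G x, delta G y) (\<phi> (x \<otimes> y))))"
      unfolding graded_twist_simps by (rule tensor_map_class) (auto simp: F_def fc)
    also have "tensor_push F F (\<Sum>(x, y)\<in>carrier G \<times> carrier G.
           Poly_Mapping.single (delta G x, delta G y) (\<phi> (x \<otimes> y))) =
        (\<Sum>(x, y)\<in>carrier G \<times> carrier G. Poly_Mapping.single (delta G (f' x), delta G (f' y)) (\<phi> (x \<otimes> y)))"
      unfolding tensor_push_sum by (rule sum.cong) (auto simp: delta)
    also have "\<dots> = (\<Sum>(x, y)\<in>carrier G \<times> carrier G. Poly_Mapping.single (delta G x, delta G y) (F \<phi> (x \<otimes> y)))"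
      by (rule sum.reindex_bij_witness[of _ "map_prod f f" "map_prod f' f'"]) (auto simp: f' fc F_def fm)
    finally show ?thesis unfolding null by simp
  qed
  have antipode: "antipode twist_j (F \<phi>) = F (antipode twist_i \<phi>)" if "\<phi> \<in> i.funs" for \<phi>
    unfolding i.graded_twist_antipode[OF that] j.graded_twist_antipode[OF F_in]
    unfolding F_def by (rule restrict_ext) (simp add: fc fm fa finv inter i.action_closed j.action_closed)
  have "F \<in> hopf_iso twist_i twist_j"
    unfolding hopf_iso_def
    by (intro CollectI conjI ballI allI ring comult antipode) (simp_all add: F_def fc f1 fun_eq_iff)
  then show ?thesis unfolding hopf_isomorphic_def by blast
qed

text \<open>Comultiplications are compared in the tensor square, where representatives agree up to a
  null element. Applying evaluation at g in the first leg and at h in the second removes it and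
  leaves an identity of scalars.\<close>

lemma hopf_iso_comult:
  assumes F: "F \<in> hopf_iso twist_i twist_j" and \<phi>: "\<phi> \<in> i.funs"
    and g: "g \<in> carrier G" and h: "h \<in> carrier G"
  shows "F \<phi> (g \<otimes> h) = (\<Sum>x\<in>carrier G. \<Sum>y\<in>carrier G. \<phi> (x \<otimes> y) * (F (delta G x) g * F (delta G y) h))"
proof -
  let ?O = "function_algebra G :: ('k, 'a \<Rightarrow> 'k) module"
  let ?D = "\<lambda>\<phi> :: 'a \<Rightarrow> 'k. \<Sum>(x, y)\<in>carrier G \<times> carrier G.
    Poly_Mapping.single (delta G x, delta G y :: 'a \<Rightarrow> 'k) (\<phi> (x \<otimes> y))"
  let ?ev = "tensor_eval (\<lambda>\<psi>. \<psi> g) (\<lambda>\<psi>. \<psi> h)"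
  have null: "tensor_null twist_j twist_j = tensor_null ?O ?O"
    by (rule tensor_null_cong) simp_all
  have "?D \<phi> \<in> comult twist_i \<phi>"
    unfolding graded_twist_simps tensor_class_def by (rule image_eqI[OF _ tensor_null.zero]) simp
  moreover have "tensor_push F F (?D \<phi>) \<in> tensor_class twist_j twist_j (tensor_push F F (?D \<phi>))"
    unfolding tensor_class_def by (rule image_eqI[OF _ tensor_null.zero]) simp
  ultimately have "tensor_push F F (?D \<phi>) \<in> tensor_map twist_j twist_j F F (comult twist_i \<phi>)"
    unfolding tensor_map_alt by blast
  also have "\<dots> = comult twist_j (F \<phi>)" using F \<phi> by (simp add: hopf_iso_def)
  finally obtain n where n: "n \<in> tensor_null ?O ?O" "tensor_push F F (?D \<phi>) = ?D (F \<phi>) + n"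
    unfolding graded_twist_simps tensor_class_def by blast
  have "?ev n = 0" by (rule tensor_eval_null[OF n(1)]) (simp_all add: g h)
  then have "?ev (?D (F \<phi>)) = ?ev (tensor_push F F (?D \<phi>))" by (simp add: n(2) tensor_eval_add)
  also have "\<dots> = (\<Sum>(x, y)\<in>carrier G \<times> carrier G. \<phi> (x \<otimes> y) * (F (delta G x) g * F (delta G y) h))"
    unfolding tensor_eval_push tensor_eval_sum by (rule sum.cong) auto
  also have "?ev (?D (F \<phi>)) = (\<Sum>(x, y)\<in>carrier G \<times> carrier G. F \<phi> (x \<otimes> y) * (delta G x g * delta G y h))"
    unfolding tensor_eval_sum by (rule sum.cong) auto
  also have "\<dots> = (\<Sum>x\<in>carrier G. (\<Sum>y\<in>carrier G. F \<phi> (x \<otimes> y) * delta G h y) * delta G g x)"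
    unfolding sum.cartesian_product[symmetric] sum_distrib_right
    by (intro sum.cong refl) (auto simp: delta_def g h)
  also have "\<dots> = F \<phi> (g \<otimes> h)" using g h by (simp add: i.sum_delta_mult)
  finally show ?thesis unfolding sum.cartesian_product .
qed

end

section \<open>Assembling the equivalence of the three assertions\<close>

lemma (in group) subgroup_group_center: "subgroup (group_center G) G"
proof (rule subgroupI)
  fix z assume z: "z \<in> group_center G"
  then have zc: "z \<in> carrier G" and comm: "\<And>x. x \<in> carrier G \<Longrightarrow> z \<otimes> x = x \<otimes> z"
    unfolding group_center_def by blast+
  have "inv z \<otimes> x = x \<otimes> inv z" if x: "x \<in> carrier G" for x
  proof -
    have "z \<otimes> (x \<otimes> inv z) = x" using comm[of "x \<otimes> inv z"] x zc by (simp add: m_assoc)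
    then show ?thesis using x zc by (metis inv_closed inv_solve_left m_closed)
  qed
  then show "inv z \<in> group_center G" using zc unfolding group_center_def by blast
  fix w assume "w \<in> group_center G"
  then have wc: "w \<in> carrier G" and comm': "\<And>x. x \<in> carrier G \<Longrightarrow> w \<otimes> x = x \<otimes> w"
    unfolding group_center_def by blast+
  have "(z \<otimes> w) \<otimes> x = x \<otimes> (z \<otimes> w)" if x: "x \<in> carrier G" for x
  proof -
    have "(z \<otimes> w) \<otimes> x = z \<otimes> (x \<otimes> w)" using x zc wc comm'[OF x] by (simp add: m_assoc)
    also have "\<dots> = x \<otimes> (z \<otimes> w)" using x zc wc comm[OF x] by (simp flip: m_assoc)
    finally show ?thesis .
  qed
  then show "z \<otimes> w \<in> group_center G" using zc wc unfolding group_center_def by blast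
next
  have "\<one> \<in> group_center G" by (simp add: group_center_def)
  then show "group_center G \<noteq> {}" by blast
qed (simp add: group_center_def subset_eq)

lemma (in cocentral_pair) hopf_isomorphic_imp_weakly_equivalent:
  assumes iso: "hopf_isomorphic twist_i twist_j"
    and no_sign: "no_sign_quotient G a"
    and center: "\<And>z. z \<in> carrier G \<Longrightarrow> (\<And>x. x \<in> carrier G \<Longrightarrow> z \<otimes> x = x \<otimes> z) \<Longrightarrow>
      z \<otimes> z = \<one> \<Longrightarrow> z \<noteq> \<one> \<Longrightarrow> z = a"
  shows "\<exists>f\<in>iso i.quot i.quot. \<forall>C\<in>carrier i.quot. \<alpha> 1 ` f C = f (\<beta> 1 ` C)"
proof -
  obtain F where F: "F \<in> hopf_iso twist_i twist_j" using iso unfolding hopf_isomorphic_def by blast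
  then have hom: "F \<in> ring_hom twist_i twist_j" and bij: "bij_betw F i.funs i.funs"
    by (simp_all add: hopf_iso_def ring_iso_def)
  have in_funs: "F \<phi> \<in> i.funs" if "\<phi> \<in> i.funs" for \<phi>
    using that by (rule bij_betw_apply[OF bij])
  interpret no_sign_quotient G a by (rule no_sign)
  interpret twist_isomorphism G a "\<alpha> 1" "\<beta> 1" F
  proof unfold_locales
    show "F (\<lambda>x\<in>carrier G. 1) = (\<lambda>x\<in>carrier G. 1)"
      using ring_hom_one[OF hom] by simp
    show "F (i.twisted_mult (\<alpha> 1) \<phi> \<psi>) = i.twisted_mult (\<beta> 1) (F \<phi>) (F \<psi>)"
      if "\<phi> \<in> i.funs" "\<psi> \<in> i.funs" for \<phi> \<psi>
      using ring_hom_mult[OF hom, of \<phi> \<psi>] that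
      unfolding i.graded_twist_mult[OF that(1)] j.graded_twist_mult[OF in_funs[OF that(1)]] by simp
    show "F \<phi> \<one> = \<phi> \<one>" if "\<phi> \<in> i.funs" for \<phi>
      using F that by (simp add: hopf_iso_def)
    show "F \<phi> (g \<otimes> h) = (\<Sum>x\<in>carrier G. \<Sum>y\<in>carrier G. \<phi> (x \<otimes> y) * (F (delta G x) g * F (delta G y) h))"
      if "\<phi> \<in> i.funs" "g \<in> carrier G" "h \<in> carrier G" for \<phi> g h
      by (rule hopf_iso_comult[OF F that])
    show "z = a" if "z \<in> carrier G" "\<And>x. x \<in> carrier G \<Longrightarrow> z \<otimes> x = x \<otimes> z" "z \<otimes> z = \<one>" "z \<noteq> \<one>" for z
      using that by (rule center)
    show "\<alpha> 1 \<in> hom G G" "\<beta> 1 \<in> hom G G" by (rule i.action_hom j.action_hom, simp)+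
  qed (fact i.action_a j.action_a bij)+
  show ?thesis by (rule ex_quotient_automorphism)
qed

theorem theorem3p3:
  fixes G :: "('a, 'x) monoid_scheme"
    and i j :: "(int \<Rightarrow> 'k::{alg_closed_field, field_char_0}) \<Rightarrow> 'a"
    and \<alpha> \<beta> :: "int \<Rightarrow> 'a \<Rightarrow> 'a"
    and H :: "'a set monoid"
  assumes "group G" and "finite (carrier G)"
    and "cyclic_group (G\<lparr>carrier := group_center G\<rparr>)"
    and "cocentral_action (integer_mod_group 2) G i \<alpha>"
    and "cocentral_action (integer_mod_group 2) G j \<beta>"
    and "H = G Mod (i ` carrier (dual_group (integer_mod_group 2)))"
    and "cyclic_group (cohomology2 H (field_units :: 'k monoid))"
    and "carrier (hom_group H (integer_mod_group 2)) = {\<one>\<^bsub>hom_group H (integer_mod_group 2)\<^esub>}"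
  shows "(hopf_isomorphic (graded_twist (integer_mod_group 2) G i \<alpha>)
                          (graded_twist (integer_mod_group 2) G j \<beta>)
            \<longleftrightarrow> equivalent_actions (integer_mod_group 2) G i \<alpha> j \<beta>)
       \<and> (equivalent_actions (integer_mod_group 2) G i \<alpha> j \<beta>
            \<longleftrightarrow> weakly_equivalent_actions (integer_mod_group 2) G i \<alpha> j \<beta>)"
proof -
  interpret group G by fact
  obtain a where a: "i ` carrier (dual_group (integer_mod_group 2)) = {\<one>\<^bsub>G\<^esub>, a}"
      "a \<in> group_center G" "a \<noteq> \<one>\<^bsub>G\<^esub>" "a \<otimes>\<^bsub>G\<^esub> a = \<one>\<^bsub>G\<^esub>"
    by (rule cocentral_image_2[OF assms(4)])
  have j_image: "j ` carrier (dual_group (integer_mod_group 2)) = {\<one>\<^bsub>G\<^esub>, a}"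
    using cocentral_images_coincide[OF assms(3-5)] a(1) by simp
  have H: "H = G Mod {\<one>\<^bsub>G\<^esub>, a}" using assms(6) a(1) by simp
  interpret central_involution G a
  proof unfold_locales
    show "a \<in> carrier G" using a(2) by (simp add: group_center_def)
    show "x \<otimes>\<^bsub>G\<^esub> a = a \<otimes>\<^bsub>G\<^esub> x" if "x \<in> carrier G" for x
      using a(2) that by (intro sym[of "a \<otimes>\<^bsub>G\<^esub> x"]) (simp only: group_center_def mem_Collect_eq)
  qed (fact assms a)+
  interpret cocentral_pair G a i j \<alpha> \<beta>
    by unfold_locales (fact assms a j_image)+
  interpret no_sign_quotient G a
    by unfold_locales (use assms(8) in \<open>simp only: H\<close>)
  \<comment> \<open>Cyclicity of the center, used above for the common image of i and j, also makes
    \<open>a\<close> the only central involution.\<close>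
  have center: "z = a" if z: "z \<in> carrier G" "\<And>x. x \<in> carrier G \<Longrightarrow> z \<otimes>\<^bsub>G\<^esub> x = x \<otimes>\<^bsub>G\<^esub> z"
    "z \<otimes>\<^bsub>G\<^esub> z = \<one>\<^bsub>G\<^esub>" "z \<noteq> \<one>\<^bsub>G\<^esub>" for z
  proof -
    let ?Z = "G\<lparr>carrier := group_center G\<rparr>"
    interpret Z: group ?Z by (rule subgroup_imp_group[OF subgroup_group_center])
    have "z \<in> group_center G" using z(1,2) unfolding group_center_def by blast
    then show ?thesis
      using Z.cyclic_group_involution_unique[OF assms(3), of z a] z(3,4) a(2-4) by simp
  qed
  \<comment> \<open>Assertion (3) implies (2); assertion (1) also reaches (2) along this way, since
    an isomorphism of the twistings gives (3).\<close>
  have lift: "equivalent_actions (integer_mod_group 2) G i \<alpha> j \<beta>"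
    if weak: "\<exists>f\<in>iso quot quot. \<forall>C\<in>carrier quot. \<alpha> 1 ` f C = f (\<beta> 1 ` C)"
  proof -
    obtain f where f: "f \<in> iso quot quot" "\<And>C. C \<in> carrier quot \<Longrightarrow> \<alpha> 1 ` f C = f (\<beta> 1 ` C)"
      using weak by blast
    have cyc: "cyclic_group (cohomology2 quot (field_units :: 'k monoid))" using assms(7) by (simp only: H)
    obtain g where "g \<in> iso G G" "g a = a" "\<And>x. x \<in> carrier G \<Longrightarrow> \<alpha> 1 (g x) = g (\<beta> 1 x)"
      using lift_weak_equivalence[OF cyc f(1) i.action_hom[of 1] i.action_a j.action_hom[of 1] j.action_a f(2)]
      by blast
    then show ?thesis unfolding equivalent_actions_iff by blast
  qed
  have "equivalent_actions (integer_mod_group 2) G i \<alpha> j \<beta>" if "hopf_isomorphic twist_i twist_j"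
    by (rule lift, rule hopf_isomorphic_imp_weakly_equivalent[OF that no_sign_quotient_axioms], rule center)
  moreover have "hopf_isomorphic twist_i twist_j"
    and "weakly_equivalent_actions (integer_mod_group 2) G i \<alpha> j \<beta>"
    if "equivalent_actions (integer_mod_group 2) G i \<alpha> j \<beta>"
  proof -
    from that obtain f where "f \<in> iso G G" "f a = a" "\<forall>x\<in>carrier G. \<alpha> 1 (f x) = f (\<beta> 1 x)"
      unfolding equivalent_actions_iff by blast
    then show "hopf_isomorphic twist_i twist_j"
      and "weakly_equivalent_actions (integer_mod_group 2) G i \<alpha> j \<beta>"
      unfolding weakly_equivalent_actions_iff
      by (simp_all only: equivalent_imp_hopf_isomorphic equivalent_imp_weakly_equivalent)
  qed
  moreover have "equivalent_actions (integer_mod_group 2) G i \<alpha> j \<beta>"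
    if "weakly_equivalent_actions (integer_mod_group 2) G i \<alpha> j \<beta>"
    using that unfolding weakly_equivalent_actions_iff by (rule lift)
  ultimately show ?thesis by argo
qed

end
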